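(* Fix a function symbol $\mathsf f$ and a size substitution $\varphi:\{\vec\alpha^{\mathsf f}\}\to\bar{\mathcal A}$. Assume that: (1) the size algebra $\mathcal A$ is monotone, i.e. every size function symbol $\mathtt f$ satisfies $\mathtt f\,a_1\ldots a_n\preceq\mathtt f\,b_1\ldots b_n$ whenever $a_i\preceq b_i$ for one $i$ and $a_j=b_j$ for $j\ne i$; (2) $\mathcal A$ contains an infinite set $\mathcal C$ of constants such that, whenever $a\preceq b$ (resp. $\vec a<^{\mathsf g,\mathsf f}_{\mathcal A}\vec b$), then for all $\mathtt c\in\mathcal C$ and $e\in\mathcal A$ we have $a\delta\preceq b\delta$ (resp. $\vec a\delta<^{\mathsf g,\mathsf f}_{\mathcal A}\vec b\delta$), where $\delta$ replaces every occurrence of $\mathtt c$ by $e$; (3) $<_{\mathbb F}$ is decidable and, for every $\mathsf g\simeq_{\mathbb F}\mathsf f$, the relation $<^{\mathsf g,\mathsf f}_{\mathcal A}$ is decidable; (4) the satisfiability of a subtyping problem is decidable; (5) every satisfiable subtyping problem $P$ has a most general solution that is computable. Then, given a typing environment $\Gamma$, a term $t$ and an annotated type $T$, it is decidable whether $\Gamma\vdash^{\mathsf f}_\varphi t:T$.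
   Context: Types: given a nonempty countable set of sorts $\mathbb S$, simple types are sorts and $U\Rightarrow V$. Terms: given disjoint countable sets of variables $\mathbb V$ (infinite), constructors $\mathbb C$ and function symbols $\mathbb F$, terms are variables, constructors, function symbols, abstractions $\lambda x^U u$ and applications $t\,u$, modulo $\alpha$-equivalence; each $s\in\mathbb C\cup\mathbb F$ has a simple type $\Theta(s)$. Size algebra: a set $\mathcal A$ of first-order terms over size variables $\mathcal V$ and size function symbols, with a quasi-order $\preceq$ and a strict order $\prec\subseteq\preceq$, both stable by substitution, and an interpretation of each size symbol as a function on an ordinal compatible with $\preceq,\prec$. $\bar{\mathcal A}=\mathcal A\cup\{\infty\}$, $a\preceq_\infty b$ iff $a\preceq b$ or $b=\infty$; a size substitution maps size variables to $\bar{\mathcal A}$ and $a\varphi=\infty$ whenever $a$ contains a variable mapped to $\infty$. Annotated types: $\mathsf B_a$ ($a\in\bar{\mathcal A}$, with $\mathsf B=\mathsf B_\infty$) and $U\Rightarrow V$; size substitutions act componentwise. Subtyping $\le$: smallest relation with $\mathsf B_a\le\mathsf B_b$ if $a\preceq_\infty b$, $U\Rightarrow V\le U'\Rightarrow V'$ if $U'\le U$ and $V\le V'$, reflexive and transitive. Each constructor $\mathsf c$ has an annotated type $\bar\Theta(\mathsf c)$ whose erasure is $\Theta(\mathsf c)$. Each function symbol $\mathsf g$ with $\Theta(\mathsf g)=T_1\Rightarrow\dots\Rightarrow T_r\Rightarrow\mathsf B$ comes with a number $q^{\mathsf g}$ such that $T_1,\dots,T_{q^{\mathsf g}}$ are sorts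 $\mathsf B_1,\ldots,\mathsf B_{q^{\mathsf g}}$, and an annotated type $\bar\Theta(\mathsf g)=(\mathsf B_1)_{\alpha_1}\Rightarrow\dots\Rightarrow(\mathsf B_{q})_{\alpha_{q}}\Rightarrow T_{q+1}\Rightarrow\dots\Rightarrow T_r\Rightarrow\mathsf B_{\sigma^{\mathsf g}}$ where $\vec\alpha^{\mathsf g}=\alpha_1,\dots,\alpha_q$ are distinct size variables, $\sigma^{\mathsf g}\in\bar{\mathcal A}$ and the variables of $\sigma^{\mathsf g}$ are among $\vec\alpha^{\mathsf g}$. There is a well-founded quasi-order $\le_{\mathbb F}$ on $\mathbb F$ (strict part $<_{\mathbb F}$, equivalence $\simeq_{\mathbb F}$), extended by $h<_{\mathbb F}\mathsf g$ for all $h\in\mathbb V\cup\mathbb C$, $\mathsf g\in\mathbb F$. For each $\mathsf g$ there are a set $D^{\mathsf g}$, a quasi-order and a well-founded relation $<^{\mathsf g}$ on it, and a map $\zeta^{\mathsf g}:\mathcal A^{q^{\mathsf g}}\to D^{\mathsf g}$ (with the same $D$ and relations for $\simeq_{\mathbb F}$-equivalent symbols); $\vec a<^{\mathsf g,\mathsf f}_{\mathcal A}\vec b$ iff $\mathsf g\simeq_{\mathbb F}\mathsf f$ and $\zeta^{\mathsf g}(\vec a)<^{\mathsf f}\zeta^{\mathsf f}(\vec b)$; it is assumed that $\vec a<^{\mathsf g,\mathsf f}_{\mathcal A}\vec c$ whenever $a_i\preceq_\infty b_i$ for all $i$ and $\vec b<^{\mathsf g,\mathsf f}_{\mathcal A}\vec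 c$ (and analogous conditions on the ordinal interpretation). Write $(h,\psi)\prec(\mathsf f,\varphi)$ if $h<_{\mathbb F}\mathsf f$ or $\vec\alpha^h\psi<^{h,\mathsf f}_{\mathcal A}\vec\alpha^{\mathsf f}\varphi$. A typing environment $\Gamma$ is a finite map from term variables to annotated types. $\Gamma\vdash^{\mathsf f}_\varphi t:T$ is the smallest relation closed under: (app-decr) if $(h,\vec V\Rightarrow V)\in\Gamma\cup\bar\Theta$, either $h<_{\mathbb F}\mathsf f$ or ($h\simeq_{\mathbb F}\mathsf f$ and $|\vec V|\ge q^h$), $\psi$ is a size substitution on the size variables of $h$'s declared type (identity if $h$ is a term variable, on $\vec\alpha^h$ if $h\in\mathbb F$), $(h,\psi)\prec(\mathsf f,\varphi)$, and $\Gamma\vdash^{\mathsf f}_\varphi w_i:V_i\psi$ for all $i$, then $\Gamma\vdash^{\mathsf f}_\varphi h\,\vec w:V\psi$; (lam) if $\Gamma,x:U\vdash^{\mathsf f}_\varphi w:V$ then $\Gamma\vdash^{\mathsf f}_\varphi\lambda x^Uw:U\Rightarrow V$; (sub) if $\Gamma\vdash^{\mathsf f}_\varphi t:U$ and $U\le V$ then $\Gamma\vdash^{\mathsf f}_\varphi t:V$. A subtyping problem is $\bot$ or a finite set of constraints $T\le^?U$ between annotated types; a solution is a size substitution $\varphi$ with domain in the size variables of the problem and $T\varphi\le U\varphi$ for all constraints; $\varphi$ is more general than $\psi$ if $\alpha\varphi\theta\preceq_\infty\alpha\psi$ for all $\alpha$ for some $\theta$.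
   Formalization: Added, since the claim fails for non-effective infinite signatures: annotated types of constructors and function symbols are computable from the symbol, the infinite set of constants is recursively enumerable, and decidability of the size order in (3) is uniform in g. *)

theory Defs
  imports Main "HOL-Library.Nat_Bijection"
begin

section \<open>Computability\<close>

text \<open>
  The (total) general recursive functions: \<open>recursive k f\<close> concerns the restriction of \<open>f\<close> to
  argument lists of length \<open>k\<close>.  Minimisation is only allowed on regular functions, so no partial
  functions are needed.
\<close>

inductive recursive :: "nat \<Rightarrow> (nat list \<Rightarrow> nat) \<Rightarrow> bool" where
  zero: "recursive k (\<lambda>_. 0)"
| succ: "recursive 1 (\<lambda>xs. Suc (hd xs))"
| proj: "i < k \<Longrightarrow> recursive k (\<lambda>xs. xs ! i)"
| comp: "recursive (length gs) f \<Longrightarrow> (\<forall>g \<in> set gs. recursive k g) \<Longrightarrow>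
    recursive k (\<lambda>xs. f (map (\<lambda>g. g xs) gs))"
| prec: "recursive k f \<Longrightarrow> recursive (Suc (Suc k)) g \<Longrightarrow>
    recursive (Suc k) (\<lambda>xs. rec_nat (f (tl xs)) (\<lambda>n r. g (n # r # tl xs)) (hd xs))"
| mini: "recursive (Suc k) f \<Longrightarrow> (\<forall>xs. length xs = k \<longrightarrow> (\<exists>n. f (n # xs) = 0)) \<Longrightarrow>
    recursive k (\<lambda>xs. LEAST n. f (n # xs) = 0)"

definition computable :: "(nat \<Rightarrow> nat) \<Rightarrow> bool" where
  "computable r \<longleftrightarrow> (\<exists>f. recursive 1 f \<and> (\<forall>n. r n = f [n]))"

definition recursively_enumerable :: "nat set \<Rightarrow> bool" where
  "recursively_enumerable X \<longleftrightarrow> X = {} \<or> (\<exists>e. computable e \<and> X = range e)"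

class goedel =
  fixes gnum :: "'a \<Rightarrow> nat"
  assumes inj_gnum: "inj gnum"
begin

lemma gnum_eq [simp]: "gnum x = gnum y \<longleftrightarrow> x = y"
  using inj_gnum by (auto dest: injD)

end

text \<open>
  Decision problems and computable functions on a set \<open>X\<close> of admissible inputs; nothing is required
  of the algorithm outside \<open>X\<close>.
\<close>

definition decidable_on :: "'a::goedel set \<Rightarrow> ('a \<Rightarrow> bool) \<Rightarrow> bool" where
  "decidable_on X P \<longleftrightarrow> (\<exists>r. computable r \<and> (\<forall>x \<in> X. r (gnum x) = (if P x then 1 else 0)))"

definition computable_on :: "'a::goedel set \<Rightarrow> ('a \<Rightarrow> 'b::goedel) \<Rightarrow> bool" where
  "computable_on X f \<longleftrightarrow> (\<exists>r. computable r \<and> (\<forall>x \<in> X. r (gnum x) = gnum (f x)))"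

instantiation nat :: goedel begin
definition gnum_nat :: "nat \<Rightarrow> nat" where "gnum_nat n = n"
instance by standard (simp add: gnum_nat_def inj_def)
end

instantiation prod :: (goedel, goedel) goedel begin
definition gnum_prod :: "'a \<times> 'b \<Rightarrow> nat" where
  "gnum_prod p = prod_encode (gnum (fst p), gnum (snd p))"
instance by standard (auto simp: gnum_prod_def inj_def prod_eq_iff)
end

instantiation list :: (goedel) goedel begin
definition gnum_list :: "'a list \<Rightarrow> nat" where "gnum_list xs = list_encode (map gnum xs)"
instance by standard
    (auto simp: gnum_list_def inj_def list_encode_eq inj_map_eq_map[OF inj_gnum])
end

instantiation option :: (goedel) goedel begin
definition gnum_option :: "'a option \<Rightarrow> nat" where
  "gnum_option z = (case z of None \<Rightarrow> 0 | Some a \<Rightarrow> Suc (gnum a))"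
instance by standard (auto simp: gnum_option_def inj_def split: option.splits)
end

section \<open>Sizes, types and terms\<close>

text \<open>
  Sorts, constructors, function symbols and size symbols are numbered, i.e. the corresponding
  countable sets are subsets of \<^typ>\<open>nat\<close>; term variables and size variables are all of \<^typ>\<open>nat\<close>.
\<close>

datatype sterm = SVar nat | SFun nat "sterm list"

text \<open>Extended sizes: \<open>None\<close> is the size \<open>\<infinity>\<close>.\<close>

type_synonym xsize = "sterm option"

abbreviation Infty :: xsize where "Infty \<equiv> None"
abbreviation Fin :: "sterm \<Rightarrow> xsize" where "Fin \<equiv> Some"

datatype sty = Sort nat | SArr sty sty

datatype aty = Srt nat xsize | Arr aty aty

text \<open>
  Terms modulo \<open>\<alpha>\<close>-equivalence are represented by de Bruijn terms: below \<open>k\<close> abstractions,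
  \<open>V n\<close> is bound if \<open>n < k\<close>, and is the free variable \<open>n - k\<close> otherwise.
\<close>

datatype sym = V nat | C nat | F nat

datatype trm = Sy sym | Lam sty trm | App trm trm

type_synonym env = "nat \<rightharpoonup> aty"
type_synonym ssubst = "nat \<Rightarrow> xsize"

text \<open>A subtyping problem is \<open>\<bottom>\<close> (\<open>None\<close>) or a finite set of constraints, given by a list.\<close>

type_synonym problem = "(aty \<times> aty) list option"

instantiation sterm :: goedel begin
primrec gnum_sterm :: "sterm \<Rightarrow> nat" where
  "gnum_sterm (SVar x) = prod_encode (0, x)"
| "gnum_sterm (SFun k ts) = prod_encode (1, prod_encode (k, list_encode (map gnum_sterm ts)))"
instance
proof
  have "gnum a = gnum b \<Longrightarrow> a = b" for a b :: sterm
  proof (induction a arbitrary: b)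
    case (SVar x)
    then show ?case by (cases b) auto
  next
    case (SFun k ts)
    then obtain us where b: "b = SFun k us" and eq: "map gnum ts = map gnum us"
      by (cases b) (auto simp: list_encode_eq)
    have "ts = us"
    proof (rule nth_equalityI)
      show len: "length ts = length us" using eq map_eq_imp_length_eq by blast
      show "ts ! i = us ! i" if "i < length ts" for i
        using SFun.IH[of "ts ! i" "us ! i"] that len eq
        by (metis nth_map nth_mem)
    qed
    with b show ?case by simp
  qed
  then show "inj (gnum :: sterm \<Rightarrow> nat)" by (simp add: inj_def)
qed
end

instantiation sty :: goedel begin
primrec gnum_sty :: "sty \<Rightarrow> nat" where
  "gnum_sty (Sort B) = prod_encode (0, B)"
| "gnum_sty (SArr U W) = prod_encode (1, prod_encode (gnum_sty U, gnum_sty W))"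
instance
proof
  have "gnum a = gnum b \<Longrightarrow> a = b" for a b :: sty
    by (induction a arbitrary: b) (case_tac b; auto)+
  then show "inj (gnum :: sty \<Rightarrow> nat)" by (simp add: inj_def)
qed
end

instantiation aty :: goedel begin
primrec gnum_aty :: "aty \<Rightarrow> nat" where
  "gnum_aty (Srt B a) = prod_encode (0, prod_encode (B, gnum a))"
| "gnum_aty (Arr U W) = prod_encode (1, prod_encode (gnum_aty U, gnum_aty W))"
instance
proof
  have "gnum a = gnum b \<Longrightarrow> a = b" for a b :: aty
    by (induction a arbitrary: b) (case_tac b; auto)+
  then show "inj (gnum :: aty \<Rightarrow> nat)" by (simp add: inj_def)
qed
end

instantiation sym :: goedel begin
primrec gnum_sym :: "sym \<Rightarrow> nat" where
  "gnum_sym (V n) = prod_encode (0, n)"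
| "gnum_sym (C n) = prod_encode (1, n)"
| "gnum_sym (F n) = prod_encode (2, n)"
instance
proof
  have "gnum a = gnum b \<Longrightarrow> a = b" for a b :: sym
    by (cases a; cases b) auto
  then show "inj (gnum :: sym \<Rightarrow> nat)" by (simp add: inj_def)
qed
end

instantiation trm :: goedel begin
primrec gnum_trm :: "trm \<Rightarrow> nat" where
  "gnum_trm (Sy s) = prod_encode (0, gnum s)"
| "gnum_trm (Lam U t) = prod_encode (1, prod_encode (gnum U, gnum_trm t))"
| "gnum_trm (App t u) = prod_encode (2, prod_encode (gnum_trm t, gnum_trm u))"
instance
proof
  have "gnum a = gnum b \<Longrightarrow> a = b" for a b :: trm
    by (induction a arbitrary: b) (case_tac b; auto)+
  then show "inj (gnum :: trm \<Rightarrow> nat)" by (simp add: inj_def)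
qed
end

primrec svars :: "sterm \<Rightarrow> nat set" where
  "svars (SVar x) = {x}"
| "svars (SFun k ts) = \<Union> (set (map svars ts))"

definition xvars :: "xsize \<Rightarrow> nat set" where
  "xvars a = (case a of None \<Rightarrow> {} | Some s \<Rightarrow> svars s)"

primrec avars :: "aty \<Rightarrow> nat set" where
  "avars (Srt B a) = xvars a"
| "avars (Arr U W) = avars U \<union> avars W"

primrec ssub :: "(nat \<Rightarrow> sterm) \<Rightarrow> sterm \<Rightarrow> sterm" where
  "ssub \<theta> (SVar x) = \<theta> x"
| "ssub \<theta> (SFun k ts) = SFun k (map (ssub \<theta>) ts)"

definition xsub :: "ssubst \<Rightarrow> xsize \<Rightarrow> xsize" where
  "xsub \<psi> a = (case a of None \<Rightarrow> Infty
     | Some s \<Rightarrow> if (\<exists>x \<in> svars s. \<psi> x = Infty) then Infty else Fin (ssub (\<lambda>x. the (\<psi> x)) s))"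

primrec asub :: "ssubst \<Rightarrow> aty \<Rightarrow> aty" where
  "asub \<psi> (Srt B a) = Srt B (xsub \<psi> a)"
| "asub \<psi> (Arr U W) = Arr (asub \<psi> U) (asub \<psi> W)"

text \<open>\<open>crepl c e a\<close> replaces every occurrence of the constant \<open>c\<close> in \<open>a\<close> by \<open>e\<close>.\<close>

primrec crepl :: "nat \<Rightarrow> sterm \<Rightarrow> sterm \<Rightarrow> sterm" where
  "crepl c e (SVar x) = SVar x"
| "crepl c e (SFun k ts) = (if k = c \<and> ts = [] then e else SFun k (map (crepl c e) ts))"

primrec sinterp :: "(nat \<Rightarrow> 'o list \<Rightarrow> 'o) \<Rightarrow> (nat \<Rightarrow> 'o) \<Rightarrow> sterm \<Rightarrow> 'o" where
  "sinterp I \<mu> (SVar x) = \<mu> x"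
| "sinterp I \<mu> (SFun k ts) = I k (map (sinterp I \<mu>) ts)"

primrec erase :: "aty \<Rightarrow> sty" where
  "erase (Srt B a) = Sort B"
| "erase (Arr U W) = SArr (erase U) (erase W)"

text \<open>The identification of a simple type with an annotated type, via \<open>B = B\<^sub>\<infinity>\<close>.\<close>

primrec emb :: "sty \<Rightarrow> aty" where
  "emb (Sort B) = Srt B Infty"
| "emb (SArr U W) = Arr (emb U) (emb W)"

definition arrs :: "aty list \<Rightarrow> aty \<Rightarrow> aty" where
  "arrs Us W = foldr Arr Us W"

definition sarrs :: "sty list \<Rightarrow> sty \<Rightarrow> sty" where
  "sarrs Us W = foldr SArr Us W"

definition apps :: "trm \<Rightarrow> trm list \<Rightarrow> trm" where
  "apps t us = foldl App t us"

section \<open>Sized type systems\<close>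

text \<open>
  \<open>annC\<close>, \<open>annF\<close> are the annotated types, \<open>simC\<close>, \<open>simF\<close> the simple types of constructors and
  function symbols; \<open>q\<close>, \<open>alpha\<close>, \<open>sigma\<close> are the data \<open>q\<^sup>g\<close>, \<open>\<alpha>\<^sup>g\<close>, \<open>\<sigma>\<^sup>g\<close>; \<open>zetaO\<close> is the counterpart
  of \<open>zeta\<close> on the ordinal.
\<close>

record ('o, 'd) system =
  sorts :: "nat set"
  constrs :: "nat set"
  funs :: "nat set"
  ssyms :: "nat set"
  sarity :: "nat \<Rightarrow> nat"
  sle :: "sterm \<Rightarrow> sterm \<Rightarrow> bool"
  sless :: "sterm \<Rightarrow> sterm \<Rightarrow> bool"
  interp :: "nat \<Rightarrow> 'o list \<Rightarrow> 'o"
  simC :: "nat \<Rightarrow> sty"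
  annC :: "nat \<Rightarrow> aty"
  simF :: "nat \<Rightarrow> sty"
  annF :: "nat \<Rightarrow> aty"
  q :: "nat \<Rightarrow> nat"
  alpha :: "nat \<Rightarrow> nat list"
  sigma :: "nat \<Rightarrow> xsize"
  fle :: "nat \<Rightarrow> nat \<Rightarrow> bool"
  dom_D :: "nat \<Rightarrow> 'd set"
  le_D :: "nat \<Rightarrow> 'd \<Rightarrow> 'd \<Rightarrow> bool"
  less_D :: "nat \<Rightarrow> 'd \<Rightarrow> 'd \<Rightarrow> bool"
  zeta :: "nat \<Rightarrow> sterm list \<Rightarrow> 'd"
  zetaO :: "nat \<Rightarrow> 'o list \<Rightarrow> 'd"

subsection \<open>Well-formed objects\<close>

inductive_set sizes :: "('o, 'd) system \<Rightarrow> sterm set" for S where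
  "SVar x \<in> sizes S"
| "k \<in> ssyms S \<Longrightarrow> length ts = sarity S k \<Longrightarrow> (\<forall>t \<in> set ts. t \<in> sizes S) \<Longrightarrow> SFun k ts \<in> sizes S"

definition xsizes :: "('o, 'd) system \<Rightarrow> xsize set" where
  "xsizes S = insert Infty (Fin ` sizes S)"

primrec sty_ok :: "('o, 'd) system \<Rightarrow> sty \<Rightarrow> bool" where
  "sty_ok S (Sort B) \<longleftrightarrow> B \<in> sorts S"
| "sty_ok S (SArr U W) \<longleftrightarrow> sty_ok S U \<and> sty_ok S W"

primrec aty_ok :: "('o, 'd) system \<Rightarrow> aty \<Rightarrow> bool" where
  "aty_ok S (Srt B a) \<longleftrightarrow> B \<in> sorts S \<and> a \<in> xsizes S"
| "aty_ok S (Arr U W) \<longleftrightarrow> aty_ok S U \<and> aty_ok S W"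

primrec sym_ok :: "('o, 'd) system \<Rightarrow> sym \<Rightarrow> bool" where
  "sym_ok S (V n) \<longleftrightarrow> True"
| "sym_ok S (C c) \<longleftrightarrow> c \<in> constrs S"
| "sym_ok S (F g) \<longleftrightarrow> g \<in> funs S"

primrec trm_ok :: "('o, 'd) system \<Rightarrow> trm \<Rightarrow> bool" where
  "trm_ok S (Sy s) \<longleftrightarrow> sym_ok S s"
| "trm_ok S (Lam U t) \<longleftrightarrow> sty_ok S U \<and> trm_ok S t"
| "trm_ok S (App t u) \<longleftrightarrow> trm_ok S t \<and> trm_ok S u"

definition env_ok :: "('o, 'd) system \<Rightarrow> env \<Rightarrow> bool" where
  "env_ok S \<Gamma> \<longleftrightarrow> finite (dom \<Gamma>) \<and> (\<forall>U \<in> ran \<Gamma>. aty_ok S U)"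

text \<open>Size substitutions with domain in \<open>X\<close>.\<close>

definition ssubst_on :: "('o, 'd) system \<Rightarrow> nat set \<Rightarrow> ssubst \<Rightarrow> bool" where
  "ssubst_on S X \<psi> \<longleftrightarrow> (\<forall>x. \<psi> x \<in> xsizes S) \<and> (\<forall>x. x \<notin> X \<longrightarrow> \<psi> x = Fin (SVar x))"

subsection \<open>Orders\<close>

definition xle :: "('o, 'd) system \<Rightarrow> xsize \<Rightarrow> xsize \<Rightarrow> bool" where
  "xle S a b \<longleftrightarrow> a \<in> xsizes S \<and> b \<in> xsizes S \<and>
     (b = Infty \<or> (\<exists>s t. a = Fin s \<and> b = Fin t \<and> sle S s t))"

definition fless :: "('o, 'd) system \<Rightarrow> nat \<Rightarrow> nat \<Rightarrow> bool" where
  "fless S g h \<longleftrightarrow> fle S g h \<and> \<not> fle S h g"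

definition fequiv :: "('o, 'd) system \<Rightarrow> nat \<Rightarrow> nat \<Rightarrow> bool" where
  "fequiv S g h \<longleftrightarrow> fle S g h \<and> fle S h g"

definition vecs :: "('o, 'd) system \<Rightarrow> nat \<Rightarrow> sterm list set" where
  "vecs S g = {as. length as = q S g \<and> set as \<subseteq> sizes S}"

definition less_A :: "('o, 'd) system \<Rightarrow> nat \<Rightarrow> nat \<Rightarrow> sterm list \<Rightarrow> sterm list \<Rightarrow> bool" where
  "less_A S g f as bs \<longleftrightarrow> as \<in> vecs S g \<and> bs \<in> vecs S f \<and>
     fequiv S g f \<and> less_D S f (zeta S g as) (zeta S f bs)"

definition less_O :: "('o, 'd) system \<Rightarrow> nat \<Rightarrow> nat \<Rightarrow> 'o list \<Rightarrow> 'o list \<Rightarrow> bool" where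
  "less_O S g f as bs \<longleftrightarrow> length as = q S g \<and> length bs = q S f \<and>
     fequiv S g f \<and> less_D S f (zetaO S g as) (zetaO S f bs)"

subsection \<open>Standing assumptions\<close>

locale size_algebra =
  fixes S :: "('o::wellorder, 'd) system"
  assumes sle_refl: "a \<in> sizes S \<Longrightarrow> sle S a a"
    and sle_trans: "\<lbrakk>a \<in> sizes S; b \<in> sizes S; c \<in> sizes S; sle S a b; sle S b c\<rbrakk> \<Longrightarrow> sle S a c"
    and sless_irrefl: "a \<in> sizes S \<Longrightarrow> \<not> sless S a a"
    and sless_trans:
      "\<lbrakk>a \<in> sizes S; b \<in> sizes S; c \<in> sizes S; sless S a b; sless S b c\<rbrakk> \<Longrightarrow> sless S a c"
    and sless_sle: "\<lbrakk>a \<in> sizes S; b \<in> sizes S; sless S a b\<rbrakk> \<Longrightarrow> sle S a b"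
    and sle_stable: "\<lbrakk>a \<in> sizes S; b \<in> sizes S; range \<theta> \<subseteq> sizes S; sle S a b\<rbrakk>
      \<Longrightarrow> sle S (ssub \<theta> a) (ssub \<theta> b)"
    and sless_stable: "\<lbrakk>a \<in> sizes S; b \<in> sizes S; range \<theta> \<subseteq> sizes S; sless S a b\<rbrakk>
      \<Longrightarrow> sless S (ssub \<theta> a) (ssub \<theta> b)"
    and sle_interp: "\<lbrakk>a \<in> sizes S; b \<in> sizes S; sle S a b\<rbrakk>
      \<Longrightarrow> sinterp (interp S) \<mu> a \<le> sinterp (interp S) \<mu> b"
    and sless_interp: "\<lbrakk>a \<in> sizes S; b \<in> sizes S; sless S a b\<rbrakk>
      \<Longrightarrow> sinterp (interp S) \<mu> a < sinterp (interp S) \<mu> b"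

locale sized_type_system = size_algebra S for S :: "('o::wellorder, 'd) system" +
  assumes sorts_nonempty: "sorts S \<noteq> {}"
    and constr_type: "c \<in> constrs S \<Longrightarrow> sty_ok S (simC S c) \<and> aty_ok S (annC S c) \<and>
      erase (annC S c) = simC S c"
    and fun_type: "g \<in> funs S \<Longrightarrow> \<exists>Bs Ts B.
      length Bs = q S g \<and> simF S g = sarrs (map Sort Bs @ Ts) (Sort B) \<and>
      annF S g = arrs (map2 (\<lambda>B \<alpha>. Srt B (Fin (SVar \<alpha>))) Bs (alpha S g) @ map emb Ts)
        (Srt B (sigma S g))"
    and fun_type_ok: "g \<in> funs S \<Longrightarrow> sty_ok S (simF S g)"
    and alpha: "g \<in> funs S \<Longrightarrow> length (alpha S g) = q S g \<and> distinct (alpha S g)"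
    and sigma: "g \<in> funs S \<Longrightarrow> sigma S g \<in> xsizes S \<and> xvars (sigma S g) \<subseteq> set (alpha S g)"
    and fle_refl: "g \<in> funs S \<Longrightarrow> fle S g g"
    and fle_trans: "\<lbrakk>g \<in> funs S; h \<in> funs S; k \<in> funs S; fle S g h; fle S h k\<rbrakk> \<Longrightarrow> fle S g k"
    and fle_wf: "wf {(g, h). g \<in> funs S \<and> h \<in> funs S \<and> fless S g h}"
    and le_D_refl: "\<lbrakk>g \<in> funs S; x \<in> dom_D S g\<rbrakk> \<Longrightarrow> le_D S g x x"
    and le_D_trans: "\<lbrakk>g \<in> funs S; x \<in> dom_D S g; y \<in> dom_D S g; z \<in> dom_D S g;
        le_D S g x y; le_D S g y z\<rbrakk> \<Longrightarrow> le_D S g x z"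
    and less_D_wf: "g \<in> funs S \<Longrightarrow> wf {(x, y). x \<in> dom_D S g \<and> y \<in> dom_D S g \<and> less_D S g x y}"
    and D_equiv: "\<lbrakk>g \<in> funs S; h \<in> funs S; fequiv S g h\<rbrakk> \<Longrightarrow>
      dom_D S g = dom_D S h \<and>
      (\<forall>x \<in> dom_D S g. \<forall>y \<in> dom_D S g.
         (le_D S g x y \<longleftrightarrow> le_D S h x y) \<and> (less_D S g x y \<longleftrightarrow> less_D S h x y))"
    and zeta: "\<lbrakk>g \<in> funs S; as \<in> vecs S g\<rbrakk> \<Longrightarrow> zeta S g as \<in> dom_D S g"
    and zetaO: "\<lbrakk>g \<in> funs S; length os = q S g\<rbrakk> \<Longrightarrow> zetaO S g os \<in> dom_D S g"
    and less_A_compat: "\<lbrakk>g \<in> funs S; f \<in> funs S; as \<in> vecs S g; bs \<in> vecs S g;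
        list_all2 (\<lambda>a b. xle S (Fin a) (Fin b)) as bs; less_A S g f bs cs\<rbrakk> \<Longrightarrow> less_A S g f as cs"
    and less_O_compat: "\<lbrakk>g \<in> funs S; f \<in> funs S;
        list_all2 (\<le>) us vs; less_O S g f vs ws\<rbrakk> \<Longrightarrow> less_O S g f us ws"

subsection \<open>Subtyping and typing\<close>

inductive subtype :: "('o, 'd) system \<Rightarrow> aty \<Rightarrow> aty \<Rightarrow> bool" for S where
  sort: "xle S a b \<Longrightarrow> subtype S (Srt B a) (Srt B b)"
| arr: "subtype S U' U \<Longrightarrow> subtype S W W' \<Longrightarrow> subtype S (Arr U W) (Arr U' W')"
| refl: "subtype S U U"
| trans: "subtype S U W \<Longrightarrow> subtype S W T \<Longrightarrow> subtype S U T"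

text \<open>The precedence, extended to variables and constructors on the left.\<close>

primrec sym_less :: "('o, 'd) system \<Rightarrow> sym \<Rightarrow> nat \<Rightarrow> bool" where
  "sym_less S (V n) f \<longleftrightarrow> True"
| "sym_less S (C c) f \<longleftrightarrow> True"
| "sym_less S (F g) f \<longleftrightarrow> fless S g f"

primrec declared :: "('o, 'd) system \<Rightarrow> env \<Rightarrow> sym \<Rightarrow> aty \<Rightarrow> bool" where
  "declared S \<Gamma> (V n) U \<longleftrightarrow> \<Gamma> n = Some U"
| "declared S \<Gamma> (C c) U \<longleftrightarrow> c \<in> constrs S \<and> U = annC S c"
| "declared S \<Gamma> (F g) U \<longleftrightarrow> g \<in> funs S \<and> U = annF S g"

text \<open>The size variables of the declaration of a symbol that may be instantiated.\<close>

primrec inst_vars :: "('o, 'd) system \<Rightarrow> sym \<Rightarrow> nat set" where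
  "inst_vars S (V n) = {}"
| "inst_vars S (C c) = avars (annC S c)"
| "inst_vars S (F g) = set (alpha S g)"

definition saturated :: "('o, 'd) system \<Rightarrow> nat \<Rightarrow> sym \<Rightarrow> nat \<Rightarrow> bool" where
  "saturated S f h n \<longleftrightarrow> (\<exists>g. h = F g \<and> fequiv S g f \<and> q S g \<le> n)"

definition decreases :: "('o, 'd) system \<Rightarrow> sym \<Rightarrow> ssubst \<Rightarrow> nat \<Rightarrow> ssubst \<Rightarrow> bool" where
  "decreases S h \<psi> f \<phi> \<longleftrightarrow> sym_less S h f \<or>
     (\<exists>g as bs. h = F g \<and> map \<psi> (alpha S g) = map Fin as \<and> map \<phi> (alpha S f) = map Fin bs \<and>
        less_A S g f as bs)"

definition push :: "aty \<Rightarrow> env \<Rightarrow> env" where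
  "push U \<Gamma> = case_nat (Some U) \<Gamma>"

inductive typing :: "('o, 'd) system \<Rightarrow> nat \<Rightarrow> ssubst \<Rightarrow> env \<Rightarrow> trm \<Rightarrow> aty \<Rightarrow> bool"
  for S f \<phi> where
  app_decr: "\<lbrakk>declared S \<Gamma> h (arrs Us W);
      sym_less S h f \<or> saturated S f h (length Us);
      ssubst_on S (inst_vars S h) \<psi>;
      decreases S h \<psi> f \<phi>;
      list_all2 (\<lambda>w U. typing S f \<phi> \<Gamma> w (asub \<psi> U)) ws Us\<rbrakk>
    \<Longrightarrow> typing S f \<phi> \<Gamma> (apps (Sy h) ws) (asub \<psi> W)"
| lam: "typing S f \<phi> (push (emb U) \<Gamma>) w W \<Longrightarrow> typing S f \<phi> \<Gamma> (Lam U w) (Arr (emb U) W)"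
| sub: "typing S f \<phi> \<Gamma> t U \<Longrightarrow> subtype S U W \<Longrightarrow> typing S f \<phi> \<Gamma> t W"

subsection \<open>Subtyping problems\<close>

definition problem_ok :: "('o, 'd) system \<Rightarrow> problem \<Rightarrow> bool" where
  "problem_ok S P \<longleftrightarrow> (\<forall>cs. P = Some cs \<longrightarrow> (\<forall>(T, U) \<in> set cs. aty_ok S T \<and> aty_ok S U))"

definition problem_vars :: "problem \<Rightarrow> nat set" where
  "problem_vars P = (case P of None \<Rightarrow> {} | Some cs \<Rightarrow> \<Union>(T, U) \<in> set cs. avars T \<union> avars U)"

definition solution :: "('o, 'd) system \<Rightarrow> problem \<Rightarrow> ssubst \<Rightarrow> bool" where
  "solution S P \<phi> \<longleftrightarrow> ssubst_on S (problem_vars P) \<phi> \<and>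
     (\<exists>cs. P = Some cs \<and> (\<forall>(T, U) \<in> set cs. subtype S (asub \<phi> T) (asub \<phi> U)))"

definition satisfiable :: "('o, 'd) system \<Rightarrow> problem \<Rightarrow> bool" where
  "satisfiable S P \<longleftrightarrow> (\<exists>\<phi>. solution S P \<phi>)"

definition more_general :: "('o, 'd) system \<Rightarrow> ssubst \<Rightarrow> ssubst \<Rightarrow> bool" where
  "more_general S \<phi> \<psi> \<longleftrightarrow> (\<exists>\<theta>. ssubst_on S UNIV \<theta> \<and> (\<forall>x. xle S (xsub \<theta> (\<phi> x)) (\<psi> x)))"

definition most_general_solution :: "('o, 'd) system \<Rightarrow> problem \<Rightarrow> ssubst \<Rightarrow> bool" where
  "most_general_solution S P \<phi> \<longleftrightarrow> solution S P \<phi> \<and> (\<forall>\<psi>. solution S P \<psi> \<longrightarrow> more_general S \<phi> \<psi>)"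

subsection \<open>Hypotheses on the size algebra\<close>

definition monotone_algebra :: "('o, 'd) system \<Rightarrow> bool" where
  "monotone_algebra S \<longleftrightarrow> (\<forall>k \<in> ssyms S. \<forall>as bs i.
     length as = sarity S k \<and> length bs = sarity S k \<and> set as \<subseteq> sizes S \<and> set bs \<subseteq> sizes S \<and>
     i < sarity S k \<and> sle S (as ! i) (bs ! i) \<and> (\<forall>j < sarity S k. j \<noteq> i \<longrightarrow> as ! j = bs ! j)
     \<longrightarrow> sle S (SFun k as) (SFun k bs))"

definition generic_constants :: "('o, 'd) system \<Rightarrow> nat \<Rightarrow> nat set \<Rightarrow> bool" where
  "generic_constants S f K \<longleftrightarrow> infinite K \<and> K \<subseteq> {k \<in> ssyms S. sarity S k = 0} \<and>
     (\<forall>c \<in> K. \<forall>e \<in> sizes S.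
        (\<forall>a \<in> sizes S. \<forall>b \<in> sizes S. sle S a b \<longrightarrow> sle S (crepl c e a) (crepl c e b)) \<and>
        (\<forall>g \<in> funs S. \<forall>as bs. less_A S g f as bs \<longrightarrow>
           less_A S g f (map (crepl c e) as) (map (crepl c e) bs)))"

text \<open>
  Effectiveness of the presentation, implicit in any talk of decidability when the sets of symbols
  may be infinite: the declared type of a symbol can be computed from the symbol.
\<close>

definition effective_declarations :: "('o, 'd) system \<Rightarrow> bool" where
  "effective_declarations S \<longleftrightarrow>
     computable_on (constrs S) (annC S) \<and> computable_on (funs S) (annF S)"

end

theory Submission
  imports Defs "HOL-Library.Sublist"
begin

text \<open>
  A term \<open>t\<close> determines, in a syntax-directed way, a finite set of subtyping constraints over fresh size
  variables together with a list of decrease conditions \<open>\<alpha>\<^sup>g\<psi> <\<^sub>A \<alpha>\<^sup>f\<phi>\<close>, and \<open>\<Gamma> \<turnstile> t : T\<close> holds iff one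
  size substitution satisfies both. The size variables of \<open>\<Gamma>\<close> and \<open>T\<close> must not be instantiated: they
  are replaced by fresh generic constants, and put back in the solution that is found.

  A most general solution alone does not settle the decrease conditions, since these may hold for an
  instance of it only. But the existence of most general solutions for \<^emph>\<open>all\<close> satisfiable problems forces
  every size symbol to have arity at most one, and then forces a least size. By monotonicity, instantiating
  all variables of a most general solution with the least size gives the least solution, and the decrease
  conditions hold for some solution iff they hold for the least one.
\<close>

subsection \<open>Recursive functions\<close>

text \<open>A family of solutions without a common generalisation contradicts the existence of a
  most general one. Since \<open>\<infinity>\<close> is fixed by every substitution, a size symbol
  with two arguments yields such a family. With arity at most one, a size has a single leaf and
  cannot mention two generic constants; this is what forces a least size when one size is asked to
  relate to two such constants. The decrease conditions pass to smaller sizes on their left, which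
  is why testing the least solution suffices; it is also finite wherever some solution is. Freezing
  has a difficulty of its own: a given typing may already instantiate variables by the constants
  chosen for freezing. These constants lie beyond the codes of the constraints and of
  \<open>\<alpha>\<^sup>f\<phi>\<close>, and sizes are compared only after unfreezing, which
  replaces the same constants on both sides.\<close>

definition recf :: "nat \<Rightarrow> (nat list \<Rightarrow> nat) \<Rightarrow> bool" where
  "recf k f \<longleftrightarrow> (\<exists>g. recursive k g \<and> (\<forall>xs. length xs = k \<longrightarrow> f xs = g xs))"

text \<open>This is the gain over \<open>recursive\<close>, which fixes the values on lists of every
  length: only lists of length \<open>k\<close> count, so functions can be rewritten freely
  there.\<close>

lemma recf_cong: "recf k f \<Longrightarrow> (\<And>xs. length xs = k \<Longrightarrow> f xs = g xs) \<Longrightarrow> recf k g"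
  unfolding recf_def by metis

lemma recf_zero: "recf k (\<lambda>_. 0)"
  unfolding recf_def using recursive.zero by blast

lemma recf_proj: "i < k \<Longrightarrow> recf k (\<lambda>xs. xs ! i)"
  unfolding recf_def using recursive.proj by blast

lemma recf_comp1:
  assumes "recf 1 f" "recf k g"
  shows "recf k (\<lambda>xs. f [g xs])"
proof -
  obtain f' g' where "recursive 1 f'" "\<forall>xs. length xs = 1 \<longrightarrow> f xs = f' xs"
    "recursive k g'" "\<forall>xs. length xs = k \<longrightarrow> g xs = g' xs"
    using assms unfolding recf_def by auto
  then show ?thesis
    unfolding recf_def using recursive.comp[of "[g']" f' k] by (intro exI[of _ "\<lambda>xs. f' [g' xs]"]) auto
qed

lemma recf_comp2:
  assumes "recf 2 f" "recf k g" "recf k h"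
  shows "recf k (\<lambda>xs. f [g xs, h xs])"
proof -
  obtain f' g' h' where "recursive 2 f'" "\<forall>xs. length xs = 2 \<longrightarrow> f xs = f' xs"
    "recursive k g'" "\<forall>xs. length xs = k \<longrightarrow> g xs = g' xs"
    "recursive k h'" "\<forall>xs. length xs = k \<longrightarrow> h xs = h' xs"
    using assms unfolding recf_def by metis
  then show ?thesis
    unfolding recf_def using recursive.comp[of "[g', h']" f' k]
    by (intro exI[of _ "\<lambda>xs. f' [g' xs, h' xs]"]) (auto simp: numeral_2_eq_2)
qed

lemma recf_Suc: "recf k g \<Longrightarrow> recf k (\<lambda>xs. Suc (g xs))"
  using recf_comp1[of "\<lambda>xs. Suc (hd xs)" k g] recursive.succ unfolding recf_def by auto

lemma recf_const: "recf k (\<lambda>_. c)"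
  by (induction c) (auto intro: recf_zero recf_Suc)

lemma recf_prec:
  assumes "recf k f" "recf (Suc (Suc k)) g"
  shows "recf (Suc k) (\<lambda>xs. rec_nat (f (tl xs)) (\<lambda>n r. g (n # r # tl xs)) (hd xs))"
proof -
  obtain f' g' where fg: "recursive k f'" "\<And>xs. length xs = k \<Longrightarrow> f xs = f' xs"
    "recursive (Suc (Suc k)) g'" "\<And>xs. length xs = Suc (Suc k) \<Longrightarrow> g xs = g' xs"
    using assms unfolding recf_def by metis
  have "rec_nat (f (tl xs)) (\<lambda>n r. g (n # r # tl xs)) m =
      rec_nat (f' (tl xs)) (\<lambda>n r. g' (n # r # tl xs)) m" if "length xs = Suc k" for xs m
    using that by (induction m) (simp_all add: fg)
  then show ?thesis
    unfolding recf_def using recursive.prec[OF fg(1,3)] by blast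
qed

lemma recf_mini:
  assumes "recf (Suc k) f" "\<And>xs. length xs = k \<Longrightarrow> \<exists>n. f (n # xs) = 0"
  shows "recf k (\<lambda>xs. LEAST n. f (n # xs) = 0)"
proof -
  obtain f' where f': "recursive (Suc k) f'" "\<And>xs. length xs = Suc k \<Longrightarrow> f xs = f' xs"
    using assms unfolding recf_def by metis
  then have "\<forall>xs. length xs = k \<longrightarrow> (\<exists>n. f' (n # xs) = 0)"
    using assms(2) by fastforce
  from recursive.mini[OF f'(1) this] show ?thesis
    unfolding recf_def using f'(2) by (intro exI conjI) auto
qed

lemma recf_pred: "recf 1 (\<lambda>xs. hd xs - 1)"
proof -
  have "rec_nat 0 (\<lambda>n r. n) m = m - 1" for m :: nat by (cases m) auto
  then show ?thesis
    using recf_prec[OF recf_zero recf_proj[of 0 2, unfolded numeral_2_eq_2]] by simp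
qed

lemma recf_add: "recf 2 (\<lambda>xs. xs ! 0 + xs ! 1)"
proof -
  have "rec_nat a (\<lambda>n r. Suc r) m = m + a" for m a :: nat by (induction m) auto
  then have "recf (Suc 1) (\<lambda>xs. hd xs + tl xs ! 0)"
    using recf_prec[OF recf_proj[of 0 1] recf_Suc[OF recf_proj[of 1 "Suc (Suc 1)"]]] by simp
  then show ?thesis
    unfolding numeral_2_eq_2 One_nat_def by (rule recf_cong) (auto simp: length_Suc_conv)
qed

text \<open>Primitive recursion runs on the head of the list, so the number of predecessor steps,
  the subtrahend, comes first.\<close>

lemma recf_minus: "recf 2 (\<lambda>xs. xs ! 1 - xs ! 0)"
proof -
  have eq: "rec_nat a (\<lambda>n r. r - 1) m = a - m" for m a :: nat by (induction m) auto
  have "recf (Suc (Suc 1)) (\<lambda>xs. xs ! 1 - 1)"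
    using recf_comp1[OF recf_pred recf_proj[of 1 "Suc (Suc 1)"]] by simp
  from recf_prec[OF recf_proj[of 0 1] this]
  have "recf (Suc 1) (\<lambda>xs. tl xs ! 0 - hd xs)"
    by (simp add: eq[simplified])
  then show ?thesis
    unfolding numeral_2_eq_2 One_nat_def by (rule recf_cong) (auto simp: length_Suc_conv)
qed

lemma recf_triangle: "recf 1 (\<lambda>xs. triangle (hd xs))"
proof -
  have eq: "rec_nat 0 (\<lambda>n r. r + Suc n) m = triangle m" for m :: nat by (induction m) auto
  have "recf 2 (\<lambda>xs. xs ! 1 + Suc (xs ! 0))"
    using recf_comp2[OF recf_add recf_proj[of 1 2] recf_Suc[OF recf_proj[of 0 2]]] by simp
  from recf_prec[OF recf_zero this[unfolded numeral_2_eq_2]]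
  show ?thesis by (simp add: eq[simplified])
qed

section \<open>Cantor pairing and its inverse\<close>

lemma recf_prod_encode: "recf 2 (\<lambda>xs. prod_encode (xs ! 0, xs ! 1))"
  unfolding prod_encode_def prod.case
  using recf_comp2[OF recf_add recf_comp1[OF recf_triangle recf_add] recf_proj[of 0 2]] by simp

text \<open>The code of \<open>(a, b)\<close> is \<open>triangle (a + b) + a\<close> and lies on the
  diagonal \<open>s = a + b\<close>, the first \<open>s\<close> with
  \<open>z < triangle (Suc s)\<close>. This expresses decoding by minimisation and
  subtraction.\<close>

lemma prod_decode_eq_LEAST:
  "prod_decode z = (let s = LEAST s. z < triangle (Suc s); a = z - triangle s in (a, s - a))"
proof -
  obtain a b where ab: "z = prod_encode (a, b)"
    by (metis prod_decode_inverse surj_pair)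
  have mono: "triangle m \<le> triangle n" if "m \<le> n" for m n
    using that by (induction rule: dec_induct) auto
  have "(LEAST s. z < triangle (Suc s)) = a + b"
  proof (rule Least_equality)
    show "z < triangle (Suc (a + b))" by (simp add: ab prod_encode_def)
    show "a + b \<le> s" if "z < triangle (Suc s)" for s
    proof (rule ccontr)
      assume "\<not> a + b \<le> s"
      then have "triangle (Suc s) \<le> triangle (a + b)" by (intro mono) simp
      then show False using that by (simp add: ab prod_encode_def)
    qed
  qed
  then show ?thesis by (simp add: ab prod_encode_def Let_def del: triangle_Suc)
      (simp add: prod_decode_triangle_add prod_decode_aux.simps)
qed

lemma computable_iff: "computable r \<longleftrightarrow> recf 1 (\<lambda>xs. r (hd xs))"
proof
  assume "computable r"
  then show "recf 1 (\<lambda>xs. r (hd xs))"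
    unfolding computable_def recf_def by (auto simp: length_Suc_conv)
next
  assume "recf 1 (\<lambda>xs. r (hd xs))"
  then obtain g where "recursive 1 g" "\<And>xs. length xs = 1 \<Longrightarrow> r (hd xs) = g xs"
    unfolding recf_def by blast
  from this(2)[of "[_]"] this(1) show "computable r"
    unfolding computable_def by auto
qed

lemma computable_comp: "computable f \<Longrightarrow> computable g \<Longrightarrow> computable (\<lambda>n. f (g n))"
  unfolding computable_iff using recf_comp1 by fastforce

lemma computable_recf2:
  "recf 2 f \<Longrightarrow> computable g \<Longrightarrow> computable h \<Longrightarrow> computable (\<lambda>n. f [g n, h n])"
  unfolding computable_iff using recf_comp2 by blast

lemma computable_id: "computable (\<lambda>n. n)"
  unfolding computable_iff using recf_proj[of 0 1]
  by (rule recf_cong) (auto simp: length_Suc_conv)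

lemma computable_const: "computable (\<lambda>_. c)"
  unfolding computable_iff by (rule recf_const)

lemma computable_Suc: "computable f \<Longrightarrow> computable (\<lambda>n. Suc (f n))"
  unfolding computable_iff by (rule recf_Suc)

lemma computable_add: "computable f \<Longrightarrow> computable g \<Longrightarrow> computable (\<lambda>n. f n + g n)"
  using computable_recf2[OF recf_add, of f g] by simp

lemma computable_minus: "computable f \<Longrightarrow> computable g \<Longrightarrow> computable (\<lambda>n. f n - g n)"
  using computable_recf2[OF recf_minus, of g f] by simp

lemma computable_triangle: "computable triangle"
  unfolding computable_iff by (rule recf_triangle)

lemma computable_pair:
  "computable f \<Longrightarrow> computable g \<Longrightarrow> computable (\<lambda>n. prod_encode (f n, g n))"
  unfolding prod_encode_def prod.case
  by (intro computable_add computable_comp[OF computable_triangle])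

lemma computable_triangle_root: "computable (\<lambda>z. LEAST s. z < triangle (Suc s))"
proof -
  \<comment> \<open>The comparison \<open>z < triangle (Suc s)\<close> becomes the vanishing of a
    truncated difference, with \<open>s\<close> at position 0 and \<open>z\<close> at position 1.
    Minimisation must be regular: \<open>s = z\<close> is always a witness.\<close>
  define T where "T xs = Suc (xs ! 1) - triangle (Suc (xs ! 0))" for xs
  have "recf 2 (\<lambda>xs. triangle (Suc (xs ! 0)))"
    using recf_comp1[OF recf_triangle recf_Suc[OF recf_proj[of 0 2]]]
    by (simp del: triangle_Suc)
  from recf_comp2[OF recf_minus this recf_Suc[OF recf_proj[of 1 2]]]
  have T: "recf (Suc 1) T"
    unfolding T_def by (simp add: numeral_2_eq_2 del: triangle_Suc)
  have ge: "s < triangle (Suc s)" for s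
    by (induction s) auto
  have "\<exists>n. T (n # xs) = 0" if "length xs = 1" for xs
    using that ge[of "xs ! 0"]
    by (intro exI[of _ "xs ! 0"]) (auto simp: T_def length_Suc_conv simp del: triangle_Suc)
  from recf_mini[OF T this] have "recf 1 (\<lambda>xs. LEAST n. T (n # xs) = 0)" by simp
  then show ?thesis
    unfolding computable_iff
    by (rule recf_cong) (auto simp: T_def length_Suc_conv less_Suc_eq_le not_less_eq_eq Suc_le_eq simp del: triangle_Suc)
qed

lemma computable_fst: "computable (\<lambda>n. fst (prod_decode n))"
  and computable_snd: "computable (\<lambda>n. snd (prod_decode n))"
  unfolding prod_decode_eq_LEAST Let_def fst_conv snd_conv
  by (intro computable_minus computable_id computable_comp[OF computable_triangle]
      computable_triangle_root)+

text \<open>As \<open>computable\<close> is about unary functions, the step function receives the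
  parameter, the index and the previous value packed into one code.\<close>

lemma computable_rec_nat:
  assumes "computable a" "computable b" "computable m"
  shows "computable (\<lambda>n. rec_nat (a n) (\<lambda>i r. b (prod_encode (n, prod_encode (i, r)))) (m n))"
proof -
  define g where "g xs = b (prod_encode (xs ! 2, prod_encode (xs ! 0, xs ! 1)))" for xs
  have "recf 3 (\<lambda>xs. prod_encode (xs ! 2, prod_encode (xs ! 0, xs ! 1)))"
    using recf_comp2[OF recf_prod_encode recf_proj[of 2 3] recf_comp2[OF recf_prod_encode recf_proj[of 0 3] recf_proj[of 1 3]]]
    by simp
  then have "recf (Suc (Suc 1)) g"
    unfolding g_def using recf_comp1[OF assms(2)[unfolded computable_iff]]
    by (simp add: numeral_3_eq_3)
  from recf_prec[OF assms(1)[unfolded computable_iff] this]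
  have "recf 2 (\<lambda>xs. rec_nat (a (hd (tl xs))) (\<lambda>n r. g (n # r # tl xs)) (hd xs))"
    by (simp add: numeral_2_eq_2)
  from computable_recf2[OF this assms(3) computable_id] show ?thesis
    by (simp add: g_def)
qed

lemma computable_LEAST:
  assumes "computable f" "\<And>n. \<exists>i. f (prod_encode (i, n)) = 0"
  shows "computable (\<lambda>n. LEAST i. f (prod_encode (i, n)) = 0)"
proof -
  have "recf (Suc 1) (\<lambda>xs. f (prod_encode (xs ! 0, xs ! 1)))"
    using recf_comp1[OF assms(1)[unfolded computable_iff] recf_prod_encode] by (simp add: numeral_2_eq_2)
  from recf_mini[OF this] assms(2)
  have "recf 1 (\<lambda>xs. LEAST i. f (prod_encode (i, xs ! 0)) = 0)" by simp
  then show ?thesis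
    unfolding computable_iff by (rule recf_cong) (auto simp: length_Suc_conv)
qed

lemma computable_if:
  assumes "computable b" "computable f" "computable g"
  shows "computable (\<lambda>n. if b n = 0 then f n else g n)"
proof -
  \<comment> \<open>A conditional as a recursion of \<open>b n\<close> rounds: without any round the
    value stays \<open>f n\<close>, and each round returns \<open>g n\<close> whatever came before.
    The detour through \<open>prod_decode\<close> gives the step the shape expected by
    \<open>computable_rec_nat\<close>.\<close>
  have eq: "(if b n = 0 then f n else g n) =
    rec_nat (f n) (\<lambda>i r. g (fst (prod_decode (prod_encode (n, prod_encode (i, r)))))) (b n)" for n
    by (cases "b n") auto
  show ?thesis
    unfolding eq
    by (intro computable_rec_nat[of f "\<lambda>z. g (fst (prod_decode z))" b] assms
        computable_comp[OF assms(3) computable_fst])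
qed

subsection \<open>Computable functions on coded data\<close>

text \<open>Truth values are coded as in \<open>decidable_on\<close>, so deciding a predicate is
  computing a Boolean function, and one set of closure rules serves both.\<close>

instantiation bool :: goedel begin
definition gnum_bool :: "bool \<Rightarrow> nat" where "gnum_bool b = (if b then 1 else 0)"
instance by standard (simp add: gnum_bool_def inj_def)
end

lemma decidable_on_iff: "decidable_on X P \<longleftrightarrow> computable_on X P"
  unfolding decidable_on_def computable_on_def gnum_bool_def ..

lemma gnum_Pair: "gnum (x, y) = prod_encode (gnum x, gnum y)"
  by (simp add: gnum_prod_def)

lemma gnum_Nil: "gnum [] = 0"
  by (simp add: gnum_list_def)

lemma gnum_Cons: "gnum (x # xs) = Suc (prod_encode (gnum x, gnum xs))"
  by (simp add: gnum_list_def)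

lemma gnum_Some: "gnum (Some x) = Suc (gnum x)"
  by (simp add: gnum_option_def)

lemma gnum_SFun: "gnum (SFun k ts) = prod_encode (1, gnum (k, ts))"
  by (simp add: gnum_Pair gnum_list_def gnum_nat_def)

lemma computable_on_subset: "computable_on Y f \<Longrightarrow> X \<subseteq> Y \<Longrightarrow> computable_on X f"
  unfolding computable_on_def by blast

lemma computable_on_cong: "computable_on X f \<Longrightarrow> (\<And>x. x \<in> X \<Longrightarrow> f x = g x) \<Longrightarrow> computable_on X g"
  unfolding computable_on_def by metis

lemma computable_on_code:
  assumes "computable_on X f" "computable r" "\<And>x. x \<in> X \<Longrightarrow> r (gnum (f x)) = gnum (h x)"
  shows "computable_on X h"
proof -
  obtain s where "computable s" "\<And>x. x \<in> X \<Longrightarrow> s (gnum x) = gnum (f x)"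
    using assms(1) unfolding computable_on_def by blast
  then show ?thesis
    unfolding computable_on_def using computable_comp[OF assms(2)] assms(3)
    by (intro exI[of _ "\<lambda>n. r (s n)"]) auto
qed

lemma computable_on_comp:
  assumes "computable_on Y g" "computable_on X f" "\<And>x. x \<in> X \<Longrightarrow> f x \<in> Y"
  shows "computable_on X (\<lambda>x. g (f x))"
proof -
  obtain r where r: "computable r" "\<And>y. y \<in> Y \<Longrightarrow> r (gnum y) = gnum (g y)"
    using assms(1) unfolding computable_on_def by blast
  show ?thesis by (rule computable_on_code[OF assms(2) r(1)]) (simp add: assms(3) r(2))
qed

lemma computable_on_id: "computable_on X (\<lambda>x. x)"
  unfolding computable_on_def using computable_id by blast

lemma computable_on_const: "computable_on X (\<lambda>_. c)"
  unfolding computable_on_def using computable_const by blast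

lemma computable_on_Pair:
  assumes "computable_on X f" "computable_on X g"
  shows "computable_on X (\<lambda>x. (f x, g x))"
proof -
  obtain r s where "computable r" "\<And>x. x \<in> X \<Longrightarrow> r (gnum x) = gnum (f x)"
    "computable s" "\<And>x. x \<in> X \<Longrightarrow> s (gnum x) = gnum (g x)"
    using assms unfolding computable_on_def by blast
  then show ?thesis
    unfolding computable_on_def
    by (intro exI[of _ "\<lambda>n. prod_encode (r n, s n)"]) (auto simp: gnum_Pair intro: computable_pair)
qed

lemma computable_on_comp2:
  assumes "computable_on Y (\<lambda>z. h (fst z) (snd z))" "computable_on X f" "computable_on X g"
    "\<And>x. x \<in> X \<Longrightarrow> (f x, g x) \<in> Y"
  shows "computable_on X (\<lambda>x. h (f x) (g x))"
  using computable_on_comp[OF assms(1) computable_on_Pair[OF assms(2,3)] assms(4)] by simp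

lemma computable_on_comp3:
  assumes "computable_on Y (\<lambda>z. h (fst z) (fst (snd z)) (snd (snd z)))"
    "computable_on X f" "computable_on X g" "computable_on X k"
    "\<And>x. x \<in> X \<Longrightarrow> (f x, g x, k x) \<in> Y"
  shows "computable_on X (\<lambda>x. h (f x) (g x) (k x))"
  using computable_on_comp[OF assms(1) computable_on_Pair[OF assms(2) computable_on_Pair[OF assms(3,4)]] assms(5)] by simp

lemma computable_on_fst: "computable_on X f \<Longrightarrow> computable_on X (\<lambda>x. fst (f x))"
  by (erule computable_on_code[OF _ computable_fst]) (simp add: gnum_prod_def)

lemma computable_on_snd: "computable_on X f \<Longrightarrow> computable_on X (\<lambda>x. snd (f x))"
  by (erule computable_on_code[OF _ computable_snd]) (simp add: gnum_prod_def)

lemma computable_on_gnum: "computable_on X f \<Longrightarrow> computable_on X (\<lambda>x. gnum (f x))"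
  by (erule computable_on_code[OF _ computable_id]) (simp add: gnum_nat_def)

lemma computable_on_computable:
  assumes "computable r" "computable_on X f"
  shows "computable_on X (\<lambda>x. r (f x))"
  by (rule computable_on_code[OF assms(2,1)]) (simp add: gnum_nat_def)

lemma computable_on_code2:
  assumes "computable_on X f" "computable_on X g" "computable r"
    "\<And>x. x \<in> X \<Longrightarrow> r (prod_encode (gnum (f x), gnum (g x))) = gnum (h x)"
  shows "computable_on X h"
  by (rule computable_on_code[OF computable_on_Pair[OF assms(1,2)] assms(3)]) (simp add: gnum_Pair assms(4))

lemma computable_on_prod_encode:
  assumes "computable_on X f" "computable_on X g"
  shows "computable_on X (\<lambda>x. prod_encode (f x, g x))"
  by (rule computable_on_code2[OF assms computable_id]) (simp add: gnum_nat_def)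

lemma computable_on_Suc: "computable_on X f \<Longrightarrow> computable_on X (\<lambda>x. Suc (f x))"
  by (erule computable_on_computable[OF computable_Suc[OF computable_id]])

lemma computable_on_add:
  fixes f g :: "'a::goedel \<Rightarrow> nat"
  assumes "computable_on X f" "computable_on X g"
  shows "computable_on X (\<lambda>x. f x + g x)"
  by (rule computable_on_code2[OF assms computable_add[OF computable_fst computable_snd]])
    (simp add: gnum_nat_def)

lemma computable_on_Some: "computable_on X f \<Longrightarrow> computable_on X (\<lambda>x. Some (f x))"
  by (erule computable_on_code[OF _ computable_Suc[OF computable_id]]) (simp add: gnum_Some)

lemma computable_on_Cons:
  assumes "computable_on X f" "computable_on X g"
  shows "computable_on X (\<lambda>x. f x # g x)"
  by (rule computable_on_code2[OF assms computable_Suc[OF computable_id]]) (simp add: gnum_Cons)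

lemma computable_on_eq:
  fixes f g :: "'a::goedel \<Rightarrow> 'b::goedel"
  assumes "computable_on X f" "computable_on X g"
  shows "computable_on X (\<lambda>x. f x = g x)"
proof -
  let ?a = "\<lambda>n. fst (prod_decode n)" and ?b = "\<lambda>n. snd (prod_decode n)"
  have "computable (\<lambda>n. if (?a n - ?b n) + (?b n - ?a n) = 0 then 1 else 0)"
    by (intro computable_if computable_const computable_add computable_minus
        computable_fst computable_snd)
  moreover have "(gnum u - gnum v) + (gnum v - gnum u) = 0 \<longleftrightarrow> u = v" for u v :: 'b
    by (auto dest: antisym)
  ultimately show ?thesis
    by (intro computable_on_code2[OF assms, where r = "\<lambda>n. if (?a n - ?b n) + (?b n - ?a n) = 0 then 1 else 0"])
      (simp_all only: gnum_bool_def fst_conv snd_conv prod_encode_inverse)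
qed

lemma computable_on_less:
  fixes f g :: "'a::goedel \<Rightarrow> nat"
  assumes "computable_on X f" "computable_on X g"
  shows "computable_on X (\<lambda>x. f x < g x)"
proof -
  let ?a = "\<lambda>n. fst (prod_decode n)" and ?b = "\<lambda>n. snd (prod_decode n)"
  have "computable (\<lambda>n. if ?b n - ?a n = 0 then 0 else 1)"
    by (intro computable_if computable_const computable_minus computable_fst computable_snd)
  then show ?thesis
    by (rule computable_on_code2[OF assms]) (simp add: gnum_bool_def gnum_nat_def)
qed

text \<open>Each branch has to be computable on its own part of the domain only, so that facts such
  as a list being non-empty are available there.\<close>

lemma computable_on_split:
  assumes "computable_on X P" "computable_on {x \<in> X. P x} h" "computable_on {x \<in> X. \<not> P x} h"
  shows "computable_on X h"
proof -
  obtain p r s where "computable p" "\<And>x. x \<in> X \<Longrightarrow> p (gnum x) = gnum (P x)"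
    "computable r" "\<And>x. x \<in> X \<Longrightarrow> P x \<Longrightarrow> r (gnum x) = gnum (h x)"
    "computable s" "\<And>x. x \<in> X \<Longrightarrow> \<not> P x \<Longrightarrow> s (gnum x) = gnum (h x)"
    using assms unfolding computable_on_def by blast
  then show ?thesis
    unfolding computable_on_def
    by (intro exI[of _ "\<lambda>n. if p n = 0 then s n else r n"])
      (auto simp: gnum_bool_def intro: computable_if)
qed

lemma computable_on_if:
  assumes "computable_on X P" "computable_on {x \<in> X. P x} f" "computable_on {x \<in> X. \<not> P x} g"
  shows "computable_on X (\<lambda>x. if P x then f x else g x)"
  by (rule computable_on_split[OF assms(1)]) (rule computable_on_cong[OF assms(2)], simp, rule computable_on_cong[OF assms(3)], simp)

lemma computable_on_conj:
  assumes "computable_on X P" "computable_on {x \<in> X. P x} Q"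
  shows "computable_on X (\<lambda>x. P x \<and> Q x)"
  using computable_on_if[OF assms computable_on_const[of _ False]] by (rule computable_on_cong) auto

lemma computable_on_not:
  assumes "computable_on X P"
  shows "computable_on X (\<lambda>x. \<not> P x)"
  using computable_on_if[OF assms computable_on_const[of _ False] computable_on_const[of _ True]] by (rule computable_on_cong) auto

text \<open>\<open>Z\<close> is an invariant: the step need be computable only on the states that
  the recursion actually reaches.\<close>

lemma computable_on_rec_nat:
  assumes "computable_on X a" "computable_on X m"
    "computable_on Z (\<lambda>z. b (fst z) (fst (snd z)) (snd (snd z)))"
    "\<And>x i. x \<in> X \<Longrightarrow> i < m x \<Longrightarrow> (x, i, rec_nat (a x) (b x) i) \<in> Z"
  shows "computable_on X (\<lambda>x. rec_nat (a x) (b x) (m x))"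
proof -
  obtain ra where ra: "computable ra" "\<And>x. x \<in> X \<Longrightarrow> ra (gnum x) = gnum (a x)"
    using assms(1) unfolding computable_on_def by blast
  obtain rm where rm: "computable rm" "\<And>x. x \<in> X \<Longrightarrow> rm (gnum x) = m x"
    using assms(2) unfolding computable_on_def gnum_nat_def by blast
  obtain rb where rb: "computable rb"
    "\<And>z. z \<in> Z \<Longrightarrow> rb (gnum z) = gnum (b (fst z) (fst (snd z)) (snd (snd z)))"
    using assms(3) unfolding computable_on_def by blast
  have "rec_nat (ra (gnum x)) (\<lambda>i r. rb (prod_encode (gnum x, prod_encode (i, r)))) i =
      gnum (rec_nat (a x) (b x) i)" if "x \<in> X" "i \<le> m x" for x i
    using that(2)
  proof (induction i)
    case 0
    then show ?case using ra that by simp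
  next
    case (Suc i)
    then show ?case
      using rb(2)[OF assms(4)[OF that(1), of i]] by (simp add: gnum_Pair gnum_nat_def)
  qed
  then show ?thesis
    unfolding computable_on_def using computable_rec_nat[OF ra(1) rb(1) rm(1)] rm(2)
    by (intro exI conjI) auto
qed

lemma computable_on_the:
  assumes "computable_on X s" "\<And>x. x \<in> X \<Longrightarrow> s x \<noteq> None"
  shows "computable_on X (\<lambda>x. the (s x))"
proof (rule computable_on_code[OF assms(1) computable_minus[OF computable_id computable_const[of 1]]])
  show "gnum (s x) - 1 = gnum (the (s x))" if "x \<in> X" for x
    using assms(2)[OF that] by (auto simp: gnum_Some)
qed

lemma computable_on_case_option:
  assumes "computable_on X s" "computable_on {x \<in> X. s x = None} f"
    "computable_on {(x, y). x \<in> X \<and> s x = Some y} (\<lambda>z. g (fst z) (snd z))"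
  shows "computable_on X (\<lambda>x. case s x of None \<Rightarrow> f x | Some y \<Rightarrow> g x y)"
proof (rule computable_on_split[where P = "\<lambda>x. s x = None"])
  show "computable_on X (\<lambda>x. s x = None)" by (intro computable_on_eq assms computable_on_const)
  show "computable_on {x \<in> X. s x = None} (\<lambda>x. case s x of None \<Rightarrow> f x | Some y \<Rightarrow> g x y)"
    by (rule computable_on_cong[OF assms(2)]) auto
  have "computable_on {x \<in> X. s x \<noteq> None} (\<lambda>x. g x (the (s x)))"
    by (rule computable_on_comp2[OF assms(3) computable_on_id computable_on_the[OF computable_on_subset[OF assms(1)]]]) auto
  then show "computable_on {x \<in> X. s x \<noteq> None} (\<lambda>x. case s x of None \<Rightarrow> f x | Some y \<Rightarrow> g x y)"
    by (rule computable_on_cong) auto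
qed

lemma computable_on_map_option:
  assumes "computable_on X s" "computable_on {(x, y). x \<in> X \<and> s x = Some y} (\<lambda>z. g (fst z) (snd z))"
  shows "computable_on X (\<lambda>x. map_option (g x) (s x))"
  unfolding map_option_case
  by (intro computable_on_case_option assms computable_on_const computable_on_Some)

section \<open>Lists\<close>

lemma computable_on_hd: "computable_on X l \<Longrightarrow> (\<And>x. x \<in> X \<Longrightarrow> l x \<noteq> []) \<Longrightarrow> computable_on X (\<lambda>x. hd (l x))"
  by (erule computable_on_code[OF _ computable_comp[OF computable_fst
          computable_minus[OF computable_id computable_const[of 1]]]])
    (metis diff_Suc_1 fst_conv gnum_Cons list.collapse prod_encode_inverse)

lemma computable_on_tl: "computable_on X l \<Longrightarrow> (\<And>x. x \<in> X \<Longrightarrow> l x \<noteq> []) \<Longrightarrow> computable_on X (\<lambda>x. tl (l x))"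
  by (erule computable_on_code[OF _ computable_comp[OF computable_snd
          computable_minus[OF computable_id computable_const[of 1]]]])
    (metis diff_Suc_1 snd_conv gnum_Cons list.collapse prod_encode_inverse)

text \<open>The code of a list is a bound on its length that is available before
  \<open>length\<close> itself is known to be computable.\<close>

lemma length_le_gnum: "length xs \<le> gnum xs"
  by (induction xs) (auto simp: gnum_Cons le_prod_encode_2 intro: order.trans)

lemma computable_on_foldl:
  fixes h :: "'a::goedel \<Rightarrow> 'b::goedel \<Rightarrow> 'c::goedel \<Rightarrow> 'b"
  assumes "computable_on X a" "computable_on X l"
    "computable_on {(x, r, y). x \<in> X \<and> y \<in> set (l x)} (\<lambda>z. h (fst z) (fst (snd z)) (snd (snd z)))"
  shows "computable_on X (\<lambda>x. foldl (h x) (a x) (l x))"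
proof -
  \<comment> \<open>The state is the accumulator with the unread rest of the list. An exhausted
    state stays put, so running \<open>gnum (l x)\<close> rounds gives the same result as running
    \<open>length (l x)\<close> rounds.\<close>
  define st where "st x i s = (if snd s = [] then s else (h x (fst s) (hd (snd s)), tl (snd s)))"
    for x and i :: nat and s :: "'b \<times> 'c list"
  define Z where "Z = {(x, i::nat, s :: 'b \<times> 'c list). x \<in> X \<and> set (snd s) \<subseteq> set (l x)}"
  have rec: "rec_nat s (st x) i = (foldl (h x) (fst s) (take i (snd s)), drop i (snd s))" for x s i
  proof (induction i)
    case (Suc i)
    show ?case
    proof (cases "drop i (snd s)")
      case Nil
      then show ?thesis using Suc by (simp add: st_def)
    next
      case (Cons y ys)
      then have "i < length (snd s)" "snd s ! i = y" "drop (Suc i) (snd s) = ys"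
        by (metis drop_eq_Nil list.distinct(1) not_le, metis nth_via_drop, metis drop_Suc list.sel(3) tl_drop)
      then show ?thesis using Suc Cons by (simp add: st_def take_Suc_conv_app_nth)
    qed
  qed auto
  have "computable_on Z (\<lambda>z. st (fst z) (fst (snd z)) (snd (snd z)))"
    unfolding st_def
  proof (intro computable_on_if computable_on_eq computable_on_snd computable_on_fst computable_on_id computable_on_const computable_on_Pair computable_on_tl)
    have "computable_on {z \<in> Z. snd (snd (snd z)) \<noteq> []}
        (\<lambda>z. (fst z, fst (snd (snd z)), hd (snd (snd (snd z)))))"
      by (intro computable_on_Pair computable_on_fst computable_on_snd computable_on_hd computable_on_id) auto
    from computable_on_comp[OF assms(3) this]
    show "computable_on {z \<in> Z. snd (snd (snd z)) \<noteq> []}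
        (\<lambda>z. h (fst z) (fst (snd (snd z))) (hd (snd (snd (snd z)))))"
      unfolding Z_def using list.set_sel(1) by fastforce
  qed auto
  then have "computable_on X (\<lambda>x. rec_nat (a x, l x) (st x) (gnum (l x)))"
    by (rule computable_on_rec_nat[OF computable_on_Pair[OF assms(1,2)] computable_on_gnum[OF assms(2)]])
      (auto simp: Z_def rec dest: in_set_dropD)
  from computable_on_fst[OF this] show ?thesis
    by (rule computable_on_cong) (simp add: rec length_le_gnum)
qed

lemma computable_on_rev: "computable_on X l \<Longrightarrow> computable_on X (\<lambda>x. rev (l x))"
proof -
  have eq: "rev l = foldl (\<lambda>r y. y # r) [] l" for l :: "'b list"
  proof -
    have "foldl (\<lambda>r y. y # r) r l = rev l @ r" for r by (induction l arbitrary: r) auto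
    then show ?thesis by simp
  qed
  show "computable_on X l \<Longrightarrow> computable_on X (\<lambda>x. rev (l x))"
    unfolding eq by (intro computable_on_foldl computable_on_const computable_on_Cons computable_on_fst computable_on_snd computable_on_id)
qed

lemma computable_on_foldr:
  assumes "computable_on X a" "computable_on X l"
    "computable_on {(x, y, r). x \<in> X \<and> y \<in> set (l x)} (\<lambda>z. h (fst z) (fst (snd z)) (snd (snd z)))"
  shows "computable_on X (\<lambda>x. foldr (h x) (l x) (a x))"
proof -
  have "computable_on {(x, r, y). x \<in> X \<and> y \<in> set (rev (l x))}
      (\<lambda>z. h (fst z) (snd (snd z)) (fst (snd z)))"
    by (rule computable_on_comp3[OF assms(3)]) (intro computable_on_fst computable_on_snd computable_on_id | auto)+
  from computable_on_foldl[OF assms(1) computable_on_rev[OF assms(2)], of "\<lambda>x r y. h x y r"] this show ?thesis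
    by (simp add: foldr_conv_foldl)
qed

lemma computable_on_append: "computable_on X f \<Longrightarrow> computable_on X g \<Longrightarrow> computable_on X (\<lambda>x. f x @ g x)"
proof -
  have eq: "f @ g = foldr (\<lambda>y r. y # r) f g" for f g :: "'b list" by (induction f) auto
  show "computable_on X f \<Longrightarrow> computable_on X g \<Longrightarrow> computable_on X (\<lambda>x. f x @ g x)"
    unfolding eq by (intro computable_on_foldr computable_on_Cons computable_on_fst computable_on_snd computable_on_id)
qed

lemma computable_on_map:
  assumes "computable_on X l" "computable_on {(x, y). x \<in> X \<and> y \<in> set (l x)} (\<lambda>z. h (fst z) (snd z))"
  shows "computable_on X (\<lambda>x. map (h x) (l x))"
proof -
  have eq: "map h l = foldr (\<lambda>y r. h y # r) l []" for h :: "'b \<Rightarrow> 'c" and l by (induction l) auto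
  have "computable_on {(x, y, r). x \<in> X \<and> y \<in> set (l x)} (\<lambda>z. h (fst z) (fst (snd z)))"
    by (rule computable_on_comp2[OF assms(2)]) (intro computable_on_fst computable_on_snd computable_on_id | auto)+
  then show ?thesis
    unfolding eq by (intro computable_on_foldr assms computable_on_const computable_on_Cons computable_on_fst computable_on_snd computable_on_id)
qed

lemma computable_on_concat: "computable_on X l \<Longrightarrow> computable_on X (\<lambda>x. concat (l x))"
proof -
  have eq: "concat l = foldr (\<lambda>y r. y @ r) l []" for l :: "'b list list" by (induction l) auto
  show "computable_on X l \<Longrightarrow> computable_on X (\<lambda>x. concat (l x))"
    unfolding eq by (intro computable_on_foldr computable_on_const computable_on_append computable_on_fst computable_on_snd computable_on_id)
qed

lemma computable_on_filter:
  assumes "computable_on X l" "computable_on {(x, y). x \<in> X \<and> y \<in> set (l x)} (\<lambda>z. P (fst z) (snd z))"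
  shows "computable_on X (\<lambda>x. filter (P x) (l x))"
proof -
  have eq: "filter P l = concat (map (\<lambda>y. if P y then [y] else []) l)" for P and l :: "'b list"
    by (induction l) auto
  show ?thesis
    unfolding eq by (intro computable_on_concat computable_on_map computable_on_if assms computable_on_const computable_on_Cons computable_on_snd computable_on_id)
qed

lemma computable_on_list_all:
  assumes "computable_on X l" "computable_on {(x, y). x \<in> X \<and> y \<in> set (l x)} (\<lambda>z. P (fst z) (snd z))"
  shows "computable_on X (\<lambda>x. list_all (P x) (l x))"
proof -
  have eq: "list_all P l \<longleftrightarrow> filter (\<lambda>y. \<not> P y) l = []" for P and l :: "'b list"
    by (induction l) auto
  show ?thesis
    unfolding eq by (intro computable_on_eq computable_on_filter computable_on_not assms computable_on_const)
qed

lemma computable_on_length: "computable_on X l \<Longrightarrow> computable_on X (\<lambda>x. length (l x))"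
proof -
  have eq: "length l = foldr (\<lambda>y r. Suc r) l 0" for l :: "'b list" by (induction l) auto
  show "computable_on X l \<Longrightarrow> computable_on X (\<lambda>x. length (l x))"
    unfolding eq by (intro computable_on_foldr computable_on_const computable_on_Suc computable_on_fst computable_on_snd computable_on_id)
qed

lemma computable_on_map_of:
  "computable_on X l \<Longrightarrow> computable_on X f \<Longrightarrow> computable_on X (\<lambda>x. map_of (l x) (f x))"
proof -
  have eq: "map_of l y = foldr (\<lambda>p r. if fst p = y then Some (snd p) else r) l None"
    for l :: "('b \<times> 'c) list" and y by (induction l) auto
  assume "computable_on X f"
  then have "computable_on {(x, y, r). x \<in> X \<and> y \<in> A x} (\<lambda>z. f (fst z))" for A
    by (rule computable_on_comp) (intro computable_on_fst computable_on_id | auto)+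
  then show "computable_on X l \<Longrightarrow> computable_on X (\<lambda>x. map_of (l x) (f x))"
    unfolding eq
    by (intro computable_on_foldr computable_on_const computable_on_if computable_on_eq computable_on_Some computable_on_fst computable_on_snd computable_on_id)
qed

text \<open>
  Recursion whose recursive calls may change every parameter. The calls reachable from \<open>a\<close> are listed
  first; then their values are tabulated in order of the measure.
\<close>

lemma computable_on_recursion:
  fixes D :: "'a::goedel \<Rightarrow> 'a list" and m :: "'a \<Rightarrow> nat" and H :: "'a \<Rightarrow> 'b::goedel"
  assumes D: "computable_on X D" and m: "computable_on X m"
    and calls: "\<And>a d. a \<in> X \<Longrightarrow> d \<in> set (D a) \<Longrightarrow> d \<in> X \<and> m d < m a"
    and G: "computable_on ((\<lambda>a. (a, map H (D a))) ` X) (\<lambda>z. G (fst z) (snd z))"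
    and H: "\<And>a. a \<in> X \<Longrightarrow> H a = G a (map H (D a))"
  shows "computable_on X H"
proof -
  \<comment> \<open>\<open>R a i\<close> collects the calls that are at most \<open>i\<close> levels
    below \<open>a\<close>; keeping \<open>a\<close> at the front retains the shallower
    levels.\<close>
  define st where "st a i r = a # concat (map D r)" for a and i :: nat and r
  define R where "R a i = rec_nat [a] (st a) i" for a i
  have R_0: "R a 0 = [a]" and R_Suc: "R a (Suc i) = a # concat (map D (R a i))" for a i
    by (simp_all add: R_def st_def)
  have RX: "set (R a i) \<subseteq> X" if "a \<in> X" for a i
    using that calls by (induction i) (auto simp: R_0 R_Suc)
  have bound: "m b \<le> m a" if "a \<in> X" "b \<in> set (R a i)" for a b i
    using that
  proof (induction i arbitrary: b)
    case (Suc i)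
    then show ?case
      using calls[of _ b] RX[OF Suc.prems(1), of i] by (fastforce simp: R_Suc)
  qed (simp add: R_0)
  \<comment> \<open>Each level lowers the measure by at least one, so a call \<open>b\<close> occurs
    at depth at most \<open>m a - m b\<close>. Hence \<open>m a\<close> levels reach every
    call.\<close>
  have early: "b \<in> set (R a j)" if "a \<in> X" "b \<in> set (R a i)" "m a \<le> m b + j" for a b i j
    using that
  proof (induction i arbitrary: b j)
    case 0
    then show ?case by (cases j) (auto simp: R_0 R_Suc)
  next
    case (Suc i)
    show ?case
    proof (cases "b = a")
      case True
      then show ?thesis by (cases j) (auto simp: R_0 R_Suc)
    next
      case False
      then obtain b' where b': "b' \<in> set (R a i)" "b \<in> set (D b')"
        using Suc.prems by (auto simp: R_Suc)
      then have lt: "m b < m b'" using calls RX Suc.prems(1) by blast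
      have "m b' \<le> m a" using bound Suc.prems(1) b'(1) by blast
      with lt Suc.prems(3) obtain j' where j: "j = Suc j'" by (cases j) auto
      have "b' \<in> set (R a j')" using Suc.IH[OF Suc.prems(1) b'(1), of j'] lt Suc.prems(3) j by simp
      then show ?thesis using b'(2) by (auto simp: j R_Suc)
    qed
  qed
  define Q where "Q a = R a (m a)" for a
  have QX: "b \<in> X" if "a \<in> X" "b \<in> set (Q a)" for a b
    using RX that unfolding Q_def by blast
  have closed: "d \<in> set (Q a)" if "a \<in> X" "b \<in> set (Q a)" "d \<in> set (D b)" for a b d
    using early[of a d "Suc (m a)" "m a"] that by (auto simp: Q_def R_Suc)
  have "computable_on X Q"
    unfolding Q_def R_def
  proof (rule computable_on_rec_nat)
    let ?Z = "{(a, i, r). set r \<subseteq> X}"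
    have "computable_on {(z, y). z \<in> ?Z \<and> y \<in> set (snd (snd z))} (\<lambda>x. D (snd x))"
      by (rule computable_on_comp[OF D]) (intro computable_on_snd computable_on_id | auto)+
    then show "computable_on ?Z (\<lambda>z. st (fst z) (fst (snd z)) (snd (snd z)))"
      unfolding st_def by (intro computable_on_Cons computable_on_concat computable_on_map computable_on_fst computable_on_snd computable_on_id)
    show "(x, i, rec_nat [x] (st x) i) \<in> ?Z" if "x \<in> X" for x i
      using RX[OF that, of i] by (simp add: R_def)
  qed (intro computable_on_Cons computable_on_id computable_on_const m)+
  \<comment> \<open>Round \<open>i\<close> rebuilds the table for all calls of measure at most
    \<open>i\<close>, looking up the values of their subcalls, which have measure below
    \<open>i\<close>, in the previous table \<open>T\<close>.\<close>
  define W where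
    "W a i T = map (\<lambda>b. (b, G b (map (\<lambda>d. the (map_of T d)) (D b)))) (filter (\<lambda>b. m b < Suc i) (Q a))"
    for a i and T :: "('a \<times> 'b) list"
  define tab where "tab a i = map (\<lambda>b. (b, H b)) (filter (\<lambda>b. m b < i) (Q a))" for a i
  have lookup: "map_of (tab a i) d = Some (H d)" if "d \<in> set (Q a)" "m d < i" for a d i
    using that by (simp add: tab_def map_of_map_restrict restrict_map_def)
  have below: "map_of (tab a i) d = Some (H d)"
    if "a \<in> X" "b \<in> set (Q a)" "m b < Suc i" "d \<in> set (D b)" for a b d i
    using that lookup closed calls QX by (meson less_Suc_eq_le order_less_le_trans)
  have rec: "rec_nat [] (W a) i = tab a i" if "a \<in> X" for a i
  proof (induction i)
    case 0
    then show ?case by (simp add: tab_def)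
  next
    case (Suc i)
    have "W a i (tab a i) = tab a (Suc i)"
      unfolding W_def tab_def[of a "Suc i"]
    proof (rule map_cong[OF HOL.refl])
      fix b assume "b \<in> set (filter (\<lambda>b. m b < Suc i) (Q a))"
      then have b: "b \<in> set (Q a)" "m b < Suc i" by auto
      have "map (\<lambda>d. the (map_of (tab a i) d)) (D b) = map H (D b)"
        using below[OF that b] by simp
      then show "(b, G b (map (\<lambda>d. the (map_of (tab a i) d)) (D b))) = (b, H b)"
        using H[of b] QX[OF that b(1)] by (simp del: map_eq_conv)
    qed
    then show ?case using Suc by simp
  qed
  have "computable_on X (\<lambda>a. rec_nat [] (W a) (Suc (m a)))"
  proof (rule computable_on_rec_nat)
    let ?Z = "{(a, i, T). a \<in> X \<and> T = tab a i}"
    let ?Y = "{(z, b). z \<in> ?Z \<and> b \<in> set (filter (\<lambda>b. m b < Suc (fst (snd z))) (Q (fst z)))}"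
    have DY: "computable_on ?Y (\<lambda>x. D (snd x))"
      by (rule computable_on_comp[OF D]) (intro computable_on_snd computable_on_id | auto intro: QX)+
    have "computable_on ?Y (\<lambda>x. map (\<lambda>d. the (map_of (snd (snd (fst x))) d)) (D (snd x)))"
      by (intro computable_on_map DY computable_on_the computable_on_map_of computable_on_fst computable_on_snd computable_on_id) (auto simp: below)
    from computable_on_Pair[OF computable_on_snd[OF computable_on_id] this]
    have "computable_on ?Y (\<lambda>x. G (snd x) (map (\<lambda>d. the (map_of (snd (snd (fst x))) d)) (D (snd x))))"
    proof (rule computable_on_comp[OF G, where f = "\<lambda>x. (snd x, map (\<lambda>d. the (map_of (snd (snd (fst x))) d)) (D (snd x)))",
          unfolded fst_conv snd_conv], goal_cases)
      case (1 x)
      then obtain a i b where x: "x = ((a, i, tab a i), b)" "a \<in> X" "b \<in> set (Q a)" "m b < Suc i"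
        by auto
      then have "map (\<lambda>d. the (map_of (tab a i) d)) (D b) = map H (D b)"
        using below by simp
      then show ?case using x QX by auto
    qed
    moreover have "computable_on ?Z (\<lambda>z. Q (fst z))"
      by (rule computable_on_comp[OF \<open>computable_on X Q\<close>]) (intro computable_on_fst computable_on_id | auto)+
    moreover have "computable_on {(z, b). z \<in> ?Z \<and> b \<in> set (Q (fst z))} (\<lambda>z. m (snd z))"
      by (rule computable_on_comp[OF m]) (intro computable_on_snd computable_on_id | auto intro: QX)+
    ultimately show "computable_on ?Z (\<lambda>z. W (fst z) (fst (snd z)) (snd (snd z)))"
      unfolding W_def
      by (intro computable_on_map computable_on_filter computable_on_less computable_on_Suc computable_on_Pair computable_on_fst computable_on_snd computable_on_id) auto
  qed (intro computable_on_const computable_on_Suc m | simp add: rec)+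
  then have "computable_on X (\<lambda>a. tab a (Suc (m a)))"
    by (rule computable_on_cong) (rule rec)
  then have "computable_on X (\<lambda>a. the (map_of (tab a (Suc (m a))) a))"
    using early[of _ _ 0] by (intro computable_on_the computable_on_map_of computable_on_id) (auto simp: lookup Q_def R_0)
  then show ?thesis
    by (rule computable_on_cong) (simp add: lookup Q_def early[of _ _ 0] R_0)
qed

subsection \<open>Size substitutions\<close>

text \<open>Maps the finite sizes of a type and keeps \<open>\<infinity>\<close>. It covers finite
  size substitutions as well as the replacement of constants, which is not a substitution.\<close>

primrec amap :: "(sterm \<Rightarrow> sterm) \<Rightarrow> aty \<Rightarrow> aty" where
  "amap g (Srt B a) = Srt B (map_option g a)"
| "amap g (Arr U W) = Arr (amap g U) (amap g W)"

lemma xsub_None [simp]: "xsub \<psi> None = None"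
  by (simp add: xsub_def)

lemma xsub_finite [simp]: "xsub (\<lambda>x. Some (\<theta> x)) a = map_option (ssub \<theta>) a"
  by (cases a) (simp_all add: xsub_def)

lemma asub_finite: "asub (\<lambda>x. Some (\<theta> x)) A = amap (ssub \<theta>) A"
  by (induction A) simp_all

lemma ssub_cong: "(\<And>x. x \<in> svars s \<Longrightarrow> \<theta> x = \<theta>' x) \<Longrightarrow> ssub \<theta> s = ssub \<theta>' s"
  by (induction s) auto

lemma ssub_SVar [simp]: "ssub SVar s = s"
  by (induction s) (auto intro: map_idI)

lemma ssub_ssub: "ssub \<theta> (ssub \<sigma> s) = ssub (\<lambda>x. ssub \<theta> (\<sigma> x)) s"
  by (induction s) auto

lemma svars_ssub: "svars (ssub \<theta> s) = (\<Union>x \<in> svars s. svars (\<theta> x))"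
  by (induction s) auto

lemma xsub_cong: "(\<And>x. x \<in> xvars a \<Longrightarrow> \<psi> x = \<psi>' x) \<Longrightarrow> xsub \<psi> a = xsub \<psi>' a"
  by (auto simp: xsub_def xvars_def split: option.splits intro!: ssub_cong)

lemma asub_cong: "(\<And>x. x \<in> avars A \<Longrightarrow> \<psi> x = \<psi>' x) \<Longrightarrow> asub \<psi> A = asub \<psi>' A"
proof (induction A)
  case (Srt B a)
  then show ?case using xsub_cong[of a \<psi> \<psi>'] by simp
qed simp

lemma xsub_xsub: "xsub \<theta> (xsub \<psi> a) = xsub (\<lambda>x. xsub \<theta> (\<psi> x)) a"
proof (cases a)
  case (Some s)
  show ?thesis
  proof (cases "\<exists>x \<in> svars s. \<psi> x = None")
    case True
    then show ?thesis using Some by (force simp: xsub_def)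
  next
    case False
    define \<sigma> where "\<sigma> = (\<lambda>x. the (\<psi> x))"
    have "\<psi> x = Some (\<sigma> x)" if "x \<in> svars s" for x using that False by (auto simp: \<sigma>_def)
    then have "xsub (\<lambda>x. xsub \<theta> (\<psi> x)) a = xsub (\<lambda>x. xsub \<theta> (Some (\<sigma> x))) a"
      by (intro xsub_cong) (simp add: xvars_def Some)
    moreover have "xsub \<psi> a = Some (ssub \<sigma> s)"
      using False by (simp add: Some xsub_def \<sigma>_def)
    moreover have "xsub \<theta> (Some (ssub \<sigma> s)) = xsub (\<lambda>x. xsub \<theta> (Some (\<sigma> x))) (Some s)"
      by (force simp: xsub_def svars_ssub ssub_ssub intro!: ssub_cong)
    ultimately show ?thesis by (simp add: Some)
  qed
qed simp

lemma asub_asub: "asub \<theta> (asub \<psi> A) = asub (\<lambda>x. xsub \<theta> (\<psi> x)) A"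
  by (induction A) (simp_all add: xsub_xsub)

lemma asub_id [simp]: "asub (\<lambda>x. Some (SVar x)) A = A"
  proof (induction A)
  case (Srt B a)
  then show ?case by (cases a) simp_all
qed simp

lemma avars_emb [simp]: "avars (emb U) = {}"
  by (induction U) (simp_all add: xvars_def)

lemma asub_emb [simp]: "asub \<psi> (emb U) = emb U"
  by (induction U) simp_all

lemma avars_finite_sub: "avars (amap (ssub \<theta>) A) = (\<Union>x \<in> avars A. svars (\<theta> x))"
  by (induction A) (auto simp: xvars_def svars_ssub split: option.splits)

lemma asub_eq_Arr: "asub \<psi> A = Arr U W \<Longrightarrow> \<exists>U' W'. A = Arr U' W' \<and> U = asub \<psi> U' \<and> W = asub \<psi> W'"
  by (cases A) auto

lemma asub_arrs: "asub \<psi> (arrs Us W) = arrs (map (asub \<psi>) Us) (asub \<psi> W)"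
  by (induction Us) (simp_all add: arrs_def)

lemma asub_eq_arrs:
  "asub \<psi> A = arrs Us W \<Longrightarrow> \<exists>Us' W'. A = arrs Us' W' \<and> Us = map (asub \<psi>) Us' \<and> W = asub \<psi> W'"
proof (induction Us arbitrary: A)
  case Nil
  then show ?case by (intro exI[of _ "[]"]) (auto simp: arrs_def)
next
  case (Cons U Us)
  then obtain U' A' where A: "A = Arr U' A'" "U = asub \<psi> U'" "arrs Us W = asub \<psi> A'"
    using asub_eq_Arr[of \<psi> A U "arrs Us W"] by (auto simp: arrs_def)
  from Cons.IH[OF A(3)[symmetric]] obtain Us' W'
    where "A' = arrs Us' W'" "Us = map (asub \<psi>) Us'" "W = asub \<psi> W'" by blast
  with A show ?case by (intro exI[of _ "U' # Us'"]) (auto simp: arrs_def)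
qed

lemma ssub_sizes: "s \<in> sizes S \<Longrightarrow> (\<And>x. x \<in> svars s \<Longrightarrow> \<theta> x \<in> sizes S) \<Longrightarrow> ssub \<theta> s \<in> sizes S"
proof (induction rule: sizes.induct)
  case (2 k ts)
  then have "\<forall>t \<in> set ts. ssub \<theta> t \<in> sizes S" by fastforce
  with 2 show ?case by (auto intro!: sizes.intros)
qed simp

lemma crepl_sizes: "s \<in> sizes S \<Longrightarrow> e \<in> sizes S \<Longrightarrow> crepl c e s \<in> sizes S"
  by (induction rule: sizes.induct) (auto intro!: sizes.intros)

lemma Some_xsizes [simp]: "Some s \<in> xsizes S \<longleftrightarrow> s \<in> sizes S"
  by (auto simp: xsizes_def)

lemma None_xsizes [simp]: "None \<in> xsizes S"
  by (simp add: xsizes_def)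

lemma xsub_xsizes: "a \<in> xsizes S \<Longrightarrow> (\<And>x. \<psi> x \<in> xsizes S) \<Longrightarrow> xsub \<psi> a \<in> xsizes S"
proof (cases a)
  case (Some s)
  assume *: "a \<in> xsizes S" "\<And>x. \<psi> x \<in> xsizes S"
  have "the (\<psi> x) \<in> sizes S" if "\<psi> x \<noteq> None" for x
    using *(2)[of x] that by auto
  then show ?thesis using * Some by (auto simp: xsub_def intro!: ssub_sizes)
qed simp

lemma aty_ok_asub: "aty_ok S A \<Longrightarrow> (\<And>x. \<psi> x \<in> xsizes S) \<Longrightarrow> aty_ok S (asub \<psi> A)"
  by (induction A) (auto intro: xsub_xsizes)

lemma aty_ok_emb: "sty_ok S U \<Longrightarrow> aty_ok S (emb U)"
  by (induction U) auto

subsection \<open>Subtyping\<close>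

context size_algebra begin

lemma xle_trans: "xle S a b \<Longrightarrow> xle S b c \<Longrightarrow> xle S a c"
  by (auto simp: xle_def intro: sle_trans)

lemma xle_refl: "a \<in> xsizes S \<Longrightarrow> xle S a a"
  by (cases a) (auto simp: xle_def intro: sle_refl)

text \<open>Inversion of subtyping has to pass through the transitivity rule, hence the induction on
  both shapes at once. The alternative \<open>a = b\<close> is there because reflexivity holds for
  all types, whereas \<open>xle\<close> is confined to well-formed sizes.\<close>

lemma subtype_cases:
  "subtype S X Y \<Longrightarrow>
    (\<forall>B a. X = Srt B a \<longrightarrow> (\<exists>b. Y = Srt B b \<and> (a = b \<or> xle S a b))) \<and>
    (\<forall>U W. X = Arr U W \<longrightarrow> (\<exists>U' W'. Y = Arr U' W' \<and> subtype S U' U \<and> subtype S W W'))"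
proof (induction rule: subtype.induct)
  case (trans U W T)
  then show ?case by (cases U) (auto, (meson subtype.trans xle_trans)+)
qed (auto intro: subtype.refl)

lemma subtype_Srt: "subtype S (Srt B a) (Srt B' b) \<longleftrightarrow> B = B' \<and> (a = b \<or> xle S a b)"
  using subtype_cases[of "Srt B a" "Srt B' b"] by (auto intro: subtype.sort subtype.refl)

lemma subtype_amap:
  assumes "subtype S A B" "\<And>a. a \<in> sizes S \<Longrightarrow> g a \<in> sizes S"
    "\<And>a b. a \<in> sizes S \<Longrightarrow> b \<in> sizes S \<Longrightarrow> sle S a b \<Longrightarrow> sle S (g a) (g b)"
  shows "subtype S (amap g A) (amap g B)"
  using assms(1)
proof (induction rule: subtype.induct)
  case (sort a b B)
  then show ?case using assms(2,3) by (cases a; cases b) (auto simp: xle_def intro!: subtype.sort)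
next
  case (trans U W T)
  show ?case by (rule subtype.trans[OF trans.IH])
qed (auto intro: subtype.arr subtype.refl)

lemma subtype_ssub:
  assumes "subtype S A B" "\<And>x. \<theta> x \<in> sizes S"
  shows "subtype S (amap (ssub \<theta>) A) (amap (ssub \<theta>) B)"
  using assms by (intro subtype_amap) (auto intro: ssub_sizes sle_stable)

end

subsection \<open>Syntax-directed typing\<close>

text \<open>\<open>pty S f \<phi> \<Gamma> n t R\<close>: the term \<open>t\<close>, in a context where it is applied to \<open>n\<close> further arguments, has
  type \<open>R\<close> without a final use of subsumption.\<close>

inductive pty :: "('o, 'd) system \<Rightarrow> nat \<Rightarrow> ssubst \<Rightarrow> env \<Rightarrow> nat \<Rightarrow> trm \<Rightarrow> aty \<Rightarrow> bool"
  for S f \<phi> where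
  head: "\<lbrakk>declared S \<Gamma> h A; sym_less S h f \<or> saturated S f h n; ssubst_on S (inst_vars S h) \<psi>;
      decreases S h \<psi> f \<phi>\<rbrakk> \<Longrightarrow> pty S f \<phi> \<Gamma> n (Sy h) (asub \<psi> A)"
| app: "\<lbrakk>pty S f \<phi> \<Gamma> (Suc n) t (Arr U W); pty S f \<phi> \<Gamma> 0 u U'; subtype S U' U\<rbrakk>
      \<Longrightarrow> pty S f \<phi> \<Gamma> n (App t u) W"
| lam: "pty S f \<phi> (push (emb U) \<Gamma>) 0 w W \<Longrightarrow> pty S f \<phi> \<Gamma> 0 (Lam U w) (Arr (emb U) W)"

text \<open>The rule \<open>app_decr\<close> types a whole spine at once, \<open>pty\<close> one
  argument at a time. The induction therefore carries the arguments \<open>us\<close> still to come,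
  already typed; their number \<open>n\<close> is what the saturation condition at the head refers
  to.\<close>

lemma pty_typing_spine:
  "pty S f \<phi> \<Gamma> n t R \<Longrightarrow> length us = n \<Longrightarrow> R = arrs Us W \<Longrightarrow>
    list_all2 (typing S f \<phi> \<Gamma>) us Us \<Longrightarrow> typing S f \<phi> \<Gamma> (apps t us) W"
proof (induction arbitrary: us Us W rule: pty.induct)
  case (head \<Gamma> h A n \<psi>)
  obtain Us' W' where A: "A = arrs Us' W'" "Us = map (asub \<psi>) Us'" "W = asub \<psi> W'"
    using asub_eq_arrs[of \<psi> A Us W] head.prems(2) by blast
  show ?case
    unfolding A(3)
  proof (rule typing.app_decr[where Us = Us'])
    show "sym_less S h f \<or> saturated S f h (length Us')"
      using head A list_all2_lengthD[OF head.prems(3)] by auto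
    show "list_all2 (\<lambda>w U. typing S f \<phi> \<Gamma> w (asub \<psi> U)) us Us'"
      using head.prems(3) A(2) by (simp add: list_all2_map2)
  qed (use head A in auto)
next
  case (app \<Gamma> n t U W' u U')
  have "typing S f \<phi> \<Gamma> u U'"
    using app.IH(2)[of "[]" "[]" U'] by (simp add: arrs_def apps_def)
  then have "typing S f \<phi> \<Gamma> u U"
    using app.hyps(3) by (rule typing.sub)
  then have "typing S f \<phi> \<Gamma> (apps t (u # us)) W"
    using app by (intro app.IH(1)[where Us = "U # Us"]) (auto simp: arrs_def)
  then show ?case by (simp add: apps_def)
next
  case (lam U \<Gamma> w W')
  then have "typing S f \<phi> \<Gamma> (Lam U w) (Arr (emb U) W')"
    using lam.IH[of "[]" "[]" W'] by (intro typing.lam) (simp add: arrs_def apps_def)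
  then show ?case using lam.prems by (simp add: apps_def arrs_def)
qed

lemma pty_apps:
  "pty S f \<phi> \<Gamma> (n + length ws) t (arrs Us W) \<Longrightarrow>
    list_all2 (\<lambda>w U. \<exists>R. pty S f \<phi> \<Gamma> 0 w R \<and> subtype S R U) ws Us \<Longrightarrow>
    pty S f \<phi> \<Gamma> n (apps t ws) W"
proof (induction ws arbitrary: t Us)
  case Nil
  then show ?case by (simp add: apps_def arrs_def)
next
  case (Cons w ws)
  then obtain U Us' where Us: "Us = U # Us'" by (cases Us) auto
  have "pty S f \<phi> \<Gamma> (n + length ws) (App t w) (arrs Us' W)"
    using Cons.prems Us by (force simp: arrs_def intro: pty.app)
  with Cons.IH[OF this] Cons.prems Us show ?case by (simp add: apps_def)
qed

text \<open>Subsumption can be postponed: at an argument it is absorbed by the premise of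
  \<open>pty.app\<close>, below an abstraction it moves outwards by covariance, and only one use
  remains at the root.\<close>

lemma typing_iff_pty:
  "typing S f \<phi> \<Gamma> t T \<longleftrightarrow> (\<exists>R. pty S f \<phi> \<Gamma> 0 t R \<and> subtype S R T)"
proof
  show "typing S f \<phi> \<Gamma> t T" if ex: "\<exists>R. pty S f \<phi> \<Gamma> 0 t R \<and> subtype S R T"
  proof -
    obtain R where R: "pty S f \<phi> \<Gamma> 0 t R" "subtype S R T" using ex by blast
    have "typing S f \<phi> \<Gamma> t R"
      using pty_typing_spine[OF R(1), of "[]" "[]" R] by (simp add: arrs_def apps_def)
    then show ?thesis using R(2) by (rule typing.sub)
  qed
  show "\<exists>R. pty S f \<phi> \<Gamma> 0 t R \<and> subtype S R T" if "typing S f \<phi> \<Gamma> t T"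
    using that
  proof (induction rule: typing.induct)
    case (app_decr \<Gamma> h Us W \<psi> ws)
    have all: "list_all2 (\<lambda>w U. \<exists>R. pty S f \<phi> \<Gamma> 0 w R \<and> subtype S R U) ws (map (asub \<psi>) Us)"
      unfolding list_all2_map2 using app_decr.IH by (rule list_all2_mono) auto
    have "pty S f \<phi> \<Gamma> (0 + length ws) (Sy h) (asub \<psi> (arrs Us W))"
      using app_decr list_all2_lengthD[OF all] by (intro pty.head) auto
    then have "pty S f \<phi> \<Gamma> 0 (apps (Sy h) ws) (asub \<psi> W)"
      unfolding asub_arrs by (rule pty_apps) (rule all)
    then show ?case using subtype.refl by blast
  next
    case (lam U \<Gamma> w W)
    then obtain R where "pty S f \<phi> (push (emb U) \<Gamma>) 0 w R" "subtype S R W" by blast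
    then show ?case using pty.lam subtype.arr[OF subtype.refl] by blast
  next
    case (sub \<Gamma> t U W)
    then obtain R where R: "pty S f \<phi> \<Gamma> 0 t R" "subtype S R U" by blast
    then show ?case using subtype.trans[OF R(2) sub.hyps(2)] by blast
  qed
qed

subsection \<open>Generation of subtyping constraints\<close>

text \<open>
  The size variable \<open>x\<close> of the declared type of the symbol at path \<open>p\<close>. The empty path is reserved for
  the size variables of the environment and of the goal type, which must not be instantiated.
\<close>

definition pvar :: "nat list \<Rightarrow> nat \<Rightarrow> nat" where
  "pvar p x = prod_encode (gnum p, x)"

definition at_path :: "nat list \<Rightarrow> aty \<Rightarrow> aty" where
  "at_path p A = asub (\<lambda>x. Some (SVar (pvar p x))) A"

definition rigid :: "nat \<Rightarrow> bool" where
  "rigid y \<longleftrightarrow> fst (prod_decode y) = 0"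

text \<open>Reads off \<open>\<alpha>\<^sup>g\<close> from the annotated type of \<open>g\<close>.\<close>

fun leading_vars :: "aty \<Rightarrow> nat list" where
  "leading_vars (Arr (Srt B (Some (SVar x))) W) = x # leading_vars W"
| "leading_vars _ = []"

definition shift :: "sty \<Rightarrow> (nat \<times> aty) list \<Rightarrow> (nat \<times> aty) list" where
  "shift U L = (0, emb U) # map (\<lambda>e. (Suc (fst e), snd e)) L"

text \<open>The type of the term, the subtyping constraints, and the decrease conditions. A
  condition \<open>(g, ys)\<close> lists the variables \<open>ys\<close> whose values form
  \<open>\<alpha>\<^sup>g\<psi>\<close>.\<close>

type_synonym constraints = "aty \<times> (aty \<times> aty) list \<times> (nat \<times> nat list) list"

text \<open>The equivalence of \<open>g\<close> and \<open>f\<close> is not tested here: it is part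
  of \<open>less_A\<close>, hence of the emitted decrease condition. The length of
  \<open>leading_vars\<close> stands for \<open>q S g\<close>, so that everything is read off from
  the declared type, which is computable.\<close>

definition gen_sym ::
  "('o, 'd) system \<Rightarrow> nat \<Rightarrow> sym \<Rightarrow> (nat \<times> aty) list \<Rightarrow> nat list \<Rightarrow> nat \<Rightarrow> constraints option" where
  "gen_sym S f h L p n = (case h of
      V x \<Rightarrow> (case map_of L x of None \<Rightarrow> None | Some A \<Rightarrow> Some (A, [], []))
    | C c \<Rightarrow> Some (at_path p (annC S c), [], [])
    | F g \<Rightarrow>
        if fless S g f then Some (at_path p (annF S g), [], [])
        else if n < length (leading_vars (annF S g)) then None
        else Some (at_path p (annF S g), [], [(g, map (pvar p) (leading_vars (annF S g)))]))"

definition gen_lam :: "sty \<Rightarrow> nat \<Rightarrow> constraints option \<Rightarrow> constraints option" where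
  "gen_lam U n r = (if n = 0 then map_option (\<lambda>z. (Arr (emb U) (fst z), snd z)) r else None)"

text \<open>Size substitutions keep the shape of a type, so a head whose generated type is a sort
  can be rejected at once.\<close>

definition gen_app :: "constraints option \<Rightarrow> constraints option \<Rightarrow> constraints option" where
  "gen_app r r' = (case r of None \<Rightarrow> None | Some z \<Rightarrow> (case r' of None \<Rightarrow> None | Some z' \<Rightarrow>
     (case fst z of Srt B a \<Rightarrow> None | Arr U W \<Rightarrow>
        Some (W, (fst z', U) # fst (snd z) @ fst (snd z'), snd (snd z) @ snd (snd z')))))"

primrec gen ::
  "('o, 'd) system \<Rightarrow> nat \<Rightarrow> trm \<Rightarrow> (nat \<times> aty) list \<Rightarrow> nat list \<Rightarrow> nat \<Rightarrow> constraints option" where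
  "gen S f (Sy h) L p n = gen_sym S f h L p n"
| "gen S f (Lam U t) L p n = gen_lam U n (gen S f t (shift U L) (0 # p) 0)"
| "gen S f (App t u) L p n = gen_app (gen S f t L (1 # p) (Suc n)) (gen S f u L (2 # p) 0)"

definition admissible :: "('o, 'd) system \<Rightarrow> ssubst \<Rightarrow> bool" where
  "admissible S \<Psi> \<longleftrightarrow> (\<forall>y. \<Psi> y \<in> xsizes S) \<and> (\<forall>x. \<Psi> (pvar [] x) = Some (SVar x))"

definition solves :: "('o, 'd) system \<Rightarrow> ssubst \<Rightarrow> (aty \<times> aty) list \<Rightarrow> bool" where
  "solves S \<Psi> cs \<longleftrightarrow> (\<forall>(A, B) \<in> set cs. subtype S (asub \<Psi> A) (asub \<Psi> B))"

definition decr ::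
  "('o, 'd) system \<Rightarrow> nat \<Rightarrow> ssubst \<Rightarrow> ssubst \<Rightarrow> (nat \<times> nat list) list \<Rightarrow> bool" where
  "decr S f \<phi> \<Psi> ds \<longleftrightarrow> (\<forall>(g, ys) \<in> set ds. \<exists>as bs. map \<Psi> ys = map Fin as \<and>
     map \<phi> (alpha S f) = map Fin bs \<and> less_A S g f as bs)"

lemma pvar_eq [simp]: "pvar p x = pvar p' x' \<longleftrightarrow> p = p' \<and> x = x'"
  by (auto simp: pvar_def)

lemma rigid_pvar [simp]: "rigid (pvar p x) \<longleftrightarrow> p = []"
  by (cases p) (simp_all add: rigid_def pvar_def gnum_Nil gnum_Cons)

lemma rigid_iff: "rigid y \<longleftrightarrow> (\<exists>x. y = pvar [] x)"
proof
  assume "rigid y"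
  then have "y = pvar [] (snd (prod_decode y))"
    unfolding rigid_def pvar_def gnum_Nil by (metis prod.collapse prod_decode_inverse)
  then show "\<exists>x. y = pvar [] x" by blast
qed auto

lemma asub_at_path: "asub \<Psi> (at_path p A) = asub (\<lambda>x. \<Psi> (pvar p x)) A"
  unfolding at_path_def asub_asub by (rule asub_cong) (simp add: xsub_def)

lemma avars_at_path: "avars (at_path p A) = pvar p ` avars A"
  unfolding at_path_def asub_finite avars_finite_sub by auto

lemma aty_ok_at_path: "aty_ok S A \<Longrightarrow> aty_ok S (at_path p A)"
  unfolding at_path_def by (rule aty_ok_asub) (auto intro: sizes.intros)

lemma asub_rigid: "admissible S \<Psi> \<Longrightarrow> asub \<Psi> (at_path [] A) = A"
  by (simp add: asub_at_path admissible_def)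

lemma at_path_emb [simp]: "at_path p (emb U) = emb U"
  by (simp add: at_path_def)

lemma map_of_shift:
  "map_of (shift U L) = case_nat (Some (emb U)) (map_of L)"
proof
  have "map_of (map (\<lambda>e. (Suc (fst e), snd e)) L) (Suc x) = map_of L x" for x
    by (induction L) auto
  then show "map_of (shift U L) x = case_nat (Some (emb U)) (map_of L) x" for x
    by (cases x) (auto simp: shift_def)
qed

lemma ran_shift: "ran (map_of (shift U L)) = insert (emb U) (ran (map_of L))"
proof -
  have "map_of (shift U L) 0 = Some (emb U)" "map_of (shift U L) (Suc x) = map_of L x" for x
    by (simp_all add: map_of_shift)
  note eqs = this
  show ?thesis
  proof (intro set_eqI iffI)
    fix B assume "B \<in> ran (map_of (shift U L))"
    then obtain x where "map_of (shift U L) x = Some B" by (auto simp: ran_def)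
    then show "B \<in> insert (emb U) (ran (map_of L))" by (cases x) (auto simp: eqs intro: ranI)
  next
    fix B assume "B \<in> insert (emb U) (ran (map_of L))"
    then show "B \<in> ran (map_of (shift U L))"
      using eqs(1) eqs(2)[symmetric] by (auto simp: ran_def)
  qed
qed

lemma env_shift:
  assumes "\<And>x. map_of L x = map_option (at_path []) (\<Gamma> x)"
  shows "map_of (shift U L) x = map_option (at_path []) (push (emb U) \<Gamma> x)"
  using assms by (cases x) (simp_all add: map_of_shift push_def)

text \<open>Paths grow at the front, so the positions below \<open>p\<close> are the paths with
  suffix \<open>p\<close>. The rigid variables are common to all positions.\<close>

definition path_vars :: "nat list \<Rightarrow> nat set" where
  "path_vars p = {y. rigid y \<or> (\<exists>q x. y = pvar q x \<and> suffix p q)}"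

lemma path_vars_Cons: "path_vars (i # p) \<subseteq> path_vars p"
  by (auto simp: path_vars_def dest: suffix_ConsD)

definition cvars :: "constraints \<Rightarrow> nat set" where
  "cvars z = avars (fst z) \<union> (\<Union>c \<in> set (fst (snd z)). avars (fst c) \<union> avars (snd c)) \<union>
     (\<Union>d \<in> set (snd (snd z)). set (snd d))"

text \<open>Locality of the fresh variables: the constraints of two sibling subterms share rigid
  variables only. This allows solutions for the siblings to be glued together.\<close>

lemma gen_vars:
  "gen S f t L p n = Some (A, cs, ds) \<Longrightarrow>
    (\<forall>B \<in> ran (map_of L). avars B \<subseteq> Collect rigid) \<Longrightarrow>
    cvars (A, cs, ds) \<subseteq> path_vars p"
proof (induction t arbitrary: L p n A cs ds)
  case (Sy h)
  have p: "pvar p x \<in> path_vars p" for x by (auto simp: path_vars_def)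
  have r: "Collect rigid \<subseteq> path_vars p" by (auto simp: path_vars_def)
  show ?case
  proof (cases h)
    case (V x)
    then have "map_of L x = Some A" "cs = []" "ds = []"
      using Sy.prems(1) by (auto simp: gen_sym_def split: option.splits)
    then show ?thesis using Sy.prems(2) r ranI[of "map_of L" x A] by (auto simp: cvars_def)
  qed (use Sy.prems(1) p in \<open>auto simp: cvars_def gen_sym_def avars_at_path split: if_splits\<close>)
next
  case (Lam U t)
  then obtain A' where A': "gen S f t (shift U L) (0 # p) 0 = Some (A', cs, ds)" "A = Arr (emb U) A'"
    by (auto simp: gen_lam_def split: if_splits)
  have "\<forall>B \<in> ran (map_of (shift U L)). avars B \<subseteq> Collect rigid"
    using Lam.prems(2) by (simp add: ran_shift)
  from Lam.IH[OF A'(1) this] have "cvars (A', cs, ds) \<subseteq> path_vars p"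
    using path_vars_Cons by (rule subset_trans)
  then show ?case by (simp add: A'(2) cvars_def)
next
  case (App t u)
  then obtain U W cs1 ds1 B cs2 ds2
    where t: "gen S f t L (1 # p) (Suc n) = Some (Arr U W, cs1, ds1)"
      and u: "gen S f u L (2 # p) 0 = Some (B, cs2, ds2)"
      and A: "A = W" "cs = (B, U) # cs1 @ cs2" "ds = ds1 @ ds2"
    by (auto simp: gen_app_def split: option.splits aty.splits)
  have "cvars (Arr U W, cs1, ds1) \<subseteq> path_vars p"
    using App.IH(1)[OF t App.prems(2)] path_vars_Cons by (rule subset_trans)
  moreover have "cvars (B, cs2, ds2) \<subseteq> path_vars p"
    using App.IH(2)[OF u App.prems(2)] path_vars_Cons by (rule subset_trans)
  ultimately show ?case unfolding A cvars_def by auto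
qed

definition rigid_env :: "(nat \<times> aty) list \<Rightarrow> (nat \<times> aty) list" where
  "rigid_env L = map (\<lambda>e. (fst e, at_path [] (snd e))) L"

lemma map_of_rigid_env: "map_of (rigid_env L) x = map_option (at_path []) (map_of L x)"
  by (induction L) (auto simp: rigid_env_def)

context sized_type_system begin

lemma leading_vars_annF:
  assumes "g \<in> funs S"
  shows "leading_vars (annF S g) = alpha S g"
proof -
  obtain Bs Ts B where "length Bs = q S g"
    and A: "annF S g = arrs (map2 (\<lambda>B \<alpha>. Srt B (Fin (SVar \<alpha>))) Bs (alpha S g) @ map emb Ts) (Srt B (sigma S g))"
    using fun_type[OF assms] by blast
  then have len: "length Bs = length (alpha S g)" using alpha[OF assms] by simp
  \<comment> \<open>The remaining argument types are embedded simple types, whose sorts carry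
    \<open>\<infinity>\<close>, so reading stops exactly after
    \<open>\<alpha>\<^sup>g\<close>.\<close>
  have nil: "leading_vars (arrs (map emb Ts) (Srt B (sigma S g))) = []"
  proof (cases Ts)
    case (Cons T Ts')
    then show ?thesis by (cases T) (simp_all add: arrs_def)
  qed (simp add: arrs_def)
  have "leading_vars (arrs (map2 (\<lambda>B \<alpha>. Srt B (Fin (SVar \<alpha>))) Bs as @ map emb Ts) (Srt B (sigma S g))) = as"
    if "length Bs = length as" for as
    using that by (induction Bs as rule: list_induct2) (use nil in \<open>simp_all add: arrs_def\<close>)
  then show ?thesis using len by (simp add: A)
qed

lemma avars_annF: "g \<in> funs S \<Longrightarrow> avars (annF S g) \<subseteq> set (alpha S g)"
proof -
  assume g: "g \<in> funs S"
  obtain Bs Ts B where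
    A: "annF S g = arrs (map2 (\<lambda>B \<alpha>. Srt B (Fin (SVar \<alpha>))) Bs (alpha S g) @ map emb Ts) (Srt B (sigma S g))"
    using fun_type[OF g] by blast
  have "avars (arrs Us W) = \<Union> (avars ` set Us) \<union> avars W" for Us W
    by (induction Us) (auto simp: arrs_def)
  then show ?thesis
    using sigma[OF g] by (auto simp: A xvars_def dest: set_zip_rightD)
qed

lemma aty_ok_annF: "g \<in> funs S \<Longrightarrow> aty_ok S (annF S g)"
proof -
  assume g: "g \<in> funs S"
  obtain Bs Ts B where s: "simF S g = sarrs (map Sort Bs @ Ts) (Sort B)" and
    A: "annF S g = arrs (map2 (\<lambda>B \<alpha>. Srt B (Fin (SVar \<alpha>))) Bs (alpha S g) @ map emb Ts) (Srt B (sigma S g))"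
    using fun_type[OF g] by blast
  have 1: "aty_ok S (arrs Us W) \<longleftrightarrow> (\<forall>U \<in> set Us. aty_ok S U) \<and> aty_ok S W" for Us W
    by (induction Us) (auto simp: arrs_def)
  have 2: "sty_ok S (sarrs Us W) \<longleftrightarrow> (\<forall>U \<in> set Us. sty_ok S U) \<and> sty_ok S W" for Us W
    by (induction Us) (auto simp: sarrs_def)
  show ?thesis
    using sigma[OF g] fun_type_ok[OF g]
    by (force simp: A s 1 2 ball_Un aty_ok_emb intro: sizes.intros dest: set_zip_leftD)
qed

text \<open>The path being non-empty keeps the generated variables apart from the rigid ones; in
  particular no decrease condition mentions a rigid variable.\<close>

lemma gen_ok:
  "gen S f t L p n = Some (A, cs, ds) \<Longrightarrow> trm_ok S t \<Longrightarrow> p \<noteq> [] \<Longrightarrow>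
    (\<forall>B \<in> ran (map_of L). aty_ok S B) \<Longrightarrow>
    aty_ok S A \<and> (\<forall>(B, B') \<in> set cs. aty_ok S B \<and> aty_ok S B') \<and>
    (\<forall>(g, ys) \<in> set ds. g \<in> funs S \<and> length ys = q S g \<and> (\<forall>y \<in> set ys. \<not> rigid y))"
proof (induction t arbitrary: L p n A cs ds)
  case (Sy h)
  show ?case
  proof (cases h)
    case (V x)
    then show ?thesis using Sy.prems by (auto simp: gen_sym_def split: option.splits intro: ranI)
  next
    case (C c)
    then show ?thesis using Sy.prems constr_type by (auto simp: gen_sym_def aty_ok_at_path)
  next
    case (F g)
    then show ?thesis
      using Sy.prems alpha
      by (auto simp: gen_sym_def aty_ok_at_path aty_ok_annF leading_vars_annF split: if_splits)
  qed
next
  case (Lam U t)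
  then obtain A' where A': "gen S f t (shift U L) (0 # p) 0 = Some (A', cs, ds)" "A = Arr (emb U) A'"
    by (auto simp: gen_lam_def split: if_splits)
  have "\<forall>B \<in> ran (map_of (shift U L)). aty_ok S B"
    using Lam.prems(2,4) by (simp add: ran_shift aty_ok_emb)
  from Lam.IH[OF A'(1) _ _ this] show ?case
    using Lam.prems(2) by (simp add: A'(2) aty_ok_emb)
next
  case (App t u)
  then obtain U W cs1 ds1 B cs2 ds2
    where t: "gen S f t L (1 # p) (Suc n) = Some (Arr U W, cs1, ds1)"
      and u: "gen S f u L (2 # p) 0 = Some (B, cs2, ds2)"
      and A: "A = W" "cs = (B, U) # cs1 @ cs2" "ds = ds1 @ ds2"
    by (auto simp: gen_app_def split: option.splits aty.splits)
  from App.IH(1)[OF t _ _ App.prems(4)] App.IH(2)[OF u _ _ App.prems(4)] show ?case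
    using App.prems(2) unfolding A by auto
qed

lemma gen_sound:
  assumes "admissible S \<Psi>"
  shows "gen S f t L p n = Some (A, cs, ds) \<Longrightarrow> trm_ok S t \<Longrightarrow>
    (\<And>x. map_of L x = map_option (at_path []) (\<Gamma> x)) \<Longrightarrow> solves S \<Psi> cs \<Longrightarrow> decr S f \<phi> \<Psi> ds \<Longrightarrow>
    pty S f \<phi> \<Gamma> n t (asub \<Psi> A)"
proof (induction t arbitrary: L \<Gamma> p n A cs ds)
  case (Sy h)
  \<comment> \<open>The part of \<open>\<Psi>\<close> that belongs to path \<open>p\<close>, cut
    down to the variables that may be instantiated, since \<open>ssubst_on\<close> demands the
    identity elsewhere.\<close>
  define \<psi> where "\<psi> x = (if x \<in> inst_vars S h then \<Psi> (pvar p x) else Some (SVar x))" for x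
  have \<psi>: "ssubst_on S (inst_vars S h) \<psi>"
    using assms by (auto simp: ssubst_on_def \<psi>_def admissible_def intro: sizes.intros)
  have inst: "asub \<Psi> (at_path p B) = asub \<psi> B" if "avars B \<subseteq> inst_vars S h" for B
    unfolding asub_at_path using that by (intro asub_cong) (auto simp: \<psi>_def)
  show ?case
  proof (cases h)
    case (V x)
    obtain B where B: "map_of L x = Some A" "\<Gamma> x = Some B" "A = at_path [] B"
      using Sy.prems(1) Sy.prems(3)[of x] V by (auto simp: gen_sym_def split: option.splits)
    have "\<psi> = (\<lambda>x. Some (SVar x))" by (simp add: \<psi>_def V fun_eq_iff)
    then have "asub \<Psi> A = asub \<psi> B" using asub_rigid[OF assms] B by simp
    then show ?thesis
      using pty.head[of S \<Gamma> h B f n \<psi> \<phi>] \<psi> B V by (simp add: decreases_def)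
  next
    case (C c)
    then have A: "A = at_path p (annC S c)" "c \<in> constrs S"
      using Sy.prems by (auto simp: gen_sym_def)
    then show ?thesis
      using pty.head[of S \<Gamma> h "annC S c" f n \<psi> \<phi>] \<psi> C inst[of "annC S c"] by (simp add: decreases_def)
  next
    case (F g)
    then have g: "g \<in> funs S" using Sy.prems(2) by simp
    have A: "A = at_path p (annF S g)"
      using Sy.prems(1) F by (auto simp: gen_sym_def split: if_splits)
    have "(sym_less S h f \<or> saturated S f h n) \<and> decreases S h \<psi> f \<phi>"
    proof (cases "fless S g f")
      case True
      then show ?thesis by (simp add: F decreases_def)
    next
      case False
      then have "q S g \<le> n" and ds: "ds = [(g, map (pvar p) (alpha S g))]"
        using Sy.prems(1) F leading_vars_annF[OF g] alpha[OF g]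
        by (auto simp: gen_sym_def split: if_splits)
      moreover have "map \<psi> (alpha S g) = map \<Psi> (map (pvar p) (alpha S g))"
        by (simp add: \<psi>_def F)
      from this[symmetric] have "decreases S h \<psi> f \<phi>"
        using Sy.prems(5) F unfolding decr_def decreases_def ds by (auto simp del: map_map)
      \<comment> \<open>The decrease of \<open>h\<close> cannot come from the precedence here, so it
        comes from \<open>less_A\<close>, which includes the equivalence required for
        saturation.\<close>
      moreover from this False F have "fequiv S g f"
        by (auto simp: decreases_def less_A_def)
      ultimately show ?thesis by (simp add: F saturated_def)
    qed
    then show ?thesis
      using pty.head[of S \<Gamma> h "annF S g" f n \<psi> \<phi>] \<psi> F g inst[of "annF S g"] avars_annF[OF g] A
      by simp
  qed
next
  case (Lam U t)
  then obtain A' where A': "gen S f t (shift U L) (0 # p) 0 = Some (A', cs, ds)" "A = Arr (emb U) A'"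
    and n: "n = 0"
    by (auto simp: gen_lam_def split: if_splits)
  from Lam.IH[OF A'(1) _ env_shift[OF Lam.prems(3)] Lam.prems(4,5)] Lam.prems(2)
  show ?case by (auto simp: A'(2) n intro: pty.lam)
next
  case (App t u)
  then obtain U W cs1 ds1 B cs2 ds2
    where t: "gen S f t L (1 # p) (Suc n) = Some (Arr U W, cs1, ds1)"
      and u: "gen S f u L (2 # p) 0 = Some (B, cs2, ds2)"
      and A: "A = W" "cs = (B, U) # cs1 @ cs2" "ds = ds1 @ ds2"
    by (auto simp: gen_app_def split: option.splits aty.splits)
  have "pty S f \<phi> \<Gamma> (Suc n) t (asub \<Psi> (Arr U W))"
    using App.prems A by (intro App.IH(1)[OF t _ App.prems(3)]) (auto simp: solves_def decr_def)
  moreover have "pty S f \<phi> \<Gamma> 0 u (asub \<Psi> B)"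
    using App.prems A by (intro App.IH(2)[OF u _ App.prems(3)]) (auto simp: solves_def decr_def)
  moreover have "subtype S (asub \<Psi> B) (asub \<Psi> U)"
    using App.prems A by (auto simp: solves_def)
  ultimately show ?case by (auto simp: A intro: pty.app)
qed

lemma gen_complete:
  "pty S f \<phi> \<Gamma> n t R \<Longrightarrow> trm_ok S t \<Longrightarrow> p \<noteq> [] \<Longrightarrow>
    (\<forall>x. map_of L x = map_option (at_path []) (\<Gamma> x)) \<Longrightarrow>
    \<exists>A cs ds \<Psi>. gen S f t L p n = Some (A, cs, ds) \<and> admissible S \<Psi> \<and> solves S \<Psi> cs \<and>
      decr S f \<phi> \<Psi> ds \<and> asub \<Psi> A = R"
proof (induction arbitrary: L p rule: pty.induct)
  case (head \<Gamma> h B n \<psi>)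
  \<comment> \<open>Every non-rigid variable is given the value of \<open>\<psi>\<close> at its
    second component, whatever its path; only variables at the path \<open>p\<close> occur in the
    generated data.\<close>
  define \<Psi> where "\<Psi> y = (if rigid y then Some (SVar (snd (prod_decode y))) else \<psi> (snd (prod_decode y)))" for y
  have \<Psi>_p: "\<Psi> (pvar p x) = \<psi> x" for x
    using head.prems(2) by (simp add: \<Psi>_def) (simp add: pvar_def)
  have adm: "admissible S \<Psi>"
    using head.hyps(3)
    by (auto simp: admissible_def \<Psi>_def ssubst_on_def intro: sizes.intros) (simp add: pvar_def)
  have inst: "asub \<Psi> (at_path p B) = asub \<psi> B"
    by (simp add: asub_at_path \<Psi>_p)
  have nil: "solves S \<Psi> []" "decr S f \<phi> \<Psi> []" by (simp_all add: solves_def decr_def)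
  show ?case
  proof (cases h)
    case (V x)
    have "\<psi> = (\<lambda>x. Some (SVar x))" using head.hyps(3) V by (auto simp: ssubst_on_def)
    then have "asub \<Psi> (at_path [] B) = asub \<psi> B" using asub_rigid[OF adm] by simp
    moreover have "gen S f (Sy h) L p n = Some (at_path [] B, [], [])"
      using head.hyps(1) head.prems(3) V by (simp add: gen_sym_def)
    ultimately show ?thesis using adm nil by (intro exI conjI)
  next
    case (C c)
    then have "gen S f (Sy h) L p n = Some (at_path p B, [], [])"
      using head.hyps(1) by (simp add: gen_sym_def)
    then show ?thesis using adm nil inst by (intro exI conjI)
  next
    case (F g)
    then have g: "g \<in> funs S" "B = annF S g" using head.hyps(1) by simp_all
    show ?thesis
    proof (cases "fless S g f")
      case True
      then have "gen S f (Sy h) L p n = Some (at_path p B, [], [])"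
        using F g by (simp add: gen_sym_def)
      then show ?thesis using adm nil inst by (intro exI conjI)
    next
      case False
      then have "q S g \<le> n" using head.hyps(2) F by (auto simp: saturated_def)
      then have gen: "gen S f (Sy h) L p n = Some (at_path p B, [], [(g, map (pvar p) (alpha S g))])"
        using False F g leading_vars_annF[OF g(1)] alpha[OF g(1)] by (simp add: gen_sym_def)
      have "map \<Psi> (map (pvar p) (alpha S g)) = map \<psi> (alpha S g)" by (simp add: \<Psi>_p)
      then have "decr S f \<phi> \<Psi> [(g, map (pvar p) (alpha S g))]"
        using head.hyps(4) False F unfolding decr_def decreases_def by (auto simp del: map_map)
      with gen adm nil(1) show ?thesis using inst by (intro exI conjI)
    qed
  qed
next
  case (app \<Gamma> n t U W u U')
  obtain A1 cs1 ds1 \<Psi>1 where 1: "gen S f t L (1 # p) (Suc n) = Some (A1, cs1, ds1)"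
    "admissible S \<Psi>1" "solves S \<Psi>1 cs1" "decr S f \<phi> \<Psi>1 ds1" "asub \<Psi>1 A1 = Arr U W"
    using app.IH(1)[of "1 # p" L] app.prems by auto
  obtain A2 cs2 ds2 \<Psi>2 where 2: "gen S f u L (2 # p) 0 = Some (A2, cs2, ds2)"
    "admissible S \<Psi>2" "solves S \<Psi>2 cs2" "decr S f \<phi> \<Psi>2 ds2" "asub \<Psi>2 A2 = U'"
    using app.IH(2)[of "2 # p" L] app.prems by auto
  obtain U0 W0 where A1: "A1 = Arr U0 W0"
    using asub_eq_Arr[OF 1(5)] by blast
  have rig: "\<forall>B \<in> ran (map_of L). avars B \<subseteq> Collect rigid"
    using app.prems(3) by (auto simp: ran_def avars_at_path)
  \<comment> \<open>Gluing: \<open>\<Psi>1\<close> is used below the function position and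
    \<open>\<Psi>2\<close> everywhere else. On rigid variables the two agree by
    admissibility.\<close>
  define \<Psi> where "\<Psi> y = (if \<exists>q x. y = pvar q x \<and> suffix (1 # p) q then \<Psi>1 y else \<Psi>2 y)" for y
  have eq_rigid: "\<Psi>1 y = \<Psi>2 y" if "rigid y" for y
    using 1(2) 2(2) that by (auto simp: rigid_iff admissible_def)
  have "\<Psi> y = \<Psi>1 y" if "y \<in> path_vars (1 # p)" for y
    using that eq_rigid by (auto simp: path_vars_def \<Psi>_def)
  then have eq1: "\<Psi> y = \<Psi>1 y" if "y \<in> cvars (A1, cs1, ds1)" for y
    using gen_vars[OF 1(1) rig] that by blast
  have "\<Psi> y = \<Psi>2 y" if "y \<in> path_vars (2 # p)" for y
    using that eq_rigid by (auto simp: path_vars_def \<Psi>_def suffix_def)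
  then have eq2: "\<Psi> y = \<Psi>2 y" if "y \<in> cvars (A2, cs2, ds2)" for y
    using gen_vars[OF 2(1) rig] that by blast
  have adm: "admissible S \<Psi>"
    using 1(2) 2(2) by (auto simp: admissible_def \<Psi>_def)
  have "solves S \<Psi> cs1"
    unfolding solves_def
  proof clarify
    fix B B' assume "(B, B') \<in> set cs1"
    then have "subtype S (asub \<Psi>1 B) (asub \<Psi>1 B')"
      and "avars B \<union> avars B' \<subseteq> cvars (A1, cs1, ds1)"
      using 1(3) by (auto simp: solves_def cvars_def)
    moreover from this have "asub \<Psi> B = asub \<Psi>1 B" "asub \<Psi> B' = asub \<Psi>1 B'"
      using eq1 by (auto intro!: asub_cong)
    ultimately show "subtype S (asub \<Psi> B) (asub \<Psi> B')" by simp
  qed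
  moreover have "solves S \<Psi> cs2"
    unfolding solves_def
  proof clarify
    fix B B' assume "(B, B') \<in> set cs2"
    then have "subtype S (asub \<Psi>2 B) (asub \<Psi>2 B')"
      and "avars B \<union> avars B' \<subseteq> cvars (A2, cs2, ds2)"
      using 2(3) by (auto simp: solves_def cvars_def)
    moreover from this have "asub \<Psi> B = asub \<Psi>2 B" "asub \<Psi> B' = asub \<Psi>2 B'"
      using eq2 by (auto intro!: asub_cong)
    ultimately show "subtype S (asub \<Psi> B) (asub \<Psi> B')" by simp
  qed
  moreover have W: "asub \<Psi> (Arr U0 W0) = Arr U W"
    unfolding 1(5)[symmetric] A1 by (rule asub_cong) (rule eq1, simp add: cvars_def A1)
  moreover have "asub \<Psi> A2 = U'"
    unfolding 2(5)[symmetric] by (rule asub_cong) (rule eq2, simp add: cvars_def)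
  ultimately have "solves S \<Psi> ((A2, U0) # cs1 @ cs2)"
    using app.hyps(3) by (auto simp: solves_def)
  moreover have "decr S f \<phi> \<Psi> (ds1 @ ds2)"
    unfolding decr_def
  proof clarify
    fix g ys assume d: "(g, ys) \<in> set (ds1 @ ds2)"
    have m1: "map \<Psi> ys = map \<Psi>1 ys" if "(g, ys) \<in> set ds1"
    proof (rule map_cong[OF HOL.refl])
      show "\<Psi> y = \<Psi>1 y" if "y \<in> set ys" for y
        using that \<open>(g, ys) \<in> set ds1\<close> by (intro eq1) (force simp: cvars_def)
    qed
    have m2: "map \<Psi> ys = map \<Psi>2 ys" if "(g, ys) \<in> set ds2"
    proof (rule map_cong[OF HOL.refl])
      show "\<Psi> y = \<Psi>2 y" if "y \<in> set ys" for y
        using that \<open>(g, ys) \<in> set ds2\<close> by (intro eq2) (force simp: cvars_def)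
    qed
    show "\<exists>as bs. map \<Psi> ys = map Fin as \<and> map \<phi> (alpha S f) = map Fin bs \<and> less_A S g f as bs"
    proof (cases "(g, ys) \<in> set ds1")
      case True
      then show ?thesis using 1(4) m1 unfolding decr_def by (auto simp del: map_eq_conv)
    next
      case False
      then show ?thesis using d 2(4) m2 unfolding decr_def by (auto simp del: map_eq_conv)
    qed
  qed
  moreover have "gen S f (App t u) L p n = Some (W0, (A2, U0) # cs1 @ cs2, ds1 @ ds2)"
    using 1(1) 2(1) A1 by (simp add: gen_app_def)
  moreover have "asub \<Psi> W0 = W" using W by simp
  ultimately show ?case using adm by (intro exI conjI)
next
  case (lam U \<Gamma> w W)
  have "\<forall>x. map_of (shift U L) x = map_option (at_path []) (push (emb U) \<Gamma> x)"
    using env_shift lam.prems(3) by blast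
  then obtain A cs ds \<Psi> where *: "gen S f w (shift U L) (0 # p) 0 = Some (A, cs, ds)"
    "admissible S \<Psi>" "solves S \<Psi> cs" "decr S f \<phi> \<Psi> ds" "asub \<Psi> A = W"
    using lam.IH[of "0 # p" "shift U L"] lam.prems by auto
  then show ?case
    by (intro exI[of _ "Arr (emb U) A"] exI[of _ cs] exI[of _ ds] exI[of _ \<Psi>]) (simp add: gen_lam_def)
qed

text \<open>Generation starts at the path \<open>[0]\<close> because the empty path belongs to the
  rigid variables. The extra constraint is the single use of subsumption at the root.\<close>

lemma typing_iff_gen:
  assumes "trm_ok S t"
  shows "typing S f \<phi> (map_of L) t T \<longleftrightarrow> (\<exists>A cs ds \<Psi>. gen S f t (rigid_env L) [0] 0 = Some (A, cs, ds) \<and>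
    admissible S \<Psi> \<and> solves S \<Psi> ((A, at_path [] T) # cs) \<and> decr S f \<phi> \<Psi> ds)"
proof
  assume "typing S f \<phi> (map_of L) t T"
  then obtain R where R: "pty S f \<phi> (map_of L) 0 t R" "subtype S R T"
    unfolding typing_iff_pty by blast
  from gen_complete[OF R(1) assms, of "[0]" "rigid_env L"]
  obtain A cs ds \<Psi> where *: "gen S f t (rigid_env L) [0] 0 = Some (A, cs, ds)" "admissible S \<Psi>"
    "solves S \<Psi> cs" "decr S f \<phi> \<Psi> ds" "asub \<Psi> A = R"
    by (auto simp: map_of_rigid_env)
  have "solves S \<Psi> ((A, at_path [] T) # cs)"
    using *(3,5) R(2) asub_rigid[OF *(2)] by (simp add: solves_def)
  with * show "\<exists>A cs ds \<Psi>. gen S f t (rigid_env L) [0] 0 = Some (A, cs, ds) \<and>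
    admissible S \<Psi> \<and> solves S \<Psi> ((A, at_path [] T) # cs) \<and> decr S f \<phi> \<Psi> ds"
    by blast
next
  assume "\<exists>A cs ds \<Psi>. gen S f t (rigid_env L) [0] 0 = Some (A, cs, ds) \<and>
    admissible S \<Psi> \<and> solves S \<Psi> ((A, at_path [] T) # cs) \<and> decr S f \<phi> \<Psi> ds"
  then obtain A cs ds \<Psi> where *: "gen S f t (rigid_env L) [0] 0 = Some (A, cs, ds)" "admissible S \<Psi>"
    "solves S \<Psi> ((A, at_path [] T) # cs)" "decr S f \<phi> \<Psi> ds"
    by blast
  have "pty S f \<phi> (map_of L) 0 t (asub \<Psi> A)"
    using * by (intro gen_sound[OF *(2,1) assms map_of_rigid_env]) (simp_all add: solves_def)
  moreover have "subtype S (asub \<Psi> A) T"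
    using *(3) asub_rigid[OF *(2)] by (simp add: solves_def)
  ultimately show "typing S f \<phi> (map_of L) t T"
    unfolding typing_iff_pty by blast
qed

end

subsection \<open>The least size and least solutions\<close>

locale sized_mgs = sized_type_system S for S :: "('o::wellorder, 'd) system" +
  fixes f :: nat and \<phi> :: ssubst and K :: "nat set" and mgs :: "problem \<Rightarrow> ssubst"
  assumes f: "f \<in> funs S"
    and monotone: "monotone_algebra S"
    and constants: "generic_constants S f K"
    and mgs: "\<And>P. problem_ok S P \<Longrightarrow> satisfiable S P \<Longrightarrow> most_general_solution S P (mgs P)"
begin

lemma K_infinite: "infinite K"
  and K_size: "c \<in> K \<Longrightarrow> SFun c [] \<in> sizes S"
  and sle_crepl: "\<lbrakk>c \<in> K; e \<in> sizes S; a \<in> sizes S; b \<in> sizes S; sle S a b\<rbrakk>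
    \<Longrightarrow> sle S (crepl c e a) (crepl c e b)"
  and less_A_crepl: "\<lbrakk>c \<in> K; e \<in> sizes S; g \<in> funs S; less_A S g f as bs\<rbrakk>
    \<Longrightarrow> less_A S g f (map (crepl c e) as) (map (crepl c e) bs)"
  using constants sizes.intros(2)[of c S "[]"] by (auto simp: generic_constants_def)

lemma more_general_finite:
  assumes "more_general S \<rho> \<psi>" "\<psi> x = Some d"
  obtains s \<theta> where "\<rho> x = Some s" "\<forall>v. \<theta> v \<in> sizes S" "sle S (ssub \<theta> s) d" "d \<in> sizes S"
proof -
  obtain \<theta> where "ssubst_on S UNIV \<theta>" "\<forall>x. xle S (xsub \<theta> (\<rho> x)) (\<psi> x)"
    using assms(1) unfolding more_general_def by blast
  then have \<theta>: "\<theta> v \<in> xsizes S" "xle S (xsub \<theta> (\<rho> x)) (Some d)" for v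
    using assms(2) by (auto simp: ssubst_on_def dest: spec[of _ x])
  then obtain s where s: "\<rho> x = Some s" by (cases "\<rho> x") (auto simp: xle_def)
  \<comment> \<open>Only variables outside \<open>svars s\<close> can have an infinite value under
    \<open>\<theta>\<close>; they are left as they are, which makes the substitution finite
    throughout.\<close>
  define \<theta>' where "\<theta>' v = (case \<theta> v of None \<Rightarrow> SVar v | Some e \<Rightarrow> e)" for v
  have sz: "\<theta>' v \<in> sizes S" for v
    using \<theta>(1)[of v] by (cases "\<theta> v") (auto simp: \<theta>'_def intro: sizes.intros)
  have fin: "\<not> (\<exists>v \<in> svars s. \<theta> v = None)"
    and le: "sle S (ssub (\<lambda>v. the (\<theta> v)) s) d" "d \<in> sizes S"
    using \<theta>(2) by (auto simp: s xle_def xsub_def split: if_splits)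
  have "ssub \<theta>' s = ssub (\<lambda>v. the (\<theta> v)) s"
    using fin by (intro ssub_cong) (auto simp: \<theta>'_def split: option.splits)
  then show ?thesis using that[of s \<theta>'] s sz le by simp
qed

text \<open>
  The problem \<open>B\<^sub>\<infinity> \<le> B\<^bsub>k(x, y, ...)\<^esub>\<close> is solved by \<open>x = \<infinity>\<close> alone and by \<open>y = \<infinity>\<close> alone, which have no
  common generalisation.
\<close>

lemma arity_le_1:
  assumes k: "k \<in> ssyms S"
  shows "sarity S k \<le> 1"
proof (rule ccontr)
  assume n: "\<not> sarity S k \<le> 1"
  obtain B where B: "B \<in> sorts S" using sorts_nonempty by blast
  obtain c where c: "c \<in> K" using K_infinite by (metis finite.emptyI ex_in_conv)
  define s where "s = SFun k (map SVar [0..<sarity S k])"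
  have s: "s \<in> sizes S" unfolding s_def using k by (auto intro!: sizes.intros)
  have sv: "svars s = {0..<sarity S k}" by (auto simp: s_def)
  define P where "P = Some [(Srt B None, Srt B (Some s))]"
  have P: "problem_ok S P" using B s by (auto simp: P_def problem_ok_def)
  have vars: "problem_vars P = {0..<sarity S k}"
    by (simp add: P_def problem_vars_def xvars_def sv)
  \<comment> \<open>One argument is infinite, all others have the same finite closed value. A single
    infinite argument already makes the whole size infinite.\<close>
  define \<psi> where "\<psi> i x = (if x = i then None else if x < sarity S k then Some (SFun c []) else Some (SVar x))"
    for i x :: nat
  have sol: "solution S P (\<psi> i)" if "i < sarity S k" for i
    unfolding solution_def vars
  proof (intro conjI)
    show "ssubst_on S {0..<sarity S k} (\<psi> i)"
      using that K_size[OF c] by (auto simp: ssubst_on_def \<psi>_def intro: sizes.intros)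
    have "xsub (\<psi> i) (Some s) = None" using that by (auto simp: xsub_def sv \<psi>_def)
    then show "\<exists>cs. P = Some cs \<and> (\<forall>(T, U) \<in> set cs. subtype S (asub (\<psi> i) T) (asub (\<psi> i) U))"
      by (simp add: P_def subtype.refl)
  qed
  have "satisfiable S P" using sol[of 0] n by (auto simp: satisfiable_def)
  note mg = mgs[OF P this]
  then have "subtype S (Srt B None) (Srt B (xsub (mgs P) (Some s)))"
    by (auto simp: most_general_solution_def solution_def P_def)
  then have "xsub (mgs P) (Some s) = None"
    by (auto simp: subtype_Srt xle_def)
  \<comment> \<open>The most general solution has to be infinite somewhere, and no further
    substitution can undo this. So every solution is infinite at the same \<open>j\<close>, whereas
    \<open>\<psi> 0\<close> and \<open>\<psi> 1\<close> are infinite at different places.\<close>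
  then obtain j where j: "mgs P j = None" by (auto simp: xsub_def split: if_splits)
  have "j = i" if "i < sarity S k" for i
  proof -
    have "more_general S (mgs P) (\<psi> i)" using mg sol[OF that] by (simp add: most_general_solution_def)
    then obtain \<theta> where "xle S (xsub \<theta> (mgs P j)) (\<psi> i j)" unfolding more_general_def by blast
    then have "\<psi> i j = None" by (auto simp: j xle_def)
    then show ?thesis by (simp add: \<psi>_def split: if_splits)
  qed
  from this[of 0] this[of 1] n show False by simp
qed

lemma sizes_unary_induct [consumes 1, case_names SVar const unary]:
  assumes "s \<in> sizes S" "\<And>x. Q (SVar x)" "\<And>k. k \<in> ssyms S \<Longrightarrow> sarity S k = 0 \<Longrightarrow> Q (SFun k [])"
    "\<And>k t. \<lbrakk>k \<in> ssyms S; sarity S k = 1; t \<in> sizes S; Q t\<rbrakk> \<Longrightarrow> Q (SFun k [t])"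
  shows "Q s"
  using assms(1)
proof (induction rule: sizes.induct)
  case (2 k ts)
  then consider "sarity S k = 0" "ts = []" | t where "sarity S k = 1" "ts = [t]"
    using arity_le_1[OF 2(1)] by (cases ts) (auto simp: le_Suc_eq)
  then show ?case using 2 assms(3,4) by cases auto
qed (rule assms(2))

text \<open>With arity at most one, a size is a chain of unary symbols ending in a single leaf. If
  this leaf is the constant \<open>c\<close>, the size is closed and contains no other constant;
  otherwise it does not contain \<open>c\<close>.\<close>

lemma sizes_leaf:
  "s \<in> sizes S \<Longrightarrow>
    (\<forall>e. crepl c e s = s) \<or> (svars s = {} \<and> (\<forall>c' e. c' \<noteq> c \<longrightarrow> crepl c' e s = s))"
  by (induction rule: sizes_unary_induct) auto

text \<open>A generic constant behaves like a universally quantified size: replacing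
  \<open>c\<close> by \<open>e\<close> leaves \<open>s\<close> alone and turns the bound
  \<open>c\<close> into \<open>e\<close>.\<close>

lemma least_size_of_generic:
  assumes "c \<in> K" "s \<in> sizes S" "\<And>e. crepl c e s = s" "sle S s (SFun c [])" "e \<in> sizes S"
  shows "sle S s e"
  using sle_crepl[OF assms(1,5,2) K_size[OF assms(1)] assms(4)] assms(3) by simp

text \<open>As \<open>x\<close> does not contain \<open>c\<close>, the inequality between
  \<open>c\<close> and \<open>x\<close> yields the same one for \<open>c'\<close>. Instantiating by
  \<open>\<theta>\<close> puts \<open>c'\<close> below \<open>c\<close>, and genericity of
  \<open>c\<close> then puts \<open>c'\<close> below every size.\<close>

lemma collapse:
  assumes "c \<in> K" "c' \<in> K" "c \<noteq> c'" "x \<in> sizes S" "\<And>e. crepl c e x = x"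
    "sle S (SFun c []) x" "\<And>x. \<theta> x \<in> sizes S" "sle S (ssub \<theta> x) (SFun c [])" "e \<in> sizes S"
  shows "sle S (SFun c' []) e"
proof -
  note c = K_size[OF assms(1)] and c' = K_size[OF assms(2)]
  have "sle S (SFun c' []) x"
    using sle_crepl[OF assms(1) c' c assms(4,6)] assms(5) by simp
  then have "sle S (SFun c' []) (ssub \<theta> x)"
    using sle_stable[of "SFun c' []" x \<theta>] c' assms(4,7) by auto
  then have "sle S (SFun c' []) (SFun c [])"
    using sle_trans[OF c' ssub_sizes[OF assms(4)] c] assms(7,8) by blast
  then show ?thesis
    using least_size_of_generic[OF assms(1) c' _ _ assms(9)] assms(3) by simp
qed

text \<open>
  A least size arises from the problem \<open>a \<le> x, c \<le> x, a \<le> y, c' \<le> y\<close> with \<open>c\<close>, \<open>c'\<close> generic. It has the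
  solutions \<open>(c, c, \<infinity>)\<close> and \<open>(c', \<infinity>, c')\<close> for \<open>(a, x, y)\<close>, and the \<open>a\<close> of a common generalisation
  contains at most one of \<open>c\<close> and \<open>c'\<close>.
\<close>

lemma ex_least_size: "\<exists>b \<in> sizes S. \<forall>e \<in> sizes S. sle S b e"
proof -
  obtain B where B: "B \<in> sorts S" using sorts_nonempty by blast
  obtain c where c: "c \<in> K" using K_infinite by (metis finite.emptyI ex_in_conv)
  obtain c' where c': "c' \<in> K" "c \<noteq> c'"
    using K_infinite by (metis finite.emptyI finite_insert infinite_super insertI1 subsetI)
  note cs = K_size[OF c] and c's = K_size[OF c'(1)]
  let ?a = "Srt B (Some (SVar 0))" and ?x = "Srt B (Some (SVar 1))" and ?y = "Srt B (Some (SVar 2))"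
    and ?c = "Srt B (Some (SFun c []))" and ?c' = "Srt B (Some (SFun c' []))"
  define P where "P = Some [(?a, ?x), (?c, ?x), (?a, ?y), (?c', ?y)]"
  have P: "problem_ok S P" using B cs c's by (auto simp: P_def problem_ok_def intro: sizes.intros)
  have vars: "problem_vars P = {0, 1, 2}"
    by (auto simp: P_def problem_vars_def xvars_def)
  define \<psi> where "\<psi> a x y v = (if v = 0 then a else if v = 1 then x else if v = 2 then y else Some (SVar v))"
    for a x y :: xsize and v :: nat
  have sol_iff: "solution S P \<rho> \<longleftrightarrow> ssubst_on S {0, 1, 2} \<rho> \<and> xle S (\<rho> 0) (\<rho> 1) \<and>
      xle S (Some (SFun c [])) (\<rho> 1) \<and> xle S (\<rho> 0) (\<rho> 2) \<and> xle S (Some (SFun c' [])) (\<rho> 2)" for \<rho>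
  proof -
    have var: "xsub \<rho> (Some (SVar v)) = \<rho> v" and con: "xsub \<rho> (Some (SFun d [])) = Some (SFun d [])" for v d
      by (auto simp: xsub_def)
    have "subtype S (Srt B a) (Srt B b) \<longleftrightarrow> xle S a b" if "a \<in> xsizes S" for a b
      unfolding subtype_Srt using xle_refl[OF that] by blast
    then have "subtype S (Srt B (\<rho> 0)) (Srt B b) \<longleftrightarrow> xle S (\<rho> 0) b"
      "subtype S ?c (Srt B b) \<longleftrightarrow> xle S (Some (SFun c [])) b"
      "subtype S ?c' (Srt B b) \<longleftrightarrow> xle S (Some (SFun c' [])) b" if "ssubst_on S {0, 1, 2} \<rho>" for b
      using that cs c's by (auto simp: ssubst_on_def)
    then show ?thesis
      unfolding solution_def vars by (auto simp: P_def var con)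
  qed
  have sol1: "solution S P (\<psi> (Some (SFun c [])) (Some (SFun c [])) None)"
    and sol2: "solution S P (\<psi> (Some (SFun c' [])) None (Some (SFun c' [])))"
    unfolding sol_iff using cs c's
    by (auto simp: \<psi>_def ssubst_on_def xle_def intro: sizes.intros sle_refl)
  have "satisfiable S P" using sol1 by (auto simp: satisfiable_def)
  note mg = mgs[OF P this]
  then have sol: "solution S P (mgs P)" by (simp add: most_general_solution_def)
  have gen: "\<exists>s \<in> sizes S. mgs P v = Some s \<and> (\<exists>\<theta>. (\<forall>x. \<theta> x \<in> sizes S) \<and> sle S (ssub \<theta> s) d)"
    if "solution S P \<rho>" "\<rho> v = Some d" for \<rho> v d
  proof -
    have "more_general S (mgs P) \<rho>" using mg that by (simp add: most_general_solution_def)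
    from this that(2) obtain s \<theta> where "mgs P v = Some s" "\<forall>v. \<theta> v \<in> sizes S" "sle S (ssub \<theta> s) d"
      by (rule more_general_finite)
    moreover have "mgs P v \<in> xsizes S" using sol by (auto simp: solution_def ssubst_on_def)
    ultimately show ?thesis by auto
  qed
  obtain x \<theta> where x: "x \<in> sizes S" "mgs P 1 = Some x" "\<And>v. \<theta> v \<in> sizes S" "sle S (ssub \<theta> x) (SFun c [])"
    using gen[OF sol1, of 1 "SFun c []"] by (auto simp: \<psi>_def)
  obtain y \<theta>' where y: "y \<in> sizes S" "mgs P 2 = Some y" "\<And>v. \<theta>' v \<in> sizes S" "sle S (ssub \<theta>' y) (SFun c' [])"
    using gen[OF sol2, of 2 "SFun c' []"] by (auto simp: \<psi>_def)
  obtain a where a: "a \<in> sizes S" "mgs P 0 = Some a"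
    using gen[OF sol1, of 0 "SFun c []"] by (auto simp: \<psi>_def)
  have le: "sle S a x" "sle S (SFun c []) x" "sle S a y" "sle S (SFun c' []) y"
    using sol unfolding sol_iff x(2) y(2) a(2) by (auto simp: xle_def)
  show ?thesis
  \<comment> \<open>If \<open>x\<close> avoids \<open>c\<close>, or \<open>y\<close> avoids
    \<open>c'\<close>, then \<open>collapse\<close> makes a generic constant least. Otherwise
    \<open>x\<close> and \<open>y\<close> end in these constants and are closed, so
    \<open>\<theta>\<close> and \<open>\<theta>'\<close> do nothing and \<open>a\<close> lies below
    both \<open>c\<close> and \<open>c'\<close>. Having a single leaf, \<open>a\<close> avoids one
    of them and is least itself.\<close>
  proof (cases "(\<forall>e. crepl c e x = x) \<or> (\<forall>e. crepl c' e y = y)")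
    case True
    then show ?thesis
      using collapse[OF c c'(1,2) x(1) _ le(2) x(3,4)]
        collapse[OF c'(1) c c'(2)[symmetric] y(1) _ le(4) y(3,4)] cs c's by blast
  next
    case False
    then have "svars x = {}" "svars y = {}"
      using sizes_leaf[OF x(1), of c] sizes_leaf[OF y(1), of c'] by auto
    then have "ssub \<theta> x = x" "ssub \<theta>' y = y"
      using ssub_cong[of x \<theta> SVar] ssub_cong[of y \<theta>' SVar] by auto
    then have "sle S a (SFun c [])" "sle S a (SFun c' [])"
      using sle_trans[OF a(1) x(1) cs le(1)] sle_trans[OF a(1) y(1) c's le(3)] x(4) y(4) by auto
    moreover have "(\<forall>e. crepl c e a = a) \<or> (\<forall>e. crepl c' e a = a)"
      using sizes_leaf[OF a(1), of c] c'(2) by auto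
    ultimately show ?thesis
      using least_size_of_generic[OF c a(1)] least_size_of_generic[OF c'(1) a(1)] a(1) by blast
  qed
qed

text \<open>Fixed by choice: the decision procedure contains it as a constant and does not have to
  search for it.\<close>

definition bot_size :: sterm where
  "bot_size = (SOME b. b \<in> sizes S \<and> (\<forall>e \<in> sizes S. sle S b e))"

lemma bot_size: "bot_size \<in> sizes S" "e \<in> sizes S \<Longrightarrow> sle S bot_size e"
  using someI_ex[of "\<lambda>b. b \<in> sizes S \<and> (\<forall>e \<in> sizes S. sle S b e)"] ex_least_size
  unfolding bot_size_def by auto

lemma sle_ssub_bot:
  assumes "s \<in> sizes S" "\<And>x. \<theta> x \<in> sizes S"
  shows "sle S (ssub (\<lambda>_. bot_size) s) (ssub \<theta> s)"
  using assms(1)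
proof (induction rule: sizes_unary_induct)
  case (unary k t)
  have "ssub (\<lambda>_. bot_size) t \<in> sizes S" "ssub \<theta> t \<in> sizes S"
    using unary(3) bot_size(1) assms(2) by (auto intro: ssub_sizes)
  then show ?case
    using monotone unary by (auto simp: monotone_algebra_def)
next
  case (const k)
  then show ?case using sle_refl[OF sizes.intros(2)[of k S "[]"]] by simp
qed (simp add: bot_size assms)

text \<open>Variables outside the problem are left alone by \<open>mgs P\<close> and so become
  \<open>bot_size\<close> as well. This matters for decrease conditions, which may mention variables
  that no constraint mentions.\<close>

definition least_solution :: "problem \<Rightarrow> ssubst" where
  "least_solution P x = map_option (ssub (\<lambda>_. bot_size)) (mgs P x)"

lemma least_solution:
  assumes "problem_ok S P" "satisfiable S P"
  shows "least_solution P x \<in> xsizes S"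
    and "P = Some cs \<Longrightarrow> solves S (least_solution P) cs"
    and "x \<notin> problem_vars P \<Longrightarrow> least_solution P x = Some bot_size"
    and "solution S P \<psi> \<Longrightarrow> xle S (least_solution P x) (\<psi> x)"
proof -
  note mg = mgs[OF assms]
  then have sol: "solution S P (mgs P)" by (simp add: most_general_solution_def)
  then have sz: "mgs P x \<in> xsizes S" for x by (auto simp: solution_def ssubst_on_def)
  show *: "least_solution P x \<in> xsizes S" for x
    using sz[of x] bot_size(1) by (cases "mgs P x") (auto simp: least_solution_def intro: ssub_sizes)
  have "asub (least_solution P) A = amap (ssub (\<lambda>_. bot_size)) (asub (mgs P) A)" for A
    unfolding asub_finite[symmetric] asub_asub least_solution_def by simp
  then show "solves S (least_solution P) cs" if "P = Some cs"
    using sol that bot_size(1) unfolding solves_def solution_def by (auto intro!: subtype_ssub)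
  show "least_solution P x = Some bot_size" if "x \<notin> problem_vars P"
    using sol that by (auto simp: solution_def ssubst_on_def least_solution_def)
  show "xle S (least_solution P x) (\<psi> x)" if "solution S P \<psi>"
  proof (cases "\<psi> x")
    case None
    then show ?thesis using * by (simp add: xle_def)
  next
    case (Some d)
    have "more_general S (mgs P) \<psi>" using mg that by (simp add: most_general_solution_def)
    from this Some obtain s \<theta> where s: "mgs P x = Some s" and \<theta>: "\<forall>v. \<theta> v \<in> sizes S"
      and le: "sle S (ssub \<theta> s) d" "d \<in> sizes S"
      by (rule more_general_finite)
    have ssz: "s \<in> sizes S" using sz[of x] by (simp add: s)
    have "ssub (\<lambda>_. bot_size) s \<in> sizes S" "ssub \<theta> s \<in> sizes S"
      using ssz \<theta> bot_size(1) by (auto intro: ssub_sizes)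
    \<comment> \<open>The value of \<open>\<psi>\<close> at \<open>x\<close> is above some instance
      of \<open>s\<close>, and the instance by \<open>bot_size\<close> is the smallest of all
      instances by monotonicity.\<close>
    then have "sle S (ssub (\<lambda>_. bot_size) s) d"
      using sle_trans le sle_ssub_bot[of s \<theta>] ssz \<theta> by blast
    then show ?thesis
      using le(2) *[of x] by (simp add: xle_def Some least_solution_def s)
  qed
qed

end

subsection \<open>Freezing rigid size variables\<close>

text \<open>The constants are replaced one after the other because genericity speaks of the
  replacement of a single constant. Each \<open>c i\<close> with \<open>i < n\<close> becomes the
  variable \<open>i\<close>.\<close>

definition unfreeze :: "(nat \<Rightarrow> nat) \<Rightarrow> nat \<Rightarrow> sterm \<Rightarrow> sterm" where
  "unfreeze c n a = rec_nat a (\<lambda>i. crepl (c i) (SVar i)) n"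

text \<open>The rigid variable \<open>pvar [] x\<close> is frozen as \<open>c x\<close>, under its
  original name \<open>x\<close>. Unfreezing thus returns the variable \<open>x\<close> itself, the
  value that \<open>admissible\<close> prescribes.\<close>

definition freeze :: "(nat \<Rightarrow> nat) \<Rightarrow> nat \<Rightarrow> sterm" where
  "freeze c y = (if rigid y then SFun (c (snd (prod_decode y))) [] else SVar y)"

definition frozen :: "(nat \<Rightarrow> nat) \<Rightarrow> (aty \<times> aty) list \<Rightarrow> (aty \<times> aty) list" where
  "frozen c cs = map (\<lambda>e. (amap (ssub (freeze c)) (fst e), amap (ssub (freeze c)) (snd e))) cs"

section \<open>Codes as bounds for freshness\<close>

lemma gnum_member: "x \<in> set xs \<Longrightarrow> gnum x \<le> gnum xs"
proof (induction xs)
  case (Cons y xs)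
  have "gnum y \<le> gnum (y # xs)" "gnum xs \<le> gnum (y # xs)"
    by (simp_all add: gnum_Cons le_prod_encode_1 le_prod_encode_2 le_SucI)
  then show ?case using Cons by fastforce
qed simp

lemma gnum_SFun_bounds:
  shows "k \<le> gnum (SFun k ts)" and "t \<in> set ts \<Longrightarrow> gnum t \<le> gnum (SFun k ts)"
proof -
  have *: "gnum (k, ts) \<le> gnum (SFun k ts)" by (simp only: gnum_SFun le_prod_encode_2)
  have "k \<le> gnum (k, ts)" "gnum ts \<le> gnum (k, ts)"
    by (simp_all add: gnum_Pair gnum_nat_def le_prod_encode_1 le_prod_encode_2)
  with * show "k \<le> gnum (SFun k ts)" and "t \<in> set ts \<Longrightarrow> gnum t \<le> gnum (SFun k ts)"
    using gnum_member[of t ts] by linarith+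
qed

lemma svars_le_gnum: "x \<in> svars s \<Longrightarrow> x \<le> gnum s"
proof (induction s)
  case (SFun k ts)
  then obtain t where "t \<in> set ts" "x \<in> svars t" by auto
  then show ?case using SFun.IH[of t] gnum_SFun_bounds(2)[of t ts k] by simp
qed (simp add: le_prod_encode_2)

lemma gnum_Srt_Some: "gnum s \<le> gnum (Srt B (Some s))"
  by (simp add: gnum_Some) (meson le_SucI le_prod_encode_2 le_trans Suc_leD)

lemma gnum_Arr: "gnum U \<le> gnum (Arr U W)" "gnum W \<le> gnum (Arr U W)"
  by simp_all (meson le_prod_encode_1 le_prod_encode_2 le_trans)+

lemma avars_le_gnum: "x \<in> avars A \<Longrightarrow> x \<le> gnum A"
proof (induction A)
  case (Srt B a)
  then obtain s where "a = Some s" "x \<in> svars s" by (auto simp: xvars_def split: option.splits)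
  then show ?case using svars_le_gnum[of x s] gnum_Srt_Some[of s B] by (metis le_trans)
next
  case (Arr U W)
  then show ?case using gnum_Arr(1)[of U W] gnum_Arr(2)[of W U] by (auto simp del: gnum_aty.simps intro: le_trans)
qed

text \<open>The code of a size dominates the number of every symbol in it, so a constant whose
  number exceeds the code does not occur. Freshness becomes a numerical bound.\<close>

lemma crepl_fresh: "gnum s < c \<Longrightarrow> crepl c e s = s"
proof (induction s)
  case (SFun k ts)
  then have "k < c" "\<And>t. t \<in> set ts \<Longrightarrow> gnum t < c"
    using gnum_SFun_bounds by (metis le_less_trans)+
  then show ?case using SFun.IH by (auto intro: map_idI)
qed simp

lemma unfreeze_0 [simp]: "unfreeze c 0 s = s"
  by (simp add: unfreeze_def)

lemma unfreeze_Suc [simp]: "unfreeze c (Suc n) s = crepl (c n) (SVar n) (unfreeze c n s)"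
  by (simp add: unfreeze_def)

lemma unfreeze_SVar [simp]: "unfreeze c n (SVar x) = SVar x"
  by (induction n) auto

lemma unfreeze_SFun:
  "ts \<noteq> [] \<or> (\<forall>i<n. c i \<noteq> k) \<Longrightarrow> unfreeze c n (SFun k ts) = SFun k (map (unfreeze c n) ts)"
proof (induction n)
  case 0
  have "unfreeze c 0 = (\<lambda>s. s)" by (simp add: fun_eq_iff)
  then show ?case by simp
qed auto

lemma unfreeze_const: "inj c \<Longrightarrow> x < n \<Longrightarrow> unfreeze c n (SFun (c x) []) = SVar x"
proof (induction n)
  case (Suc n)
  show ?case
  proof (cases "x = n")
    case True
    have "\<forall>i<n. c i \<noteq> c n" using Suc.prems(1) by (auto dest: injD)
    then show ?thesis using True by (simp add: unfreeze_SFun)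
  qed (use Suc in auto)
qed simp

lemma unfreeze_fresh: "(\<And>i. gnum s < c i) \<Longrightarrow> unfreeze c n s = s"
  by (induction n) (auto simp: crepl_fresh)

lemma unfreeze_ssub:
  "(\<And>i. gnum s < c i) \<Longrightarrow> unfreeze c n (ssub \<theta> s) = ssub (\<lambda>x. unfreeze c n (\<theta> x)) s"
proof (induction s)
  case (SFun k ts)
  have "gnum t < c i" if "t \<in> set ts" for t i
    using SFun.prems[of i] gnum_SFun_bounds(2)[OF that, of k] by linarith
  moreover have "c i \<noteq> k" for i
    using SFun.prems[of i] gnum_SFun_bounds(1)[of k ts] by linarith
  ultimately show ?case using SFun.IH by (simp add: unfreeze_SFun)
qed simp

text \<open>The right-hand side is not \<open>s\<close>, because \<open>s\<close> may itself contain
  constants \<open>c x\<close>, and these are turned into variables too.\<close>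

lemma unfreeze_frozen_vars:
  "inj c \<Longrightarrow> unfreeze c n (ssub (\<lambda>x. if x < n then SFun (c x) [] else SVar x) s) = unfreeze c n s"
proof (induction s)
  case (SFun k ts)
  then show ?case by (cases "ts = []") (simp_all add: unfreeze_SFun)
qed (simp add: unfreeze_const)

text \<open>The constants lie beyond the code of \<open>A\<close>, so they can enter only through
  the substitution; unfreezing the instance is unfreezing the substituted sizes.\<close>

lemma asub_unfreeze:
  assumes "\<And>i. gnum A < c i" "\<And>y. y \<in> avars A \<Longrightarrow> \<Psi> y = map_option (unfreeze c n) (M y)"
  shows "asub \<Psi> A = amap (unfreeze c n) (asub M A)"
  using assms
proof (induction A)
  case (Srt B a)
  show ?case
  proof (cases a)
    case (Some s)
    have g: "\<And>i. gnum s < c i" using Srt.prems(1) gnum_Srt_Some[of s B] unfolding Some by (metis le_less_trans)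
    have \<Psi>: "\<Psi> y = map_option (unfreeze c n) (M y)" if "y \<in> svars s" for y
      using Srt.prems(2) that by (simp add: Some xvars_def)
    have "ssub (\<lambda>x. the (\<Psi> x)) s = unfreeze c n (ssub (\<lambda>x. the (M x)) s)" if "\<forall>x \<in> svars s. M x \<noteq> None"
      unfolding unfreeze_ssub[OF g] using that \<Psi> by (intro ssub_cong) auto
    then show ?thesis using \<Psi> by (auto simp: Some xsub_def)
  qed simp
next
  case (Arr U W)
  have "gnum U < c i" "gnum W < c i" for i
    using Arr.prems(1)[of i] gnum_Arr(1)[of U W] gnum_Arr(2)[of W U] by linarith+
  then show ?case using Arr by simp
qed

context sized_mgs begin

context
  fixes c :: "nat \<Rightarrow> nat"
  assumes c: "inj c" "\<And>i. c i \<in> K"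
begin

lemma unfreeze_sizes: "s \<in> sizes S \<Longrightarrow> unfreeze c n s \<in> sizes S"
  by (induction n) (auto intro: crepl_sizes sizes.intros)

lemma sle_unfreeze:
  "a \<in> sizes S \<Longrightarrow> b \<in> sizes S \<Longrightarrow> sle S a b \<Longrightarrow> sle S (unfreeze c n a) (unfreeze c n b)"
  by (induction n) (auto intro!: sle_crepl c(2) unfreeze_sizes sizes.intros)

lemma less_A_unfreeze:
  assumes "g \<in> funs S" "less_A S g f as bs"
  shows "less_A S g f (map (unfreeze c n) as) (map (unfreeze c n) bs)"
proof (induction n)
  case (Suc n)
  have "less_A S g f (map (crepl (c n) (SVar n)) (map (unfreeze c n) as)) (map (crepl (c n) (SVar n)) (map (unfreeze c n) bs))"
    using less_A_crepl[OF c(2) sizes.intros(1) assms(1) Suc] .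
  then show ?case by (simp add: comp_def)
qed (use assms in \<open>simp add: unfreeze_def\<close>)

lemma problem_ok_frozen:
  assumes "\<forall>(A, B) \<in> set cs. aty_ok S A \<and> aty_ok S B"
  shows "problem_ok S (Some (frozen c cs))"
proof -
  have "Some (freeze c y) \<in> xsizes S" for y
    using K_size[OF c(2)] by (auto simp: freeze_def intro: sizes.intros)
  then show ?thesis
    using assms
    by (auto simp: problem_ok_def frozen_def asub_finite[symmetric] case_prod_beta intro!: aty_ok_asub)
qed

text \<open>A solution \<open>\<Psi>\<close> freezes to a solution of \<open>P\<close>, which the
  least solution bounds from below. Unfreezing preserves this comparison and the decrease of
  \<open>\<Psi>\<close>, so the unfrozen least solution decreases too. Conversely, the unfrozen
  least solution, reset on rigid variables, is a solution as it stands.\<close>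

lemma gen_solvable_iff:
  fixes cs ds
  defines "P \<equiv> Some (frozen c cs)"
  defines "N \<equiv> Suc (gnum cs + gnum (map (\<lambda>x. the (\<phi> x)) (alpha S f)))"
  assumes cs: "\<forall>(A, B) \<in> set cs. aty_ok S A \<and> aty_ok S B"
    and ds: "\<forall>(g, ys) \<in> set ds. g \<in> funs S \<and> length ys = q S g \<and> (\<forall>y \<in> set ys. \<not> rigid y)"
    and big: "\<And>i. N < c i"
  shows "(\<exists>\<Psi>. admissible S \<Psi> \<and> solves S \<Psi> cs \<and> decr S f \<phi> \<Psi> ds) \<longleftrightarrow>
    satisfiable S P \<and> decr S f \<phi> (\<lambda>y. map_option (unfreeze c N) (least_solution P y)) ds"
proof
  have P: "problem_ok S P" unfolding P_def by (rule problem_ok_frozen[OF cs])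
  have cs_gnum: "gnum A < N" "gnum B < N" if "(A, B) \<in> set cs" for A B
    using gnum_member[OF that] le_prod_encode_1[of "gnum A" "gnum B"] le_prod_encode_2[of "gnum B" "gnum A"]
    by (auto simp: N_def gnum_Pair)
  have vars: "y < N" if "(A, B) \<in> set cs" "y \<in> avars A \<union> avars B" for y A B
    using avars_le_gnum[of y A] avars_le_gnum[of y B] cs_gnum[OF that(1)] that(2) by fastforce
  have rigid_lt: "x < N" if "pvar [] x < N" for x
    using that le_prod_encode_2[of x "gnum ([] :: nat list)"] by (simp add: pvar_def)
  \<comment> \<open>\<open>N\<close> also exceeds the code of the vector of \<open>f\<close>, so
    unfreezing does not change the right-hand side of a decrease condition. The default of
    \<open>the\<close> is harmless: only finite vectors are considered.\<close>
  have bs_fresh: "map (unfreeze c N) bs = bs" if "map \<phi> (alpha S f) = map Fin bs" for bs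
  proof (rule map_idI)
    have "map (\<lambda>x. the (\<phi> x)) (alpha S f) = bs"
      using arg_cong[OF that, of "map the"] by (simp add: comp_def)
    then show "unfreeze c N b = b" if "b \<in> set bs" for b
    proof (intro unfreeze_fresh)
      show "gnum b < c i" for i
        using gnum_member[OF that] big[of i] \<open>_ = bs\<close> unfolding N_def by simp
    qed
  qed
  {
    assume "\<exists>\<Psi>. admissible S \<Psi> \<and> solves S \<Psi> cs \<and> decr S f \<phi> \<Psi> ds"
    then obtain \<Psi> where \<Psi>: "admissible S \<Psi>" "solves S \<Psi> cs" "decr S f \<phi> \<Psi> ds" by blast
    \<comment> \<open>Sizes chosen by \<open>\<Psi>\<close> have to be frozen like the constraints.
      All rigid variables \<open>pvar [] x\<close> of the constraints have \<open>x < N\<close>;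
      other variables in the values of \<open>\<Psi>\<close> may stay.\<close>
    define \<kappa> where "\<kappa> x = (if x < N then SFun (c x) [] else SVar x)" for x
    have \<kappa>: "\<kappa> x \<in> sizes S" for x
      using K_size[OF c(2)] by (auto simp: \<kappa>_def intro: sizes.intros)
    define \<psi> where "\<psi> y = (if y \<in> problem_vars P then map_option (ssub \<kappa>) (\<Psi> y) else Some (SVar y))" for y
    have \<Psi>sz: "\<Psi> y \<in> xsizes S" for y using \<Psi>(1) by (simp add: admissible_def)
    have \<psi>sz: "map_option (ssub \<kappa>) (\<Psi> y) \<in> xsizes S" for y
      using \<Psi>sz[of y] \<kappa> by (cases "\<Psi> y") (auto intro: ssub_sizes)
    have inst: "asub \<psi> (amap (ssub (freeze c)) A) = amap (ssub \<kappa>) (asub \<Psi> A)"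
      if "avars A \<subseteq> {..<N}" "avars (amap (ssub (freeze c)) A) \<subseteq> problem_vars P" for A
      unfolding asub_finite[symmetric] asub_asub
    proof (rule asub_cong)
      fix y assume y: "y \<in> avars A"
      show "xsub \<psi> (Some (freeze c y)) = xsub (\<lambda>x. Some (\<kappa> x)) (\<Psi> y)"
      proof (cases "rigid y")
        case True
        then obtain x where x: "y = pvar [] x" by (auto simp: rigid_iff)
        then have "x < N" using that(1) y rigid_lt by auto
        moreover have "\<Psi> y = Some (SVar x)" using \<Psi>(1) x by (simp add: admissible_def)
        ultimately show ?thesis
          by (simp add: x freeze_def \<kappa>_def xsub_def) (simp add: pvar_def)
      next
        case False
        then have "y \<in> avars (amap (ssub (freeze c)) A)"
          unfolding avars_finite_sub using y by (auto simp: freeze_def)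
        then have "y \<in> problem_vars P" using that(2) by blast
        then have "xsub \<psi> (Some (SVar y)) = map_option (ssub \<kappa>) (\<Psi> y)"
          by (auto simp: xsub_def \<psi>_def)
        then show ?thesis using False by (simp add: freeze_def)
      qed
    qed
    have "solution S P \<psi>"
      unfolding solution_def
    proof (intro conjI exI[of _ "frozen c cs"])
      show "ssubst_on S (problem_vars P) \<psi>"
        using \<psi>sz by (auto simp: ssubst_on_def \<psi>_def intro: sizes.intros)
      show "P = Some (frozen c cs)" by (simp add: P_def)
      show "\<forall>(T, U) \<in> set (frozen c cs). subtype S (asub \<psi> T) (asub \<psi> U)"
      proof clarify
        fix T U assume fr: "(T, U) \<in> set (frozen c cs)"
        then obtain A B where AB: "(A, B) \<in> set cs" "T = amap (ssub (freeze c)) A" "U = amap (ssub (freeze c)) B"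
          by (auto simp: frozen_def)
        have TU: "avars T \<subseteq> problem_vars P" "avars U \<subseteq> problem_vars P"
          using UN_upper[OF fr, of "\<lambda>(T, U). avars T \<union> avars U"] by (simp_all add: problem_vars_def P_def)
        have "avars A \<subseteq> {..<N}" "avars B \<subseteq> {..<N}" using vars[OF AB(1)] by auto
        then have "asub \<psi> T = amap (ssub \<kappa>) (asub \<Psi> A)" "asub \<psi> U = amap (ssub \<kappa>) (asub \<Psi> B)"
          using inst[of A] inst[of B] TU unfolding AB(2,3) by simp_all
        moreover have "subtype S (asub \<Psi> A) (asub \<Psi> B)" using \<Psi>(2) AB(1) by (auto simp: solves_def)
        ultimately show "subtype S (asub \<psi> T) (asub \<psi> U)" using subtype_ssub \<kappa> by simp
      qed
    qed
    then have sat: "satisfiable S P" by (auto simp: satisfiable_def)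
    \<comment> \<open>Outside the problem the bound holds because the least solution is
      \<open>bot_size\<close> there.\<close>
    have le: "xle S (least_solution P y) (map_option (ssub \<kappa>) (\<Psi> y))" for y
    proof (cases "y \<in> problem_vars P")
      case True
      then show ?thesis using least_solution(4)[OF P sat \<open>solution S P \<psi>\<close>, of y] by (simp add: \<psi>_def)
    next
      case False
      then show ?thesis
        using least_solution(3)[OF P sat, of y] bot_size \<psi>sz[of y]
        by (cases "\<Psi> y") (auto simp: xle_def)
    qed
    have "decr S f \<phi> (\<lambda>y. map_option (unfreeze c N) (least_solution P y)) ds"
      unfolding decr_def
    proof clarify
      fix g ys assume d: "(g, ys) \<in> set ds"
      then obtain as bs where ab: "map \<Psi> ys = map Fin as" "map \<phi> (alpha S f) = map Fin bs" "less_A S g f as bs"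
        using \<Psi>(3) unfolding decr_def by blast
      have g: "g \<in> funs S" "length ys = q S g" using ds d by auto
      define ms where "ms = map (\<lambda>y. the (least_solution P y)) ys"
      have len: "length as = length ys" "length ms = length ys"
        using arg_cong[OF ab(1), of length] by (simp_all add: ms_def)
      have nth: "least_solution P (ys ! i) = Some (ms ! i) \<and> ms ! i \<in> sizes S \<and> as ! i \<in> sizes S \<and>
          sle S (ms ! i) (ssub \<kappa> (as ! i))" if "i < length ys" for i
      proof -
        have \<Psi>i: "\<Psi> (ys ! i) = Some (as ! i)"
          using arg_cong[OF ab(1), of "\<lambda>l. l ! i"] that len by simp
        then obtain m where "least_solution P (ys ! i) = Some m" "m \<in> sizes S" "sle S m (ssub \<kappa> (as ! i))"
          using le[of "ys ! i"] by (auto simp: xle_def)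
        moreover have "as ! i \<in> sizes S" using \<Psi>sz[of "ys ! i"] \<Psi>i by simp
        ultimately show ?thesis using that by (simp add: ms_def)
      qed
      have "less_A S g f (map (unfreeze c N) as) bs"
        using less_A_unfreeze[OF g(1) ab(3), of N] bs_fresh[OF ab(2)] by simp
      moreover have "list_all2 (\<lambda>a b. xle S (Fin a) (Fin b)) (map (unfreeze c N) ms) (map (unfreeze c N) as)"
      proof (intro list_all2_all_nthI)
        fix i assume "i < length (map (unfreeze c N) ms)"
        then have i: "i < length ys" by (simp add: len)
        have "sle S (unfreeze c N (ms ! i)) (unfreeze c N (ssub \<kappa> (as ! i)))"
          using nth[OF i] \<kappa> by (intro sle_unfreeze) (auto intro: ssub_sizes)
        \<comment> \<open>The freezing by \<open>\<kappa>\<close> is absorbed by the subsequent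
          unfreezing, which leaves the sizes of \<open>\<Psi>\<close> unfrozen.\<close>
        then have "sle S (unfreeze c N (ms ! i)) (unfreeze c N (as ! i))"
          unfolding \<kappa>_def unfreeze_frozen_vars[OF c(1)] .
        then show "xle S (Fin (map (unfreeze c N) ms ! i)) (Fin (map (unfreeze c N) as ! i))"
          using i len nth[OF i] by (simp add: xle_def unfreeze_sizes)
      qed (simp add: len)
      moreover have "map (unfreeze c N) ms \<in> vecs S g" "map (unfreeze c N) as \<in> vecs S g"
        using nth len g(2) by (auto simp: vecs_def in_set_conv_nth intro!: unfreeze_sizes)
      ultimately have "less_A S g f (map (unfreeze c N) ms) bs"
        using less_A_compat[OF g(1) f, of "map (unfreeze c N) ms" "map (unfreeze c N) as" bs] by simp
      moreover have "map (\<lambda>y. map_option (unfreeze c N) (least_solution P y)) ys = map Fin (map (unfreeze c N) ms)"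
        using nth len by (intro nth_equalityI) auto
      ultimately show "\<exists>as bs. map (\<lambda>y. map_option (unfreeze c N) (least_solution P y)) ys = map Fin as \<and>
          map \<phi> (alpha S f) = map Fin bs \<and> less_A S g f as bs"
        using ab(2) by blast
    qed
    with sat show "satisfiable S P \<and> decr S f \<phi> (\<lambda>y. map_option (unfreeze c N) (least_solution P y)) ds" ..
  }
  assume R: "satisfiable S P \<and> decr S f \<phi> (\<lambda>y. map_option (unfreeze c N) (least_solution P y)) ds"
  then have sat: "satisfiable S P" by blast
  define M where "M = least_solution P"
  \<comment> \<open>Rigid variables no longer occur in \<open>P\<close>, where the least solution
    makes them \<open>bot_size\<close>; they are reset to the variables they stand for.\<close>
  define \<Psi> where "\<Psi> y = (if rigid y then Some (SVar (snd (prod_decode y))) else map_option (unfreeze c N) (M y))" for y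
  have Msz: "M y \<in> xsizes S" for y unfolding M_def by (rule least_solution(1)[OF P sat])
  have "\<Psi> y \<in> xsizes S" for y
    using Msz[of y] by (cases "M y") (auto simp: \<Psi>_def intro: unfreeze_sizes sizes.intros)
  then have "admissible S \<Psi>"
    by (auto simp: admissible_def \<Psi>_def) (simp add: pvar_def)
  moreover have "solves S \<Psi> cs"
    unfolding solves_def
  proof clarify
    fix A B assume AB: "(A, B) \<in> set cs"
    have eq: "asub \<Psi> A' = amap (unfreeze c N) (asub M (amap (ssub (freeze c)) A'))"
      if "gnum A' < N" "avars A' \<subseteq> {..<N}" for A'
      unfolding asub_finite[symmetric] asub_asub
    proof (rule asub_unfreeze)
      show "gnum A' < c i" for i using big[of i] that(1) by simp
      fix y assume "y \<in> avars A'"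
      then have y: "y < N" using that(2) by auto
      show "\<Psi> y = map_option (unfreeze c N) (xsub M (Some (freeze c y)))"
      proof (cases "rigid y")
        case True
        then obtain x where x: "y = pvar [] x" by (auto simp: rigid_iff)
        then have "x < N" using y rigid_lt by auto
        then have "unfreeze c N (SFun (c x) []) = SVar x" using unfreeze_const[OF c(1)] by simp
        moreover have "snd (prod_decode y) = x" by (simp add: x pvar_def)
        ultimately show ?thesis using True by (simp add: freeze_def \<Psi>_def xsub_def)
      next
        case False
        then show ?thesis by (auto simp: freeze_def \<Psi>_def xsub_def)
      qed
    qed
    have "(amap (ssub (freeze c)) A, amap (ssub (freeze c)) B) \<in> set (frozen c cs)"
      using AB by (force simp: frozen_def)
    then have "subtype S (asub M (amap (ssub (freeze c)) A)) (asub M (amap (ssub (freeze c)) B))"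
      using least_solution(2)[OF P sat P_def[THEN meta_eq_to_obj_eq]] by (auto simp: solves_def M_def)
    from subtype_amap[OF this, of "unfreeze c N"]
    have "subtype S (amap (unfreeze c N) (asub M (amap (ssub (freeze c)) A)))
        (amap (unfreeze c N) (asub M (amap (ssub (freeze c)) B)))"
      by (simp add: unfreeze_sizes sle_unfreeze)
    moreover have "asub \<Psi> A = amap (unfreeze c N) (asub M (amap (ssub (freeze c)) A))"
      "asub \<Psi> B = amap (unfreeze c N) (asub M (amap (ssub (freeze c)) B))"
      using eq[of A] eq[of B] cs_gnum[OF AB] vars[OF AB] by auto
    ultimately show "subtype S (asub \<Psi> A) (asub \<Psi> B)" by simp
  qed
  moreover have "decr S f \<phi> \<Psi> ds"
    unfolding decr_def
  proof clarify
    fix g ys assume d: "(g, ys) \<in> set ds"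
    then have "map \<Psi> ys = map (\<lambda>y. map_option (unfreeze c N) (least_solution P y)) ys"
      using ds by (auto simp: \<Psi>_def M_def)
    then show "\<exists>as bs. map \<Psi> ys = map Fin as \<and> map \<phi> (alpha S f) = map Fin bs \<and> less_A S g f as bs"
      using R d unfolding decr_def by (auto simp del: map_eq_conv)
  qed
  ultimately show "\<exists>\<Psi>. admissible S \<Psi> \<and> solves S \<Psi> cs \<and> decr S f \<phi> \<Psi> ds" by blast
qed

end
end

subsection \<open>Computability on sizes, types and terms\<close>

text \<open>The data types are coded as a constructor tag paired with the code of the arguments, so
  the second projection gives access to the arguments \<open>p\<close>. The case rules below are
  instances for each constructor.\<close>

lemma computable_on_tagged:
  fixes s :: "'a::goedel \<Rightarrow> 'b::goedel" and h :: "'a \<Rightarrow> 'p::goedel \<Rightarrow> 'c::goedel"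
  assumes "computable_on X s" "computable_on Y (\<lambda>z. h (fst z) (snd z))"
    "\<And>x. x \<in> X \<Longrightarrow> \<exists>p. gnum (s x) = prod_encode (i, gnum p) \<and> (x, p) \<in> Y \<and> k x = h x p"
  shows "computable_on X k"
proof -
  obtain p where p: "\<And>x. x \<in> X \<Longrightarrow> gnum (s x) = prod_encode (i, gnum (p x)) \<and> (x, p x) \<in> Y \<and> k x = h x (p x)"
    using assms(3) by metis
  have "computable_on X p"
    by (rule computable_on_code[OF assms(1) computable_snd]) (simp add: p)
  from computable_on_comp2[OF assms(2) computable_on_id this] have "computable_on X (\<lambda>x. h x (p x))"
    using p by auto
  then show ?thesis by (rule computable_on_cong) (simp add: p)
qed

lemma computable_on_tag: "computable_on X s \<Longrightarrow> computable_on X (\<lambda>x. fst (prod_decode (gnum (s x))) = i)"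
  by (intro computable_on_eq computable_on_computable[OF computable_fst] computable_on_gnum computable_on_const)

lemma computable_on_case_sterm:
  assumes "computable_on X s"
    "computable_on {(x, v). x \<in> X \<and> s x = SVar v} (\<lambda>z. f (fst z) (snd z))"
    "computable_on {(x, k, ts). x \<in> X \<and> s x = SFun k ts} (\<lambda>z. g (fst z) (fst (snd z)) (snd (snd z)))"
  shows "computable_on X (\<lambda>x. case s x of SVar v \<Rightarrow> f x v | SFun k ts \<Rightarrow> g x k ts)"
proof (rule computable_on_split[OF computable_on_tag[OF assms(1), of 0]])
  let ?k = "\<lambda>x. case s x of SVar v \<Rightarrow> f x v | SFun k ts \<Rightarrow> g x k ts"
  have tag: "fst (prod_decode (gnum (s x))) = 0 \<longleftrightarrow> (\<exists>v. s x = SVar v)"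
    "fst (prod_decode (gnum (s x))) \<noteq> 0 \<longleftrightarrow> (\<exists>k ts. s x = SFun k ts)" for x
    by (cases "s x"; simp)+
  show "computable_on {x \<in> X. fst (prod_decode (gnum (s x))) = 0} ?k"
    unfolding tag
    by (rule computable_on_tagged[where i = 0 and h = "f", OF computable_on_subset[OF assms(1)] assms(2)])
      (auto simp: gnum_Pair gnum_nat_def gnum_list_def)
  show "computable_on {x \<in> X. fst (prod_decode (gnum (s x))) \<noteq> 0} ?k"
    unfolding tag(2)
    by (rule computable_on_tagged[where i = 1 and h = "\<lambda>x p. g x (fst p) (snd p)", OF computable_on_subset[OF assms(1)] assms(3)])
      (auto simp: gnum_Pair gnum_nat_def gnum_list_def)
qed

lemma computable_on_case_sty:
  assumes "computable_on X s"
    "computable_on {(x, v). x \<in> X \<and> s x = Sort v} (\<lambda>z. f (fst z) (snd z))"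
    "computable_on {(x, U, W). x \<in> X \<and> s x = SArr U W} (\<lambda>z. g (fst z) (fst (snd z)) (snd (snd z)))"
  shows "computable_on X (\<lambda>x. case s x of Sort v \<Rightarrow> f x v | SArr U W \<Rightarrow> g x U W)"
proof (rule computable_on_split[OF computable_on_tag[OF assms(1), of 0]])
  let ?k = "\<lambda>x. case s x of Sort v \<Rightarrow> f x v | SArr U W \<Rightarrow> g x U W"
  have tag: "fst (prod_decode (gnum (s x))) = 0 \<longleftrightarrow> (\<exists>v. s x = Sort v)"
    "fst (prod_decode (gnum (s x))) \<noteq> 0 \<longleftrightarrow> (\<exists>U W. s x = SArr U W)" for x
    by (cases "s x"; simp)+
  show "computable_on {x \<in> X. fst (prod_decode (gnum (s x))) = 0} ?k"
    unfolding tag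
    by (rule computable_on_tagged[where i = 0 and h = "f", OF computable_on_subset[OF assms(1)] assms(2)])
      (auto simp: gnum_Pair gnum_nat_def gnum_list_def)
  show "computable_on {x \<in> X. fst (prod_decode (gnum (s x))) \<noteq> 0} ?k"
    unfolding tag(2)
    by (rule computable_on_tagged[where i = 1 and h = "\<lambda>x p. g x (fst p) (snd p)", OF computable_on_subset[OF assms(1)] assms(3)])
      (auto simp: gnum_Pair gnum_nat_def gnum_list_def)
qed

lemma computable_on_case_aty:
  assumes "computable_on X s"
    "computable_on {(x, B, a). x \<in> X \<and> s x = Srt B a} (\<lambda>z. f (fst z) (fst (snd z)) (snd (snd z)))"
    "computable_on {(x, U, W). x \<in> X \<and> s x = Arr U W} (\<lambda>z. g (fst z) (fst (snd z)) (snd (snd z)))"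
  shows "computable_on X (\<lambda>x. case s x of Srt B a \<Rightarrow> f x B a | Arr U W \<Rightarrow> g x U W)"
proof (rule computable_on_split[OF computable_on_tag[OF assms(1), of 0]])
  let ?k = "\<lambda>x. case s x of Srt B a \<Rightarrow> f x B a | Arr U W \<Rightarrow> g x U W"
  have tag: "fst (prod_decode (gnum (s x))) = 0 \<longleftrightarrow> (\<exists>B a. s x = Srt B a)"
    "fst (prod_decode (gnum (s x))) \<noteq> 0 \<longleftrightarrow> (\<exists>U W. s x = Arr U W)" for x
    by (cases "s x"; simp)+
  show "computable_on {x \<in> X. fst (prod_decode (gnum (s x))) = 0} ?k"
    unfolding tag
    by (rule computable_on_tagged[where i = 0 and h = "\<lambda>x p. f x (fst p) (snd p)", OF computable_on_subset[OF assms(1)] assms(2)])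
      (auto simp: gnum_Pair gnum_nat_def gnum_list_def)
  show "computable_on {x \<in> X. fst (prod_decode (gnum (s x))) \<noteq> 0} ?k"
    unfolding tag(2)
    by (rule computable_on_tagged[where i = 1 and h = "\<lambda>x p. g x (fst p) (snd p)", OF computable_on_subset[OF assms(1)] assms(3)])
      (auto simp: gnum_Pair gnum_nat_def gnum_list_def)
qed

lemma computable_on_case_sym:
  assumes "computable_on X s"
    "computable_on {(x, n). x \<in> X \<and> s x = V n} (\<lambda>z. f (fst z) (snd z))"
    "computable_on {(x, n). x \<in> X \<and> s x = C n} (\<lambda>z. g (fst z) (snd z))"
    "computable_on {(x, n). x \<in> X \<and> s x = F n} (\<lambda>z. h (fst z) (snd z))"
  shows "computable_on X (\<lambda>x. case s x of V n \<Rightarrow> f x n | C n \<Rightarrow> g x n | F n \<Rightarrow> h x n)"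
proof (rule computable_on_split[OF computable_on_tag[OF assms(1), of 0]])
  let ?k = "\<lambda>x. case s x of V n \<Rightarrow> f x n | C n \<Rightarrow> g x n | F n \<Rightarrow> h x n"
  have tag: "fst (prod_decode (gnum (s x))) = 0 \<longleftrightarrow> (\<exists>n. s x = V n)"
    "fst (prod_decode (gnum (s x))) = 1 \<longleftrightarrow> (\<exists>n. s x = C n)"
    "fst (prod_decode (gnum (s x))) \<noteq> 0 \<and> fst (prod_decode (gnum (s x))) \<noteq> 1 \<longleftrightarrow> (\<exists>n. s x = F n)" for x
    by (cases "s x"; simp)+
  show "computable_on {x \<in> X. fst (prod_decode (gnum (s x))) = 0} ?k"
    unfolding tag
    by (rule computable_on_tagged[where i = 0 and h = "f", OF computable_on_subset[OF assms(1)] assms(2)])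
      (auto simp: gnum_Pair gnum_nat_def)
  show "computable_on {x \<in> X. fst (prod_decode (gnum (s x))) \<noteq> 0} ?k"
  proof (rule computable_on_split[OF computable_on_tag[OF computable_on_subset[OF assms(1)], of _ 1]])
    show "computable_on {x \<in> {x \<in> X. fst (prod_decode (gnum (s x))) \<noteq> 0}. fst (prod_decode (gnum (s x))) = 1} ?k"
      unfolding tag
      by (rule computable_on_tagged[where i = 1 and h = "g", OF computable_on_subset[OF assms(1)] assms(3)])
        (auto simp: gnum_Pair gnum_nat_def)
    have "{x \<in> {x \<in> X. fst (prod_decode (gnum (s x))) \<noteq> 0}. fst (prod_decode (gnum (s x))) \<noteq> 1} = {x \<in> X. \<exists>n. s x = F n}"
      unfolding tag(3)[symmetric] by auto
    then show "computable_on {x \<in> {x \<in> X. fst (prod_decode (gnum (s x))) \<noteq> 0}. fst (prod_decode (gnum (s x))) \<noteq> 1} ?k"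
      by (simp only:, intro computable_on_tagged[where i = 2 and h = "h", OF computable_on_subset[OF assms(1)] assms(4)])
        (auto simp: gnum_Pair gnum_nat_def)
  qed auto
qed

lemma computable_on_case_trm:
  assumes "computable_on X s"
    "computable_on {(x, y). x \<in> X \<and> s x = Sy y} (\<lambda>z. f (fst z) (snd z))"
    "computable_on {(x, U, t). x \<in> X \<and> s x = Lam U t} (\<lambda>z. g (fst z) (fst (snd z)) (snd (snd z)))"
    "computable_on {(x, t, u). x \<in> X \<and> s x = App t u} (\<lambda>z. h (fst z) (fst (snd z)) (snd (snd z)))"
  shows "computable_on X (\<lambda>x. case s x of Sy y \<Rightarrow> f x y | Lam U t \<Rightarrow> g x U t | App t u \<Rightarrow> h x t u)"
proof (rule computable_on_split[OF computable_on_tag[OF assms(1), of 0]])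
  let ?k = "\<lambda>x. case s x of Sy y \<Rightarrow> f x y | Lam U t \<Rightarrow> g x U t | App t u \<Rightarrow> h x t u"
  have tag: "fst (prod_decode (gnum (s x))) = 0 \<longleftrightarrow> (\<exists>y. s x = Sy y)"
    "fst (prod_decode (gnum (s x))) = 1 \<longleftrightarrow> (\<exists>U t. s x = Lam U t)"
    "fst (prod_decode (gnum (s x))) \<noteq> 0 \<and> fst (prod_decode (gnum (s x))) \<noteq> 1 \<longleftrightarrow> (\<exists>t u. s x = App t u)" for x
    by (cases "s x"; simp)+
  show "computable_on {x \<in> X. fst (prod_decode (gnum (s x))) = 0} ?k"
    unfolding tag
    by (rule computable_on_tagged[where i = 0 and h = "f", OF computable_on_subset[OF assms(1)] assms(2)])
      (auto simp: gnum_Pair gnum_nat_def)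
  show "computable_on {x \<in> X. fst (prod_decode (gnum (s x))) \<noteq> 0} ?k"
  proof (rule computable_on_split[OF computable_on_tag[OF computable_on_subset[OF assms(1)], of _ 1]])
    show "computable_on {x \<in> {x \<in> X. fst (prod_decode (gnum (s x))) \<noteq> 0}. fst (prod_decode (gnum (s x))) = 1} ?k"
      unfolding tag
      by (rule computable_on_tagged[where i = 1 and h = "\<lambda>x p. g x (fst p) (snd p)", OF computable_on_subset[OF assms(1)] assms(3)])
        (auto simp: gnum_Pair gnum_nat_def)
    have "{x \<in> {x \<in> X. fst (prod_decode (gnum (s x))) \<noteq> 0}. fst (prod_decode (gnum (s x))) \<noteq> 1} = {x \<in> X. \<exists>t u. s x = App t u}"
      unfolding tag(3)[symmetric] by auto
    then show "computable_on {x \<in> {x \<in> X. fst (prod_decode (gnum (s x))) \<noteq> 0}. fst (prod_decode (gnum (s x))) \<noteq> 1} ?k"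
      by (simp only:, intro computable_on_tagged[where i = 2 and h = "\<lambda>x p. h x (fst p) (snd p)", OF computable_on_subset[OF assms(1)] assms(4)])
        (auto simp: gnum_Pair gnum_nat_def)
  qed auto
qed

lemma computable_on_SVar: "computable_on X f \<Longrightarrow> computable_on X (\<lambda>x. SVar (f x))"
  by (erule computable_on_code[OF _ computable_pair[OF computable_const[of 0] computable_id]]) (simp add: gnum_nat_def)

lemma computable_on_SFun:
  assumes "computable_on X f" "computable_on X g"
  shows "computable_on X (\<lambda>x. SFun (f x) (g x))"
  by (rule computable_on_code[OF computable_on_Pair[OF assms] computable_pair[OF computable_const[of 1] computable_id]])
    (simp only: gnum_SFun)

lemma computable_on_Srt:
  assumes "computable_on X f" "computable_on X g"
  shows "computable_on X (\<lambda>x. Srt (f x) (g x))"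
  by (rule computable_on_code[OF computable_on_Pair[OF assms] computable_pair[OF computable_const[of 0] computable_id]])
    (simp add: gnum_Pair gnum_nat_def)

lemma computable_on_Arr:
  assumes "computable_on X f" "computable_on X g"
  shows "computable_on X (\<lambda>x. Arr (f x) (g x))"
  by (rule computable_on_code[OF computable_on_Pair[OF assms] computable_pair[OF computable_const[of 1] computable_id]])
    (simp add: gnum_Pair)

section \<open>Structural recursion on coded data\<close>

lemma less_prod_encode_Suc: "x < prod_encode (Suc i, x)"
  by (simp add: prod_encode_def)

text \<open>Supplies the measures for \<open>computable_on_recursion\<close>. Strictness comes from
  the tags: constructors with recursive arguments have a positive tag, and a pair with positive
  first component exceeds its second component.\<close>

lemma gnum_less:
  "t \<in> set ts \<Longrightarrow> gnum t < gnum (SFun k ts)"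
  "gnum U < gnum (SArr U W)" "gnum W < gnum (SArr U W)"
  "gnum A < gnum (Arr A B)" "gnum B < gnum (Arr A B)"
  "gnum r < gnum (Lam U r)" "gnum r < gnum (App r s)" "gnum s < gnum (App r s)"
proof -
  show "gnum t < gnum (SFun k ts)" if "t \<in> set ts"
    unfolding gnum_SFun gnum_Pair
    using gnum_member[OF that] le_prod_encode_2[of "gnum ts" "gnum k"] less_prod_encode_Suc[of _ 0]
    by (metis One_nat_def le_less_trans le_trans)
qed (auto simp: numeral_2_eq_2 intro: le_less_trans[OF le_prod_encode_1 less_prod_encode_Suc]
      le_less_trans[OF le_prod_encode_2 less_prod_encode_Suc] le_less_trans[OF le_prod_encode_1 less_prod_encode_Suc[of _ 0, unfolded One_nat_def[symmetric]]]
      le_less_trans[OF le_prod_encode_2 less_prod_encode_Suc[of _ 0, unfolded One_nat_def[symmetric]]])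

text \<open>A common form of substitution and of constant replacement, which act on variables and on
  constants respectively; one recursion serves both.\<close>

primrec leaf_map :: "(nat \<Rightarrow> sterm) \<Rightarrow> (nat \<Rightarrow> sterm) \<Rightarrow> sterm \<Rightarrow> sterm" where
  "leaf_map u v (SVar x) = u x"
| "leaf_map u v (SFun k ts) = (if ts = [] then v k else SFun k (map (leaf_map u v) ts))"

lemma ssub_leaf_map: "ssub \<theta> s = leaf_map \<theta> (\<lambda>k. SFun k []) s"
  by (induction s) auto

lemma crepl_leaf_map: "crepl c e s = leaf_map SVar (\<lambda>k. if k = c then e else SFun k []) s"
  by (induction s) auto

lemma computable_on_leaf_map:
  assumes s: "computable_on X s"
    and u: "computable_on (X \<times> UNIV) (\<lambda>z. u (fst z) (snd z))"
    and v: "computable_on (X \<times> UNIV) (\<lambda>z. v (fst z) (snd z))"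
  shows "computable_on X (\<lambda>x. leaf_map (u x) (v x) (s x))"
proof -
  \<comment> \<open>\<open>D\<close> lists the recursive calls, with the parameter \<open>x\<close>
    carried along, and \<open>G\<close> combines their values.\<close>
  define D where "D a = (case snd a of SVar y \<Rightarrow> [] | SFun k ts \<Rightarrow> map (\<lambda>t. (fst a, t)) ts)"
    for a :: "'a \<times> sterm"
  define G where "G a rs = (case snd a of SVar y \<Rightarrow> u (fst a) y
      | SFun k ts \<Rightarrow> if ts = [] then v (fst a) k else SFun k rs)" for a :: "'a \<times> sterm" and rs
  define H where "H a = leaf_map (u (fst a)) (v (fst a)) (snd a)" for a
  have "computable_on (X \<times> UNIV) H"
  proof (rule computable_on_recursion)
    show "computable_on (X \<times> UNIV) D"
      unfolding D_def
      by (intro computable_on_case_sterm computable_on_map computable_on_Pair computable_on_fst computable_on_snd computable_on_id computable_on_const)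
    show "computable_on (X \<times> UNIV) (\<lambda>a. gnum (snd a))"
      by (intro computable_on_gnum computable_on_snd computable_on_id)
    show "d \<in> X \<times> UNIV \<and> gnum (snd d) < gnum (snd a)" if "a \<in> X \<times> UNIV" "d \<in> set (D a)" for a d
      using that by (auto simp: D_def gnum_less simp del: gnum_sterm.simps split: sterm.splits)
    show "computable_on ((\<lambda>a. (a, map H (D a))) ` (X \<times> UNIV)) (\<lambda>z. G (fst z) (snd z))"
      unfolding G_def
      by (intro computable_on_case_sterm computable_on_if computable_on_eq computable_on_SFun computable_on_comp2[OF u] computable_on_comp2[OF v]
          computable_on_fst computable_on_snd computable_on_id computable_on_const) auto
    show "H a = G a (map H (D a))" if "a \<in> X \<times> UNIV" for a
      by (cases "snd a") (simp_all add: H_def G_def D_def comp_def)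
  qed
  from computable_on_comp2[where h = "\<lambda>x t. leaf_map (u x) (v x) t", OF this[unfolded H_def] computable_on_id s]
  show ?thesis by simp
qed

lemma computable_on_ssub:
  assumes "computable_on X s" "computable_on (X \<times> UNIV) (\<lambda>z. \<theta> (fst z) (snd z))"
  shows "computable_on X (\<lambda>x. ssub (\<theta> x) (s x))"
  unfolding ssub_leaf_map by (intro computable_on_leaf_map assms computable_on_SFun computable_on_snd computable_on_id computable_on_const)

lemma computable_on_crepl:
  assumes "computable_on X c" "computable_on X e" "computable_on X s"
  shows "computable_on X (\<lambda>x. crepl (c x) (e x) (s x))"
proof -
  have "computable_on (X \<times> UNIV) (\<lambda>z. c (fst z))"
    by (rule computable_on_comp[OF assms(1)]) (intro computable_on_fst computable_on_id | auto)+
  moreover have "computable_on {z \<in> X \<times> UNIV. snd z = c (fst z)} (\<lambda>z. e (fst z))"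
    by (rule computable_on_comp[OF assms(2)]) (intro computable_on_fst computable_on_id | auto)+
  ultimately show ?thesis
    unfolding crepl_leaf_map
    by (intro computable_on_leaf_map assms computable_on_if computable_on_eq computable_on_SVar computable_on_SFun computable_on_snd computable_on_id computable_on_const)
qed

lemma computable_on_amap:
  assumes A: "computable_on X A" and h: "computable_on (X \<times> UNIV) (\<lambda>z. h (fst z) (snd z))"
  shows "computable_on X (\<lambda>x. amap (h x) (A x))"
proof -
  define D where "D a = (case snd a of Srt B b \<Rightarrow> [] | Arr U W \<Rightarrow> [(fst a, U), (fst a, W)])"
    for a :: "'a \<times> aty"
  define G where "G a rs = (case snd a of Srt B b \<Rightarrow> Srt B (map_option (h (fst a)) b)
      | Arr U W \<Rightarrow> Arr (hd rs) (hd (tl rs)))" for a :: "'a \<times> aty" and rs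
  define H where "H a = amap (h (fst a)) (snd a)" for a
  have "computable_on (X \<times> UNIV) H"
  proof (rule computable_on_recursion)
    show "computable_on (X \<times> UNIV) D"
      unfolding D_def
      by (intro computable_on_case_aty computable_on_Cons computable_on_Pair computable_on_fst computable_on_snd computable_on_id computable_on_const)
    show "computable_on (X \<times> UNIV) (\<lambda>a. gnum (snd a))"
      by (intro computable_on_gnum computable_on_snd computable_on_id)
    show "d \<in> X \<times> UNIV \<and> gnum (snd d) < gnum (snd a)" if "a \<in> X \<times> UNIV" "d \<in> set (D a)" for a d
      using that by (auto simp: D_def gnum_less simp del: gnum_aty.simps split: aty.splits)
    show "computable_on ((\<lambda>a. (a, map H (D a))) ` (X \<times> UNIV)) (\<lambda>z. G (fst z) (snd z))"
      unfolding G_def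
      by (intro computable_on_case_aty computable_on_Srt computable_on_Arr computable_on_map_option computable_on_hd computable_on_tl computable_on_comp2[OF h]
          computable_on_fst computable_on_snd computable_on_id computable_on_const) (auto simp: D_def)
    show "H a = G a (map H (D a))" if "a \<in> X \<times> UNIV" for a
      by (cases "snd a") (simp_all add: H_def G_def D_def)
  qed
  from computable_on_comp2[where h = "\<lambda>x t. amap (h x) t", OF this[unfolded H_def] computable_on_id A]
  show ?thesis by simp
qed

lemma computable_on_emb: "computable_on X U \<Longrightarrow> computable_on X (\<lambda>x. emb (U x))"
proof -
  define D where "D a = (case a of Sort B \<Rightarrow> [] | SArr U W \<Rightarrow> [U, W])" for a
  define G where "G a rs = (case a of Sort B \<Rightarrow> Srt B None | SArr U W \<Rightarrow> Arr (hd rs) (hd (tl rs)))" for a rs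
  have "computable_on UNIV emb"
  proof (rule computable_on_recursion)
    show "computable_on UNIV D"
      unfolding D_def by (intro computable_on_case_sty computable_on_Cons computable_on_fst computable_on_snd computable_on_id computable_on_const)
    show "computable_on UNIV (gnum :: sty \<Rightarrow> nat)"
      by (intro computable_on_gnum computable_on_id)
    show "d \<in> UNIV \<and> gnum d < gnum a" if "d \<in> set (D a)" for a d
      using that by (auto simp: D_def gnum_less simp del: gnum_sty.simps split: sty.splits)
    show "computable_on ((\<lambda>a. (a, map emb (D a))) ` UNIV) (\<lambda>z. G (fst z) (snd z))"
      unfolding G_def
      by (intro computable_on_case_sty computable_on_Srt computable_on_Arr computable_on_hd computable_on_tl computable_on_fst computable_on_snd computable_on_id computable_on_const)
        (auto simp: D_def)
    show "emb a = G a (map emb (D a))" for a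
      by (cases a) (simp_all add: G_def D_def)
  qed
  then show "computable_on X U \<Longrightarrow> computable_on X (\<lambda>x. emb (U x))"
    by (rule computable_on_comp) auto
qed

text \<open>The nested pattern of \<open>leading_vars\<close>, taken apart one constructor at a time
  to fit the case rules for computability.\<close>

definition leading_var :: "aty \<Rightarrow> nat option" where
  "leading_var A = (case A of Srt B a \<Rightarrow> (case a of None \<Rightarrow> None | Some s \<Rightarrow>
     (case s of SVar x \<Rightarrow> Some x | SFun k ts \<Rightarrow> None)) | Arr U W \<Rightarrow> None)"

lemma computable_on_leading_vars: "computable_on X A \<Longrightarrow> computable_on X (\<lambda>x. leading_vars (A x))"
proof -
  define D where "D a = (case a of Srt B b \<Rightarrow> [] | Arr U W \<Rightarrow> [W])" for a
  define G where "G a rs = (case a of Srt B b \<Rightarrow> [] | Arr U W \<Rightarrow>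
      (case leading_var U of None \<Rightarrow> [] | Some x \<Rightarrow> x # hd rs))" for a rs
  have lead: "computable_on X leading_var" for X
    unfolding leading_var_def
    by (intro computable_on_case_aty computable_on_case_option computable_on_case_sterm computable_on_Some computable_on_fst computable_on_snd computable_on_id computable_on_const)
  have "computable_on UNIV leading_vars"
  proof (rule computable_on_recursion)
    show "computable_on UNIV D"
      unfolding D_def by (intro computable_on_case_aty computable_on_Cons computable_on_fst computable_on_snd computable_on_id computable_on_const)
    show "computable_on UNIV (gnum :: aty \<Rightarrow> nat)"
      by (intro computable_on_gnum computable_on_id)
    show "d \<in> UNIV \<and> gnum d < gnum a" if "d \<in> set (D a)" for a d
      using that by (auto simp: D_def gnum_less simp del: gnum_aty.simps split: aty.splits)
    show "computable_on ((\<lambda>a. (a, map leading_vars (D a))) ` UNIV) (\<lambda>z. G (fst z) (snd z))"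
      unfolding G_def
      by (intro computable_on_case_aty computable_on_case_option computable_on_Cons computable_on_comp[OF lead] computable_on_hd computable_on_fst computable_on_snd computable_on_id computable_on_const)
        (auto simp: D_def)
    show "leading_vars a = G a (map leading_vars (D a))" for a
      by (cases a rule: leading_vars.cases) (simp_all add: G_def D_def leading_var_def)
  qed
  then show "computable_on X A \<Longrightarrow> computable_on X (\<lambda>x. leading_vars (A x))"
    by (rule computable_on_comp) auto
qed

lemma computable_on_pvar: "computable_on X p \<Longrightarrow> computable_on X f \<Longrightarrow> computable_on X (\<lambda>x. pvar (p x) (f x))"
  unfolding pvar_def by (intro computable_on_prod_encode computable_on_gnum)

lemma computable_on_at_path:
  assumes "computable_on X p" "computable_on X A"
  shows "computable_on X (\<lambda>x. at_path (p x) (A x))"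
proof -
  have "computable_on ((X \<times> UNIV) \<times> UNIV) (\<lambda>z. p (fst (fst z)))"
    by (rule computable_on_comp[OF assms(1)]) (intro computable_on_fst computable_on_id | auto)+
  then show ?thesis
    unfolding at_path_def asub_finite
    by (intro computable_on_amap computable_on_ssub assms computable_on_SVar computable_on_pvar computable_on_snd computable_on_id)
qed

lemma computable_on_shift:
  assumes "computable_on X U" "computable_on X L"
  shows "computable_on X (\<lambda>x. shift (U x) (L x))"
  unfolding shift_def
  by (intro computable_on_Cons computable_on_Pair computable_on_const computable_on_emb computable_on_map assms computable_on_Suc computable_on_fst computable_on_snd computable_on_id)

lemma computable_on_rigid_env: "computable_on X L \<Longrightarrow> computable_on X (\<lambda>x. rigid_env (L x))"
  unfolding rigid_env_def
  by (intro computable_on_map computable_on_Pair computable_on_at_path computable_on_const computable_on_fst computable_on_snd computable_on_id)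

lemma computable_on_rigid: "computable_on X f \<Longrightarrow> computable_on X (\<lambda>x. rigid (f x))"
  unfolding rigid_def by (intro computable_on_eq computable_on_computable[OF computable_fst] computable_on_const)

lemma computable_on_gen_lam:
  assumes "computable_on X U" "computable_on X n" "computable_on X r"
  shows "computable_on X (\<lambda>x. gen_lam (U x) (n x) (r x))"
proof -
  let ?Y = "{x \<in> X. n x = 0}"
  have "computable_on ?Y r" by (rule computable_on_subset[OF assms(3)]) auto
  moreover have "computable_on {(x, y). x \<in> ?Y \<and> r x = Some y} (\<lambda>z. U (fst z))"
    by (rule computable_on_comp[OF assms(1)]) (intro computable_on_fst computable_on_id | auto)+
  ultimately show ?thesis
    unfolding gen_lam_def
    by (intro computable_on_if computable_on_eq assms computable_on_const computable_on_map_option computable_on_Pair computable_on_Arr computable_on_emb computable_on_fst computable_on_snd computable_on_id)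
qed

lemma computable_on_gen_app:
  assumes "computable_on X r" "computable_on X r'"
  shows "computable_on X (\<lambda>x. gen_app (r x) (r' x))"
proof -
  have "computable_on {(x, y). x \<in> X \<and> r x = Some y} (\<lambda>z. r' (fst z))"
    by (rule computable_on_comp[OF assms(2)]) (intro computable_on_fst computable_on_id | auto)+
  then show ?thesis
    unfolding gen_app_def
    by (intro computable_on_case_option computable_on_case_aty assms computable_on_const computable_on_Some computable_on_Pair computable_on_Cons computable_on_append
        computable_on_fst computable_on_snd computable_on_id)
qed

context sized_type_system begin

context
  fixes f :: nat
  assumes effective: "effective_declarations S"
    and f: "f \<in> funs S"
    and prec: "computable_on (funs S \<times> funs S) (\<lambda>z. fless S (fst z) (snd z))"
begin

lemma computable_on_gen_sym:
  assumes h: "computable_on X h" "\<And>x. x \<in> X \<Longrightarrow> sym_ok S (h x)"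
    and L: "computable_on X L" and p: "computable_on X p" and n: "computable_on X n"
  shows "computable_on X (\<lambda>x. gen_sym S f (h x) (L x) (p x) (n x))"
proof -
  note sub = computable_on_comp[OF L computable_on_fst[OF computable_on_id]] computable_on_comp[OF p computable_on_fst[OF computable_on_id]] computable_on_comp[OF n computable_on_fst[OF computable_on_id]]
  \<comment> \<open>Declared types are computable on declared symbols only, so each branch is
    treated on the inputs that take it.\<close>
  let ?V = "{(x, y). x \<in> X \<and> h x = V y}" and ?C = "{(x, c). x \<in> X \<and> h x = C c}" and ?F = "{(x, g). x \<in> X \<and> h x = F g}"
  have V: "computable_on ?V (\<lambda>z. L (fst z))" by (rule sub) auto
  have "computable_on ?C (\<lambda>z. annC S (snd z))"
    by (rule computable_on_comp[OF _ computable_on_snd[OF computable_on_id], of "constrs S"])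
      (use effective h(2) in \<open>force simp: effective_declarations_def\<close>)+
  moreover have "computable_on ?C (\<lambda>z. p (fst z))" by (rule sub) auto
  ultimately have C: "computable_on ?C (\<lambda>z. Some (at_path (p (fst z)) (annC S (snd z)), [], []))"
    by (intro computable_on_Some computable_on_Pair computable_on_at_path computable_on_const)
  have g: "snd z \<in> funs S" if "z \<in> ?F" for z using that h(2) by force
  have less: "computable_on ?F (\<lambda>z. fless S (snd z) f)"
    by (rule computable_on_comp2[OF prec computable_on_snd[OF computable_on_id] computable_on_const]) (use g f in auto)
  have ann: "computable_on Y (\<lambda>z. annF S (snd z))" and pF: "computable_on Y (\<lambda>z. p (fst z))"
    and nF: "computable_on Y (\<lambda>z. n (fst z))" if "Y \<subseteq> ?F" for Y
  proof -
    show "computable_on Y (\<lambda>z. annF S (snd z))"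
      by (rule computable_on_comp[OF _ computable_on_snd[OF computable_on_id], of "funs S"])
        (use effective g that in \<open>auto simp: effective_declarations_def\<close>)
    show "computable_on Y (\<lambda>z. p (fst z))" "computable_on Y (\<lambda>z. n (fst z))"
      by (rule sub, use that in auto)+
  qed
  have mp: "computable_on Y (\<lambda>z. map (pvar (p (fst z))) (leading_vars (annF S (snd z))))" if "Y \<subseteq> ?F" for Y
  proof (intro computable_on_map computable_on_leading_vars ann computable_on_pvar computable_on_snd computable_on_id that)
    show "computable_on {(z, y). z \<in> Y \<and> y \<in> set (leading_vars (annF S (snd z)))} (\<lambda>z. p (fst (fst z)))"
      by (rule computable_on_comp[OF p]) (intro computable_on_fst computable_on_id, use that in auto)
  qed
  have F: "computable_on ?F (\<lambda>z.
        if fless S (snd z) f then Some (at_path (p (fst z)) (annF S (snd z)), [], [])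
        else if n (fst z) < length (leading_vars (annF S (snd z))) then None
        else Some (at_path (p (fst z)) (annF S (snd z)), [],
          [(snd z, map (pvar (p (fst z))) (leading_vars (annF S (snd z))))]))"
    by (intro computable_on_if less computable_on_Some computable_on_Pair computable_on_Cons computable_on_at_path computable_on_const computable_on_less computable_on_length
        mp computable_on_leading_vars ann pF nF computable_on_snd computable_on_id) auto
  show ?thesis
    unfolding gen_sym_def
    by (intro computable_on_case_sym h(1) computable_on_case_option computable_on_map_of V C F computable_on_Some computable_on_Pair computable_on_const computable_on_snd computable_on_id)
qed

text \<open>Environment, path and argument count change from call to call, so the recursion ranges
  over whole calls, measured by the code of the term.\<close>

lemma computable_on_gen:
  "computable_on {(L, p, n, t). trm_ok S t}
    (\<lambda>a. gen S f (snd (snd (snd a))) (fst a) (fst (snd a)) (fst (snd (snd a))))"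
proof -
  define D where "D a = (case snd (snd (snd a)) of Sy h \<Rightarrow> []
      | Lam U t \<Rightarrow> [(shift U (fst a), 0 # fst (snd a), 0, t)]
      | App t u \<Rightarrow> [(fst a, 1 # fst (snd a), Suc (fst (snd (snd a))), t), (fst a, 2 # fst (snd a), 0, u)])"
    for a :: "(nat \<times> aty) list \<times> nat list \<times> nat \<times> trm"
  define G where "G a rs = (case snd (snd (snd a)) of
        Sy h \<Rightarrow> gen_sym S f h (fst a) (fst (snd a)) (fst (snd (snd a)))
      | Lam U t \<Rightarrow> gen_lam U (fst (snd (snd a))) (hd rs)
      | App t u \<Rightarrow> gen_app (hd rs) (hd (tl rs)))"
    for a :: "(nat \<times> aty) list \<times> nat list \<times> nat \<times> trm" and rs
  let ?X = "{(L, p, n, t). trm_ok S t} :: ((nat \<times> aty) list \<times> nat list \<times> nat \<times> trm) set"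
  let ?H = "\<lambda>a. gen S f (snd (snd (snd a))) (fst a) (fst (snd a)) (fst (snd (snd a)))"
  show ?thesis
  proof (rule computable_on_recursion)
    show "computable_on ?X D"
      unfolding D_def
      by (intro computable_on_case_trm computable_on_Cons computable_on_Pair computable_on_shift computable_on_Suc computable_on_fst computable_on_snd computable_on_id computable_on_const)
    show "computable_on ?X (\<lambda>a. gnum (snd (snd (snd a))))"
      by (intro computable_on_gnum computable_on_snd computable_on_id)
    show "d \<in> ?X \<and> gnum (snd (snd (snd d))) < gnum (snd (snd (snd a)))" if "a \<in> ?X" "d \<in> set (D a)" for a d
      using that by (auto simp: D_def gnum_less simp del: gnum_trm.simps split: trm.splits)
    let ?Z = "(\<lambda>a. (a, map ?H (D a))) ` ?X"
    show "computable_on ?Z (\<lambda>z. G (fst z) (snd z))"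
      unfolding G_def
      by (intro computable_on_case_trm computable_on_gen_sym computable_on_gen_lam computable_on_gen_app computable_on_hd computable_on_tl
          computable_on_fst computable_on_snd computable_on_id computable_on_const) (auto simp: D_def)
    show "?H a = G a (map ?H (D a))" if "a \<in> ?X" for a
      by (cases "snd (snd (snd a))") (simp_all add: G_def D_def)
  qed
qed

end

end

subsection \<open>Fresh constants\<close>

definition next_above :: "(nat \<Rightarrow> nat) \<Rightarrow> nat \<Rightarrow> nat" where
  "next_above e k = e (LEAST j. k < e j)"

text \<open>An enumeration may repeat itself and need not be monotone. Searching again and again for
  a listed value above the last one yields a strictly increasing sequence beyond \<open>N\<close>,
  hence distinct fresh constants.\<close>

definition fresh_seq :: "(nat \<Rightarrow> nat) \<Rightarrow> nat \<Rightarrow> nat \<Rightarrow> nat" where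
  "fresh_seq e N i = rec_nat (next_above e N) (\<lambda>_. next_above e) i"

lemma
  assumes "infinite (range e)"
  shows next_above_gt: "k < next_above e k"
    and computable_next_above: "computable e \<Longrightarrow> computable (next_above e)"
proof -
  have ex: "\<exists>j. k < e j" for k
    using assms unfolding finite_nat_set_iff_bounded_le by (auto simp: not_le)
  show "k < next_above e k"
    unfolding next_above_def by (rule LeastI_ex[OF ex])
  assume e: "computable e"
  let ?g = "\<lambda>z. Suc (snd (prod_decode z)) - e (fst (prod_decode z))"
  have "computable ?g"
    by (intro computable_minus computable_Suc computable_snd computable_comp[OF e computable_fst])
  moreover have iff: "?g (prod_encode (j, k)) = 0 \<longleftrightarrow> k < e j" for j k by auto
  ultimately have "computable (\<lambda>k. LEAST j. k < e j)"
    using computable_LEAST[of ?g] ex unfolding iff by simp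
  then show "computable (next_above e)"
    unfolding next_above_def by (rule computable_comp[OF e])
qed

lemma fresh_seq:
  assumes "infinite (range e)"
  shows "fresh_seq e N i \<in> range e" "N < fresh_seq e N i" "inj (fresh_seq e N)"
proof -
  show "fresh_seq e N i \<in> range e"
    by (cases i) (simp_all add: fresh_seq_def next_above_def)
  have mono: "fresh_seq e N i < fresh_seq e N (Suc i)" for i
    using next_above_gt[OF assms] by (simp add: fresh_seq_def)
  then show "inj (fresh_seq e N)"
    by (simp add: strict_mono_Suc_iff strict_mono_imp_inj_on)
  show "N < fresh_seq e N i"
  proof (induction i)
    case 0
    show ?case using next_above_gt[OF assms] by (simp add: fresh_seq_def)
  qed (use mono less_trans in blast)
qed

lemma computable_on_fresh_seq:
  assumes "infinite (range e)" "computable e" "computable_on X N" "computable_on X i"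
  shows "computable_on X (\<lambda>x. fresh_seq e (N x) (i x))"
  unfolding fresh_seq_def
proof (rule computable_on_rec_nat[where Z = UNIV])
  show "computable_on UNIV (\<lambda>z. next_above e (snd (snd z)))"
    by (intro computable_on_computable[OF computable_next_above[OF assms(1,2)]] computable_on_snd computable_on_id)
qed (intro computable_on_computable[OF computable_next_above[OF assms(1,2)]] assms(3,4) UNIV_I)+

lemma computable_on_freeze:
  assumes "computable_on X y" "computable_on (X \<times> UNIV) (\<lambda>z. c (fst z) (snd z))"
  shows "computable_on X (\<lambda>x. freeze (c x) (y x))"
proof -
  let ?Y = "{x \<in> X. rigid (y x)}"
  have y: "computable_on Y y" if "Y \<subseteq> X" for Y using computable_on_subset[OF assms(1) that] .
  have "computable_on ?Y (\<lambda>x. c x (snd (prod_decode (y x))))"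
    by (rule computable_on_comp2[OF assms(2) computable_on_id computable_on_computable[OF computable_snd y]]) auto
  then show ?thesis
    unfolding freeze_def
    by (intro computable_on_if computable_on_rigid assms computable_on_SFun computable_on_const computable_on_SVar y) auto
qed

lemma computable_on_unfreeze:
  assumes "computable_on X n" "computable_on X s" "computable_on (X \<times> UNIV) (\<lambda>z. c (fst z) (snd z))"
  shows "computable_on X (\<lambda>x. unfreeze (c x) (n x) (s x))"
  unfolding unfreeze_def
proof (rule computable_on_rec_nat[where Z = "X \<times> UNIV"])
  have "computable_on (X \<times> UNIV) (\<lambda>z. c (fst z) (fst (snd z)))"
    by (rule computable_on_comp2[OF assms(3)]) (intro computable_on_fst computable_on_snd computable_on_id | auto)+
  then show "computable_on (X \<times> UNIV) (\<lambda>z. crepl (c (fst z) (fst (snd z))) (SVar (fst (snd z))) (snd (snd z)))"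
    by (intro computable_on_crepl computable_on_SVar computable_on_fst computable_on_snd computable_on_id)
qed (use assms in auto)

lemma computable_on_frozen:
  assumes "computable_on X cs" "computable_on (X \<times> UNIV) (\<lambda>z. c (fst z) (snd z))"
  shows "computable_on X (\<lambda>x. frozen (c x) (cs x))"
proof -
  let ?Y = "{(x, y). x \<in> X \<and> y \<in> set (cs x)}"
  have "computable_on (((?Y \<times> UNIV) \<times> UNIV) \<times> UNIV) (\<lambda>z. c (fst (fst (fst (fst z)))) (snd z))"
    by (rule computable_on_comp2[OF assms(2)]) (intro computable_on_fst computable_on_snd computable_on_id | auto)+
  then show ?thesis
    unfolding frozen_def
    by (intro computable_on_map assms computable_on_Pair computable_on_amap computable_on_ssub computable_on_freeze computable_on_fst computable_on_snd computable_on_id)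
qed

section \<open>The decision procedure\<close>

theorem mainTheorem9:
  fixes S :: "('o::wellorder, 'd) system"
    and f :: nat and \<phi> :: ssubst and K :: "nat set"
    and mgs :: "problem \<Rightarrow> ssubst"
  assumes system: "sized_type_system S"
    and effective: "effective_declarations S"
    and f: "f \<in> funs S"
    and phi: "ssubst_on S (set (alpha S f)) \<phi>"
    and monotone: "monotone_algebra S"
    and constants: "generic_constants S f K" "recursively_enumerable K"
    and prec_decidable: "decidable_on (funs S \<times> funs S) (\<lambda>(g, h). fless S g h)"
    and less_A_decidable: "decidable_on {(g, as, bs). g \<in> funs S \<and> as \<in> vecs S g \<and> bs \<in> vecs S f}
      (\<lambda>(g, as, bs). less_A S g f as bs)"
    and sat_decidable: "decidable_on {P. problem_ok S P} (satisfiable S)"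
    and mgs: "\<And>P. problem_ok S P \<Longrightarrow> satisfiable S P \<Longrightarrow> most_general_solution S P (mgs P)"
    and mgs_computable: "computable_on {(P, x). problem_ok S P \<and> satisfiable S P} (\<lambda>(P, x). mgs P x)"
  shows "decidable_on {(L, t, T). env_ok S (map_of L) \<and> trm_ok S t \<and> aty_ok S T}
    (\<lambda>(L, t, T). typing S f \<phi> (map_of L) t T)"
proof -
  note K_enum = constants(2)
  interpret sized_type_system S by (rule system)
  interpret sized_mgs S f \<phi> K mgs
    using f monotone constants(1) mgs by unfold_locales
  obtain e where e: "computable e" "K = range e"
    using K_enum K_infinite unfolding recursively_enumerable_def by auto
  have inf: "infinite (range e)" using K_infinite e(2) by simp
  define N where "N cs = Suc (gnum cs + gnum (map (\<lambda>x. the (\<phi> x)) (alpha S f)))"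
    for cs :: "(aty \<times> aty) list"
  define c where "c cs = fresh_seq e (N cs)" for cs
  define P where "P cs = Some (frozen (c cs) cs)" for cs
  define val where "val cs y = map_option (unfreeze (c cs) (N cs)) (least_solution (P cs) y)" for cs y
  define chk where "chk z \<longleftrightarrow> satisfiable S (P (fst z)) \<and> decr S f \<phi> (val (fst z)) (snd z)" for z
  have c: "inj (c cs)" "c cs i \<in> K" "N cs < c cs i" for cs i
    unfolding c_def e(2) using fresh_seq[OF inf] by auto
  define Ok where "Ok = {z. (\<forall>(A, B) \<in> set (fst z). aty_ok S A \<and> aty_ok S B) \<and>
    (\<forall>(g, ys) \<in> set (snd z). g \<in> funs S \<and> length ys = q S g \<and> (\<forall>y \<in> set ys. \<not> rigid y))}"
  have P_ok: "problem_ok S (P (fst z))" if "z \<in> Ok" for z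
    using that unfolding P_def Ok_def by (intro problem_ok_frozen c) auto
  have val_ok: "val (fst z) y \<in> xsizes S" if "z \<in> Ok" "satisfiable S (P (fst z))" for z y
    using least_solution(1)[OF P_ok[OF that(1)] that(2), of y] unfreeze_sizes[OF c(1,2)]
    by (cases "least_solution (P (fst z)) y") (auto simp: val_def)
  \<comment> \<open>Most general solutions are computable for satisfiable problems only, so the
    decrease conditions are evaluated after satisfiability has been decided.\<close>
  define Ok' where "Ok' = {z \<in> Ok. satisfiable S (P (fst z))}"

  have conN: "computable_on X cs \<Longrightarrow> computable_on X (\<lambda>x. N (cs x))" for X :: "'a::goedel set" and cs
    unfolding N_def by (intro computable_on_Suc computable_on_add computable_on_gnum computable_on_const)
  have conP: "computable_on X cs \<Longrightarrow> computable_on X (\<lambda>x. P (cs x))" for X :: "'a::goedel set" and cs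
  proof -
    assume cs: "computable_on X cs"
    have "computable_on (X \<times> UNIV) (\<lambda>z. cs (fst z))"
      by (rule computable_on_comp[OF cs]) (intro computable_on_fst computable_on_id | auto)+
    then show ?thesis
      unfolding P_def c_def by (intro computable_on_Some computable_on_frozen computable_on_fresh_seq inf e conN computable_on_snd computable_on_id cs)
  qed
  have val: "computable_on (Ok' \<times> UNIV) (\<lambda>z. val (fst (fst z)) (snd z))"
  proof -
    have "computable_on {(P, x). problem_ok S P \<and> satisfiable S P} (\<lambda>z. mgs (fst z) (snd z))"
      using mgs_computable by (simp add: case_prod_beta')
    then have "computable_on (Ok' \<times> UNIV) (\<lambda>z. mgs (P (fst (fst z))) (snd z))"
      by (rule computable_on_comp2) (intro conP computable_on_fst computable_on_snd computable_on_id | auto simp: Ok'_def dest: P_ok)+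
    then show ?thesis
      unfolding val_def least_solution_def c_def
      by (intro computable_on_map_option computable_on_unfreeze computable_on_ssub computable_on_fresh_seq inf e conN
          computable_on_fst computable_on_snd computable_on_id computable_on_const)
  qed
  have decr: "computable_on Ok' (\<lambda>z. decr S f \<phi> (val (fst z)) (snd z))"
  \<comment> \<open>If \<open>\<phi>\<close> is infinite on some variable of \<open>f\<close>, no
    decrease condition can hold and only the empty list passes. The distinction depends on the fixed
    \<open>f\<close> and \<open>\<phi>\<close> alone, so the procedure need not make it.\<close>
  proof (cases "\<exists>bs. map \<phi> (alpha S f) = map Fin bs")
    case False
    have "computable_on Ok' (\<lambda>z. snd z = [])"
      by (intro computable_on_eq computable_on_snd computable_on_id computable_on_const)
    moreover have "decr S f \<phi> \<Psi> ds \<longleftrightarrow> ds = []" for \<Psi> ds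
      using False by (cases ds) (auto simp: decr_def)
    ultimately show ?thesis by simp
  next
    case True
    then obtain bs where bs: "map \<phi> (alpha S f) = map Fin bs" by blast
    have bs_vec: "bs \<in> vecs S f"
    proof -
      have "length bs = q S f" using alpha[OF f] arg_cong[OF bs, of length] by simp
      moreover have "b \<in> sizes S" if "b \<in> set bs" for b
      proof -
        have "Fin b \<in> set (map \<phi> (alpha S f))" using that bs by simp
        then obtain x where "\<phi> x = Fin b" by auto
        then show ?thesis using phi unfolding ssubst_on_def by (metis Some_xsizes)
      qed
      ultimately show ?thesis by (auto simp: vecs_def)
    qed
    have iff: "decr S f \<phi> \<Psi> ds \<longleftrightarrow> list_all (\<lambda>d. list_all (\<lambda>y. \<Psi> y \<noteq> None) (snd d) \<and>
        less_A S (fst d) f (map (\<lambda>y. the (\<Psi> y)) (snd d)) bs) ds" for \<Psi> ds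
    proof -
      have "(\<exists>as bs'. map \<Psi> ys = map Fin as \<and> map \<phi> (alpha S f) = map Fin bs' \<and> less_A S g f as bs') \<longleftrightarrow>
          (\<forall>y \<in> set ys. \<Psi> y \<noteq> None) \<and> less_A S g f (map (\<lambda>y. the (\<Psi> y)) ys) bs" for g ys
      proof
        assume "\<exists>as bs'. map \<Psi> ys = map Fin as \<and> map \<phi> (alpha S f) = map Fin bs' \<and> less_A S g f as bs'"
        then obtain as where as: "map \<Psi> ys = map Fin as" "less_A S g f as bs"
          using bs by (auto dest: map_injective simp: inj_def)
        have "map (\<lambda>y. the (\<Psi> y)) ys = as"
          using arg_cong[OF as(1), of "map the"] by (simp add: comp_def)
        moreover have "\<Psi> y \<noteq> None" if "y \<in> set ys" for y
        proof -
          have "\<Psi> y \<in> set (map Fin as)" using that as(1)[symmetric] by simp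
          then show ?thesis by auto
        qed
        ultimately show "(\<forall>y \<in> set ys. \<Psi> y \<noteq> None) \<and> less_A S g f (map (\<lambda>y. the (\<Psi> y)) ys) bs"
          using as(2) by blast
      next
        assume *: "(\<forall>y \<in> set ys. \<Psi> y \<noteq> None) \<and> less_A S g f (map (\<lambda>y. the (\<Psi> y)) ys) bs"
        then have "map \<Psi> ys = map Fin (map (\<lambda>y. the (\<Psi> y)) ys)" by auto
        then show "\<exists>as bs'. map \<Psi> ys = map Fin as \<and> map \<phi> (alpha S f) = map Fin bs' \<and> less_A S g f as bs'"
          using * bs by blast
      qed
      then show ?thesis
        unfolding decr_def by (auto simp: list_all_iff)
    qed
    let ?D = "{(z, d). z \<in> Ok' \<and> d \<in> set (snd z)}"
    have val_D: "computable_on {(x, y). x \<in> Y \<and> y \<in> set (snd (snd x))} (\<lambda>x. val (fst (fst (fst x))) (snd x))"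
      if "Y \<subseteq> ?D" for Y
      by (rule computable_on_comp2[OF val]) (intro computable_on_fst computable_on_snd computable_on_id | use that in auto)+
    \<comment> \<open>The procedure for \<open>less_A\<close> accepts finite vectors only, so
      finiteness of all values is tested beforehand.\<close>
    let ?E = "{x \<in> ?D. list_all (\<lambda>y. val (fst (fst x)) y \<noteq> None) (snd (snd x))}"
    have vec: "computable_on ?E (\<lambda>x. map (\<lambda>y. the (val (fst (fst x)) y)) (snd (snd x)))"
      by (intro computable_on_map computable_on_the val_D computable_on_snd computable_on_id) (auto simp: list_all_iff)
    have "computable_on {(g, as, bs). g \<in> funs S \<and> as \<in> vecs S g \<and> bs \<in> vecs S f}
        (\<lambda>z. less_A S (fst z) f (fst (snd z)) (snd (snd z)))"
      using less_A_decidable by (simp add: decidable_on_iff case_prod_beta')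
    then have "computable_on ?E (\<lambda>x. less_A S (fst (snd x)) f (map (\<lambda>y. the (val (fst (fst x)) y)) (snd (snd x))) bs)"
    proof (rule computable_on_comp3[OF _ computable_on_fst[OF computable_on_snd[OF computable_on_id]] vec computable_on_const], goal_cases)
      case (1 x)
      then obtain cs ds g ys where x: "x = ((cs, ds), g, ys)" "(cs, ds) \<in> Ok'" "(g, ys) \<in> set ds"
        "\<forall>y \<in> set ys. val cs y \<noteq> None"
        by (auto simp: list_all_iff)
      have "the (val cs y) \<in> sizes S" if "y \<in> set ys" for y
        using val_ok[of "(cs, ds)" y] x that by (auto simp: Ok'_def)
      moreover have "g \<in> funs S" "length ys = q S g"
        using x(2,3) by (auto simp: Ok'_def Ok_def)
      ultimately show ?case using bs_vec by (auto simp: x vecs_def)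
    qed
    then show ?thesis
      unfolding iff
      by (intro computable_on_list_all computable_on_conj computable_on_not computable_on_eq val_D computable_on_snd computable_on_id computable_on_const) auto
  qed
  have chk: "computable_on Ok chk"
    unfolding chk_def
  proof (rule computable_on_conj)
    show "computable_on Ok (\<lambda>z. satisfiable S (P (fst z)))"
      by (rule computable_on_comp[OF sat_decidable[unfolded decidable_on_iff] conP]) (auto intro: P_ok computable_on_fst computable_on_id)
    show "computable_on {z \<in> Ok. satisfiable S (P (fst z))} (\<lambda>z. decr S f \<phi> (val (fst z)) (snd z))"
      using decr unfolding Ok'_def .
  qed

  let ?I = "{(L, t, T). env_ok S (map_of L) \<and> trm_ok S t \<and> aty_ok S T} :: ((nat \<times> aty) list \<times> trm \<times> aty) set"
  define prob where "prob T r = ((fst r, at_path [] T) # fst (snd r), snd (snd r))" for T and r :: constraints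
  have prob_ok: "prob T r \<in> Ok" if "(L, t, T) \<in> ?I" "gen S f t (rigid_env L) [0] 0 = Some r" for L t T r
  proof -
    obtain A cs ds where r: "r = (A, cs, ds)" by (cases r)
    have "\<forall>B \<in> ran (map_of (rigid_env L)). aty_ok S B"
      using that(1) by (auto simp: ran_def map_of_rigid_env env_ok_def intro!: aty_ok_at_path)
    from gen_ok[OF that(2)[unfolded r] _ _ this] that(1) show ?thesis
      by (auto simp: Ok_def prob_def r aty_ok_at_path)
  qed
  have correct: "typing S f \<phi> (map_of L) t T \<longleftrightarrow>
      (case gen S f t (rigid_env L) [0] 0 of None \<Rightarrow> False | Some r \<Rightarrow> chk (prob T r))"
    if I: "(L, t, T) \<in> ?I" for L t T
  proof (cases "gen S f t (rigid_env L) [0] 0")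
    case None
    then show ?thesis using I typing_iff_gen[of t f \<phi> L T] by simp
  next
    case (Some r)
    obtain A cs ds where r: "r = (A, cs, ds)" by (cases r)
    let ?cs = "(A, at_path [] T) # cs"
    have "typing S f \<phi> (map_of L) t T \<longleftrightarrow>
        (\<exists>\<Psi>. admissible S \<Psi> \<and> solves S \<Psi> ?cs \<and> decr S f \<phi> \<Psi> ds)"
      using I Some typing_iff_gen[of t f \<phi> L T] by (simp add: r)
    also have "\<dots> \<longleftrightarrow> satisfiable S (P ?cs) \<and> decr S f \<phi> (val ?cs) ds"
      unfolding val_def P_def N_def
      using prob_ok[OF I Some] c(3)[of ?cs]
      by (intro gen_solvable_iff c) (auto simp: Ok_def prob_def r N_def)
    also have "\<dots> \<longleftrightarrow> chk (prob T r)" by (simp add: chk_def prob_def r)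
    finally show ?thesis using Some by simp
  qed
  have prec: "computable_on (funs S \<times> funs S) (\<lambda>z. fless S (fst z) (snd z))"
    using prec_decidable by (simp add: decidable_on_iff case_prod_beta')
  have "computable_on ?I (\<lambda>z. (rigid_env (fst z), [0], 0, fst (snd z)))"
    by (intro computable_on_Pair computable_on_rigid_env computable_on_const computable_on_fst computable_on_snd computable_on_id)
  from computable_on_comp[OF computable_on_gen[OF effective f prec] this]
  have "computable_on ?I (\<lambda>z. gen S f (fst (snd z)) (rigid_env (fst z)) [0] 0)" by auto
  moreover have "computable_on {(z, r). z \<in> ?I \<and> gen S f (fst (snd z)) (rigid_env (fst z)) [0] 0 = Some r}
      (\<lambda>x. chk (prob (snd (snd (fst x))) (snd x)))"
  proof (rule computable_on_comp[OF chk])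
    show "computable_on {(z, r). z \<in> ?I \<and> gen S f (fst (snd z)) (rigid_env (fst z)) [0] 0 = Some r}
        (\<lambda>x. prob (snd (snd (fst x))) (snd x))"
      unfolding prob_def by (intro computable_on_Pair computable_on_Cons computable_on_at_path computable_on_const computable_on_fst computable_on_snd computable_on_id)
  qed (use prob_ok in auto)
  ultimately have "computable_on ?I (\<lambda>z. case gen S f (fst (snd z)) (rigid_env (fst z)) [0] 0 of
      None \<Rightarrow> False | Some r \<Rightarrow> chk (prob (snd (snd z)) r))"
    by (intro computable_on_case_option computable_on_const)
  then show ?thesis
    unfolding decidable_on_iff by (rule computable_on_cong) (use correct in \<open>auto split: option.splits\<close>)
qed

end
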